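(* Let $\xi\in\mathcal{A}$, $K\in\mathbb{N}$, let $f:U^{\mathbb{N}}\to\mathbb{R}$ be bounded with $f((z_i)_{i\ge1})$ independent of $(z_i)_{i>K}$, and let $\epsilon>0$. Then $$\limsup_{\delta\to0}\limsup_{n\to\infty}\frac1n\log P_0\left(\left|\int f\,\mathrm{d}\bar\nu_{n,X}^\infty-\int f\,\mathrm{d}\bar\mu_\xi^\infty\right|>\epsilon\ \middle|\ \left|\tfrac{X_n}{n}-\xi\right|\le\delta\right)<0.$$
   Context: Nearest-neighbor RWRE on $\mathbb{Z}^d$, $U:=\{z:|z_1|+\cdots+|z_d|=1\}$, environments $\omega_x=(\pi(x,x+z))_{z\in U}$ under $\mathbb{P}$; quenched law $P_0^\omega$, averaged $P_0=\int P_0^\omega\,\mathrm{d}\mathbb{P}$, expectation $E_0$; $Z_i:=X_i-X_{i-1}$. Assumptions: (A1) $\mathbb{P}$ product measure; (A2) $\mathbb{P}(\pi(0,z)\ge c_1)=1$ for all $z$, some $c_1>0$; (A3) Kalikow's condition relative to a unit vector $\hat u$: $\inf_{\mathcal{G}}\inf_{x\in\mathcal{G}}\frac{\mathbb{E}[E_0^\omega[\sum_{k=0}^{t_{\mathcal{G}}}\mathbf 1_{X_k=x}]\sum_{z}\pi(x,x+z)\langle z,\hat u\rangle]}{E_0[\sum_{k=0}^{t_{\mathcal{G}}}\mathbf 1_{X_k=x}]}>0$ (over connected strict $\mathcal{G}\ni0$, $t_{\mathcal G}$ exit time). $\Lambda_a(\theta):=\lim_n\frac1n\log E_0[\mathrm{e}^{\langle\theta,X_n\rangle}]$.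 $D:=\inf\{k\ge0:\langle X_k,\hat u\rangle<\langle X_0,\hat u\rangle\}$; $\tau_1:=\inf\{j>0:\langle X_i,\hat u\rangle<\langle X_j,\hat u\rangle\le\langle X_k,\hat u\rangle\ \forall i<j<k\}$, $\tau_{m+1}:=\inf\{j>\tau_m:\text{same condition}\}$. Nestling: convex hull of the support of the law of $\sum_z\pi(0,z)z$ contains $0$. $c_3>0$ with $E_0[\mathrm{e}^{2c_3\tau_1}]<\infty$ (non-nestling), $c_4>0$ with $E_0[\sup_{1\le n\le\tau_1}\mathrm{e}^{c_4|X_n|}]<\infty$ (nestling); $\mathcal{C}:=\{|\theta|<c_3\}$ resp. $\{|\theta|<c_4,\Lambda_a(\theta)>0\}$; $\mathcal{A}:=\{\nabla\Lambda_a(\theta):\theta\in\mathcal{C}\}$, and for $\xi\in\mathcal{A}$ there is a unique $\theta\in\mathcal{C}$ with $\xi=\nabla\Lambda_a(\theta)$. $\bar\mu_\xi^\infty$ is the measure on $U^{\mathbb{N}}$ with $\int f\,\mathrm{d}\bar\mu_\xi^\infty=\frac{E_0[\sum_{j=0}^{\tau_1-1}f((Z_{j+i})_{i\ge1})\mathrm{e}^{\langle\theta,X_{\tau_K}\rangle-\Lambda_a(\theta)\tau_K}\mid D=\infty]}{E_0[\tau_1\mathrm{e}^{\langle\theta,X_{\tau_1}\rangle-\Lambda_a(\theta)\tau_1}\mid D=\infty]}$ for every $K$ and bounded $f$ depending only on $(z_i)_{i\le K}$. $\bar\nu_{n,X}^\infty:=\frac1n\sum_{j=0}^{n-1}\delta_{(Z_{j+i})_{i\ge1}}$.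 *)

theory Defs
  imports "HOL-Probability.Probability" "HOL-Library.Extended_Nat"
begin

text \<open>Lattice points of Z^d are int^'d, vectors of R^d are real^'d ('d finite, d = CARD('d)).
  A site transition vector p :: int^'d => real gives p z = pi(x, x+z);
  an environment is omega :: int^'d => int^'d => real, omega x z = pi(x,x+z).
  Paths are position sequences X :: nat => int^'d.\<close>

definition rv :: "int^'d \<Rightarrow> real^'d" where
  "rv x = (\<chi> i. real_of_int (x $ i))"

definition nnU :: "(int^'d) set" where
  "nnU = {z. (\<Sum>i\<in>UNIV. \<bar>z $ i\<bar>) = 1}"

definition trans_simplex :: "(int^'d \<Rightarrow> real) set" where
  "trans_simplex = {p. (\<forall>z. 0 \<le> p z) \<and> (\<forall>z. z \<notin> nnU \<longrightarrow> p z = 0) \<and> (\<Sum>z\<in>nnU. p z) = 1}"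

definition siteM :: "(int^'d \<Rightarrow> real) measure" where
  "siteM = PiM UNIV (\<lambda>_. borel)"

definition envM :: "(int^'d \<Rightarrow> int^'d \<Rightarrow> real) measure" where
  "envM = PiM UNIV (\<lambda>_. siteM)"

definition pathM :: "(nat \<Rightarrow> int^'d) measure" where
  "pathM = PiM UNIV (\<lambda>_. count_space UNIV)"

definition envlaw :: "(int^'d \<Rightarrow> real) measure \<Rightarrow> (int^'d \<Rightarrow> int^'d \<Rightarrow> real) measure" where
  "envlaw \<mu> = PiM UNIV (\<lambda>_. \<mu>)"

definition is_quenched_law ::
  "((int^'d \<Rightarrow> int^'d \<Rightarrow> real) \<Rightarrow> (nat \<Rightarrow> int^'d) measure) \<Rightarrow> bool" where
  "is_quenched_law Pq \<longleftrightarrow>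
     Pq \<in> envM \<rightarrow>\<^sub>M prob_algebra pathM \<and>
     (\<forall>\<omega>\<in>space envM. (\<forall>y. \<omega> y \<in> trans_simplex) \<longrightarrow>
        (\<forall>n x. emeasure (Pq \<omega>) {X\<in>space pathM. \<forall>i\<le>n. X i = x i} =
               ennreal (if x 0 = 0 then (\<Prod>i<n. \<omega> (x i) (x (Suc i) - x i)) else 0)))"

definition annealed :: "(int^'d \<Rightarrow> real) measure \<Rightarrow>
     ((int^'d \<Rightarrow> int^'d \<Rightarrow> real) \<Rightarrow> (nat \<Rightarrow> int^'d) measure) \<Rightarrow> (nat \<Rightarrow> int^'d) measure" where
  "annealed \<mu> Pq = bind (envlaw \<mu>) Pq"

definition drift :: "(int^'d \<Rightarrow> real) \<Rightarrow> real^'d" where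
  "drift p = (\<Sum>z\<in>nnU. p z *\<^sub>R rv z)"

definition measure_support :: "(real^'d) measure \<Rightarrow> (real^'d) set" where
  "measure_support M = {v. \<forall>e>0. emeasure M (ball v e) > 0}"

definition nestling :: "(int^'d \<Rightarrow> real) measure \<Rightarrow> bool" where
  "nestling \<mu> \<longleftrightarrow> (0::real^'d) \<in> convex hull (measure_support (distr \<mu> borel drift))"

definition Lambda_a :: "(nat \<Rightarrow> int^'d) measure \<Rightarrow> real^'d \<Rightarrow> real" where
  "Lambda_a P0 \<theta> = lim (\<lambda>n. ln (\<integral>X. exp (\<theta> \<bullet> rv (X n)) \<partial>P0) / real n)"

definition lat_connected :: "(int^'d) set \<Rightarrow> bool" where
  "lat_connected G \<longleftrightarrow> (\<forall>y\<in>G. \<exists>p n. p 0 = 0 \<and> p n = y \<and> (\<forall>k\<le>n. p k \<in> G) \<and>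
                                      (\<forall>k<n. p (Suc k) - p k \<in> nnU))"

text \<open>sum_{k=0}^{t_G} 1_{X_k = x}, with t_G the exit time from G.\<close>
definition local_time :: "(int^'d) set \<Rightarrow> int^'d \<Rightarrow> (nat \<Rightarrow> int^'d) \<Rightarrow> ennreal" where
  "local_time G x X = (\<Sum>k. if (\<forall>m<k. X m \<in> G) \<and> X k = x then 1 else 0)"

definition kalikow :: "(int^'d \<Rightarrow> real) measure \<Rightarrow>
     ((int^'d \<Rightarrow> int^'d \<Rightarrow> real) \<Rightarrow> (nat \<Rightarrow> int^'d) measure) \<Rightarrow> real^'d \<Rightarrow> bool" where
  "kalikow \<mu> Pq u \<longleftrightarrow> (\<exists>\<kappa>>0. \<forall>G. 0 \<in> G \<and> G \<noteq> UNIV \<and> lat_connected G \<longrightarrow>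
     (\<forall>x\<in>G. \<kappa> \<le>
        (\<integral>\<omega>. enn2real (\<integral>\<^sup>+X. local_time G x X \<partial>Pq \<omega>) * (\<Sum>z\<in>nnU. \<omega> x z * (rv z \<bullet> u)) \<partial>envlaw \<mu>)
        / enn2real (\<integral>\<^sup>+X. local_time G x X \<partial>annealed \<mu> Pq)))"

definition regen :: "real^'d \<Rightarrow> (nat \<Rightarrow> int^'d) \<Rightarrow> nat \<Rightarrow> bool" where
  "regen u X j \<longleftrightarrow> 0 < j \<and> (\<forall>i<j. u \<bullet> rv (X i) < u \<bullet> rv (X j)) \<and>
                   (\<forall>k>j. u \<bullet> rv (X j) \<le> u \<bullet> rv (X k))"

primrec tau :: "real^'d \<Rightarrow> (nat \<Rightarrow> int^'d) \<Rightarrow> nat \<Rightarrow> enat" where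
  "tau u X 0 = 0"
| "tau u X (Suc m) = (case tau u X m of
       \<infinity> \<Rightarrow> \<infinity>
     | enat t \<Rightarrow> (if \<exists>j>t. regen u X j then enat (LEAST j. t < j \<and> regen u X j) else \<infinity>))"

definition Dinf :: "real^'d \<Rightarrow> (nat \<Rightarrow> int^'d) \<Rightarrow> bool" where
  "Dinf u X \<longleftrightarrow> (\<forall>k. u \<bullet> rv (X 0) \<le> u \<bullet> rv (X k))"

definition condE :: "(nat \<Rightarrow> int^'d) measure \<Rightarrow> real^'d \<Rightarrow> ((nat \<Rightarrow> int^'d) \<Rightarrow> real) \<Rightarrow> real" where
  "condE P0 u F = (\<integral>X. F X * indicator {X. Dinf u X} X \<partial>P0) / measure P0 {X\<in>space P0. Dinf u X}"

definition condprob :: "'a measure \<Rightarrow> 'a set \<Rightarrow> 'a set \<Rightarrow> real" where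
  "condprob M A B = measure M (A \<inter> B \<inter> space M) / measure M (B \<inter> space M)"

text \<open>(Z_{j+i})_{i>=1}, reindexed from 0: stepseq X j i = Z_{j+i+1}.\<close>
definition stepseq :: "(nat \<Rightarrow> int^'d) \<Rightarrow> nat \<Rightarrow> nat \<Rightarrow> int^'d" where
  "stepseq X j = (\<lambda>i. X (j + i + 1) - X (j + i))"

definition nu_int :: "nat \<Rightarrow> ((nat \<Rightarrow> int^'d) \<Rightarrow> real) \<Rightarrow> (nat \<Rightarrow> int^'d) \<Rightarrow> real" where
  "nu_int n f X = (\<Sum>j<n. f (stepseq X j)) / real n"

text \<open>integral of f against mu_xi (theta the parameter with xi = grad Lambda_a theta), for f
  depending only on the first K steps.\<close>
definition mu_int :: "(nat \<Rightarrow> int^'d) measure \<Rightarrow> real^'d \<Rightarrow> real^'d \<Rightarrow> nat \<Rightarrow>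
     ((nat \<Rightarrow> int^'d) \<Rightarrow> real) \<Rightarrow> real" where
  "mu_int P0 u \<theta> K f =
     condE P0 u (\<lambda>X. case tau u X 1 of
         \<infinity> \<Rightarrow> 0
       | enat t1 \<Rightarrow> (case tau u X K of
             \<infinity> \<Rightarrow> 0
           | enat tK \<Rightarrow> (\<Sum>j<t1. f (stepseq X j)) *
                          exp (\<theta> \<bullet> rv (X tK) - Lambda_a P0 \<theta> * real tK)))
   / condE P0 u (\<lambda>X. case tau u X 1 of
         \<infinity> \<Rightarrow> 0
       | enat t1 \<Rightarrow> real t1 * exp (\<theta> \<bullet> rv (X t1) - Lambda_a P0 \<theta> * real t1))"

definition Cset :: "(int^'d \<Rightarrow> real) measure \<Rightarrow> (nat \<Rightarrow> int^'d) measure \<Rightarrow> real \<Rightarrow> real \<Rightarrow> (real^'d) set" where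
  "Cset \<mu> P0 c3 c4 = (if nestling \<mu> then {\<theta>. norm \<theta> < c4 \<and> Lambda_a P0 \<theta> > 0}
                                     else {\<theta>. norm \<theta> < c3})"

definition eln :: "real \<Rightarrow> ereal" where
  "eln x = (if 0 < x then ereal (ln x) else -\<infinity>)"

end

theory Submission
  imports Defs "HOL-Real_Asymp.Real_Asymp"
begin

text \<open>Weight a finite path \<open>w\<close> by its averaged probability \<open>W w\<close>. Since the environment is a product
  measure, \<open>W\<close> is multiplicative under concatenation of paths visiting disjoint sets of sites; in
  particular, given \<open>Dinf\<close>, the pieces of the trajectory between regeneration times (blocks) are
  independent with law \<open>W\<close>. Tilting this block law by \<open>exp (\<theta> \<bullet> x - \<Lambda> t)\<close>, where \<open>\<Lambda> = Lambda_a P0 \<theta>\<close>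
  is the normalising root, turns it into a probability measure \<open>\<gamma>\<close> under which \<open>mu_int\<close> is the mean
  of \<open>f\<close> per unit time.

  The numerator of the conditional probability is controlled by an exponential Chebyshev bound:
  splitting a path at its last regeneration time before \<open>n\<close> reduces the exponential moment of the sum
  of \<open>f - m\<close> along the path to moments over long strings of independent blocks, and these do not
  grow when \<open>m\<close> exceeds the mean, as \<open>f\<close> looks only \<open>K\<close> steps ahead. The denominator is bounded
  below by a Gaertner-Ellis argument from the differentiability of \<open>\<Lambda>\<close> at \<open>\<theta>\<close>.

  The hypotheses only speak about \<open>\<Lambda>\<close> through \<open>lim\<close>, so existence of the limit has to be shown. It
  follows from a renewal argument except when the walk is nestling and the untilted mass of the
  blocks is at most one; there the limit is \<open>0\<close>, which contradicts \<open>\<Lambda> > 0\<close>, because traps make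
  staying near the origin cost only a subexponential factor.\<close>

subsection \<open>Finite step sequences\<close>

text \<open>The stretch after the last regeneration before n is not a block: all that is known of it
  is that no further regeneration has been seen. It is therefore measured by \<open>AA\<close>, the
  mean of the supremum of the tilted weight up to \<open>tau_1\<close>, which controls the initial
  stretch as well. On these two stretches the factor exp (s * sum) of the Chebyshev bound can only
  be estimated by exp (s * C * length); to absorb it, \<open>AA\<close> has to be finite at a rate
  strictly below \<Lambda>. This slack is the last clause of \<open>good\<close>. In the
  non-nestling case it comes from 2 * c3 against norm \<theta> < c3; in the nestling case only rates
  \<ge> 0 are controlled, and the slack is \<Lambda> itself. Up to a linear factor the numerator is
  at most exp (- n * (\<theta> \<bullet> \<xi> - norm \<theta> * \<delta> - \<Lambda> + \<kappa>)),
  and eventually the denominator is at least exp (- n * (\<theta> \<bullet> \<xi> - \<Lambda> + norm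
  \<theta> * \<delta> + \<kappa>/4)), so the quotient decays as soon as norm \<theta> * \<delta> is
  small against \<kappa>. The bound for the denominator compares \<theta> with nearby tilts, so
  \<open>good\<close> is needed on a whole neighbourhood of \<theta>.\<close>

lemma rv_0 [simp]: "rv 0 = 0"
  by (simp add: rv_def vec_eq_iff)

lemma rv_add: "rv (x + y) = rv x + rv y"
  by (simp add: rv_def vec_eq_iff)

lemma rv_diff: "rv (x - y) = rv x - rv y"
  by (simp add: rv_def vec_eq_iff)

lemma inj_on_append:
  assumes "\<And>w. w \<in> A \<Longrightarrow> length w = m"
  shows "inj_on (\<lambda>(w, v). w @ v) (A \<times> B)"
proof (rule inj_onI, clarify)
  fix w v w' v'
  assume "w \<in> A" "w' \<in> A" "w @ v = w' @ v'"
  then show "w = w' \<and> v = v'" using assms by (metis append_eq_append_conv)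
qed

text \<open>Beyond the end of \<open>w\<close>, \<open>take\<close> returns \<open>w\<close> itself,
  so the level stays constant there and bounds on levels hold for every index.\<close>

definition lev :: "real^'d \<Rightarrow> (int^'d) list \<Rightarrow> nat \<Rightarrow> real" where
  "lev u w i = u \<bullet> rv (sum_list (take i w))"

lemma lev_0 [simp]: "lev u w 0 = 0"
  by (simp add: lev_def)

lemma lev_append: "lev u (w @ v) i = lev u w i + lev u v (i - length w)"
  by (simp add: lev_def rv_add inner_add_right)

lemma lev_ge_length: "length w \<le> i \<Longrightarrow> lev u w i = lev u w (length w)"
  by (simp add: lev_def)

lemma lev_take: "i \<le> n \<Longrightarrow> lev u (take n w) i = lev u w i"
  by (simp add: lev_def min_def)

text \<open>\<open>record_end\<close> and \<open>nonneg_path\<close> are the past and the future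
  half of \<open>regen\<close>: strict before, weak after. This asymmetry makes the sites left by a
  record word disjoint from those left by a nonnegative continuation, even when levels tie.\<close>

definition record_end :: "real^'d \<Rightarrow> (int^'d) list \<Rightarrow> bool" where
  "record_end u w \<longleftrightarrow> (\<forall>i<length w. lev u w i < lev u w (length w))"

definition nonneg_path :: "real^'d \<Rightarrow> (int^'d) list \<Rightarrow> bool" where
  "nonneg_path u w \<longleftrightarrow> (\<forall>i\<le>length w. 0 \<le> lev u w i)"

text \<open>A regeneration time as far as the finite word can tell; \<open>prereg_iff_regen\<close>
  says when the rest of the trajectory confirms it.\<close>

definition prereg :: "real^'d \<Rightarrow> (int^'d) list \<Rightarrow> nat \<Rightarrow> bool" where
  "prereg u w j \<longleftrightarrow> 0 < j \<and> (\<forall>i<j. lev u w i < lev u w j) \<and>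
     (\<forall>k. j < k \<and> k \<le> length w \<longrightarrow> lev u w j \<le> lev u w k)"

text \<open>These are the words a trajectory can trace up to \<open>tau_1\<close>. They may dip
  below the starting level; between later regeneration times this cannot happen, whence the extra
  condition in \<open>blocks\<close>.\<close>

definition first_blocks :: "real^'d \<Rightarrow> (int^'d) list set" where
  "first_blocks u = {w. w \<noteq> [] \<and> set w \<subseteq> nnU \<and> record_end u w \<and> (\<forall>j<length w. \<not> prereg u w j)}"

definition blocks :: "real^'d \<Rightarrow> (int^'d) list set" where
  "blocks u = {w\<in>first_blocks u. nonneg_path u w}"

lemma record_end_Nil [simp]: "record_end u []"
  by (simp add: record_end_def)

lemma nonneg_path_Nil [simp]: "nonneg_path u []"
  by (simp add: nonneg_path_def)

lemma nonneg_path_lev: "nonneg_path u w \<Longrightarrow> 0 \<le> lev u w i"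
  by (metis lev_ge_length nonneg_path_def nle_le)

lemma record_end_lev: "record_end u w \<Longrightarrow> lev u w i \<le> lev u w (length w)"
  by (metis record_end_def lev_ge_length less_le_not_le linorder_not_le nle_le)

lemma nonneg_path_append:
  "nonneg_path u w \<Longrightarrow> nonneg_path u v \<Longrightarrow> nonneg_path u (w @ v)"
  by (simp add: nonneg_path_def[of u "w @ v"] lev_append nonneg_path_lev)

lemma record_end_append:
  assumes "record_end u w" "record_end u v" "nonneg_path u v"
  shows "record_end u (w @ v)"
  unfolding record_end_def
proof (intro allI impI)
  fix i assume i: "i < length (w @ v)"
  show "lev u (w @ v) i < lev u (w @ v) (length (w @ v))"
  proof (cases "i < length w")
    case True
    then have "lev u w i < lev u w (length w)"
      using assms(1) by (simp add: record_end_def)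
    then show ?thesis
      using True nonneg_path_lev[OF assms(3), of "length v"]
      by (simp add: lev_append lev_ge_length[of w "length w + length v"])
  next
    case False
    then have "lev u v (i - length w) < lev u v (length v)"
      using i assms(2) by (auto simp: record_end_def)
    then show ?thesis
      using False by (simp add: lev_append lev_ge_length[of w "length w + length v"] lev_ge_length[of w i])
  qed
qed

lemma nonneg_path_take: "nonneg_path u w \<Longrightarrow> nonneg_path u (take n w)"
  by (auto simp: nonneg_path_def lev_take)

lemma concat_blocks:
  assumes "bs \<in> lists (blocks u)"
  shows "nonneg_path u (concat bs) \<and> record_end u (concat bs) \<and> set (concat bs) \<subseteq> nnU"
  using assms
proof (induction bs)
  case (Cons b bs)
  then show ?case
    by (auto simp: blocks_def first_blocks_def intro: nonneg_path_append record_end_append)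
qed auto

text \<open>If \<open>b\<close> were a proper prefix of \<open>b'\<close>, the rest of
  \<open>b'\<close> would begin the nonnegative word \<open>v\<close>, and \<open>length b\<close>
  would be a forbidden pre-regeneration time of \<open>b'\<close>.\<close>

lemma first_block_prefix_aux:
  assumes eq: "b @ v = b' @ v'" and b: "b \<in> first_blocks u" "b' \<in> first_blocks u"
    and v: "nonneg_path u v" and le: "length b \<le> length b'"
  shows "b = b'"
proof (rule ccontr)
  assume ne: "b \<noteq> b'"
  obtain c where c: "b' = b @ c" "v = c @ v'"
    using eq le by (auto simp: append_eq_append_conv2)
  have "c \<noteq> []" using ne c by auto
  then have lt: "length b < length b'" using c by auto
  have nc: "nonneg_path u c"
    using nonneg_path_take[OF v, of "length c"] c by simp
  have "prereg u b' (length b)"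
    unfolding prereg_def
  proof (intro conjI allI impI)
    show "0 < length b" using b by (auto simp: first_blocks_def)
    fix i assume "i < length b"
    then show "lev u b' i < lev u b' (length b)"
      using b by (auto simp: first_blocks_def record_end_def c lev_append)
  next
    fix k assume "length b < k \<and> k \<le> length b'"
    then show "lev u b' (length b) \<le> lev u b' k"
      using nonneg_path_lev[OF nc] by (simp add: c lev_append lev_ge_length[of b k])
  qed
  then show False using b(2) lt by (auto simp: first_blocks_def)
qed

lemma first_block_prefix:
  assumes "b @ v = b' @ v'" "b \<in> first_blocks u" "b' \<in> first_blocks u"
    "nonneg_path u v" "nonneg_path u v'"
  shows "b = b' \<and> v = v'"
proof -
  have "b = b'"
    using first_block_prefix_aux[OF assms(1-4)]
      first_block_prefix_aux[OF assms(1)[symmetric] assms(3) assms(2) assms(5)]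
    by (metis nle_le)
  then show ?thesis using assms(1) by simp
qed

text \<open>Before nonnegative continuations blocks behave like a prefix code, so a concatenation of
  blocks can be decoded uniquely. This allows sums over lists of blocks to be read as sums over
  words.\<close>

lemma concat_blocks_inj: "inj_on concat (lists (blocks u))"
proof -
  have "bs' \<in> lists (blocks u) \<Longrightarrow> concat bs = concat bs' \<Longrightarrow> bs = bs'"
    if "bs \<in> lists (blocks u)" for bs bs'
    using that
  proof (induction bs arbitrary: bs')
    case Nil
    then show ?case
      by (cases bs') (auto simp: blocks_def first_blocks_def)
  next
    case outer: (Cons b bs)
    show ?case
    proof (cases bs')
      case Nil
      then show ?thesis using outer Nil by (auto simp: blocks_def first_blocks_def)
    next
      case (Cons b' cs)
      with outer.prems outer.hyps have "b = b' \<and> concat bs = concat cs"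
        using concat_blocks[of bs u] concat_blocks[of cs u]
        by (intro first_block_prefix[where u = u]) (auto simp: blocks_def)
      then show ?thesis using outer.IH[of cs] Cons outer.prems outer.hyps by auto
    qed
  qed
  then show ?thesis by (auto intro!: inj_onI)
qed

subsection \<open>Steps and shifts of a trajectory\<close>

definition steps :: "(nat \<Rightarrow> int^'d) \<Rightarrow> nat \<Rightarrow> (int^'d) list" where
  "steps X n = map (\<lambda>i. X (Suc i) - X i) [0..<n]"

definition pshift :: "nat \<Rightarrow> (nat \<Rightarrow> int^'d) \<Rightarrow> nat \<Rightarrow> int^'d" where
  "pshift t X = (\<lambda>i. X (t + i) - X t)"

definition nnpath :: "(nat \<Rightarrow> int^'d) \<Rightarrow> bool" where
  "nnpath X \<longleftrightarrow> X 0 = 0 \<and> (\<forall>i. X (Suc i) - X i \<in> nnU)"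

lemma length_steps [simp]: "length (steps X n) = n"
  by (simp add: steps_def)

lemma steps_0 [simp]: "steps X 0 = []"
  by (simp add: steps_def)

lemma take_steps: "i \<le> n \<Longrightarrow> take i (steps X n) = steps X i"
  by (simp add: steps_def take_map)

lemma sum_list_steps: "X 0 = 0 \<Longrightarrow> sum_list (steps X n) = X n"
  by (induction n) (simp_all add: steps_def)

lemma sum_list_take_steps: "X 0 = 0 \<Longrightarrow> i \<le> n \<Longrightarrow> sum_list (take i (steps X n)) = X i"
  by (simp add: take_steps sum_list_steps)

lemma lev_steps: "X 0 = 0 \<Longrightarrow> i \<le> n \<Longrightarrow> lev u (steps X n) i = u \<bullet> rv (X i)"
  by (simp add: lev_def sum_list_take_steps)

lemma pshift_apply_0 [simp]: "pshift t X 0 = 0"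
  by (simp add: pshift_def)

lemma pshift_shift: "pshift s (pshift t X) = pshift (t + s) X"
  by (simp add: pshift_def fun_eq_iff add.assoc)

lemma pshift_0: "X 0 = 0 \<Longrightarrow> pshift 0 X = X"
  by (simp add: pshift_def)

lemma steps_add: "steps X (t + k) = steps X t @ steps (pshift t X) k"
  by (induction k) (simp_all add: steps_def pshift_def)

lemma nnpath_shift: "nnpath X \<Longrightarrow> nnpath (pshift t X)"
  by (simp add: nnpath_def pshift_def)

lemma set_steps: "nnpath X \<Longrightarrow> set (steps X n) \<subseteq> nnU"
  by (auto simp: nnpath_def steps_def)

lemma Dinf_shift: "Dinf u (pshift t X) \<longleftrightarrow> (\<forall>k\<ge>t. u \<bullet> rv (X t) \<le> u \<bullet> rv (X k))"
proof -
  have "Dinf u (pshift t X) \<longleftrightarrow> (\<forall>k. u \<bullet> rv (X t) \<le> u \<bullet> rv (X (t + k)))"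
    by (simp add: Dinf_def pshift_def rv_diff inner_diff_right)
  also have "\<dots> \<longleftrightarrow> (\<forall>k\<ge>t. u \<bullet> rv (X t) \<le> u \<bullet> rv (X k))"
    by (auto simp: le_iff_add)
  finally show ?thesis .
qed

text \<open>Separates the past, a condition on a finite word, from the future, a condition on the
  recentred path; the factorisation of probabilities rests on this split.\<close>

lemma regen_iff:
  assumes "X 0 = 0"
  shows "regen u X t \<longleftrightarrow> 0 < t \<and> record_end u (steps X t) \<and> Dinf u (pshift t X)"
  unfolding regen_def record_end_def Dinf_shift using assms
  by (auto simp: lev_steps le_less)

lemma regen_shift:
  assumes "regen u X t" "0 < j"
  shows "regen u (pshift t X) j \<longleftrightarrow> regen u X (t + j)"
proof
  assume R: "regen u X (t + j)"
  show "regen u (pshift t X) j"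
    using R assms by (auto simp: regen_def pshift_def rv_diff inner_diff_right)
next
  assume R: "regen u (pshift t X) j"
  have 1: "u \<bullet> rv (X (t + i)) < u \<bullet> rv (X (t + j))" if "i < j" for i
    using R that by (auto simp: regen_def pshift_def rv_diff inner_diff_right)
  have 2: "u \<bullet> rv (X (t + j)) \<le> u \<bullet> rv (X (t + k))" if "k > j" for k
    using R that by (auto simp: regen_def pshift_def rv_diff inner_diff_right)
  show "regen u X (t + j)"
    unfolding regen_def
  proof (intro conjI allI impI)
    show "0 < t + j" using assms by simp
    fix i assume i: "i < t + j"
    show "u \<bullet> rv (X i) < u \<bullet> rv (X (t + j))"
    proof (cases "i < t")
      case True
      then have "u \<bullet> rv (X i) < u \<bullet> rv (X t)" using assms by (auto simp: regen_def)
      also have "\<dots> < u \<bullet> rv (X (t + j))" using 1[of 0] assms by simp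
      finally show ?thesis .
    next
      case False
      then show ?thesis using 1[of "i - t"] i by simp
    qed
  next
    fix k assume "k > t + j"
    then show "u \<bullet> rv (X (t + j)) \<le> u \<bullet> rv (X k)" using 2[of "k - t"] by simp
  qed
qed

text \<open>After time \<open>t\<close> the path stays above its level at \<open>t\<close>, which is
  above all earlier levels; so the part of \<open>regen\<close> beyond \<open>t\<close> holds by
  itself.\<close>

lemma prereg_iff_regen:
  assumes "X 0 = 0" "Dinf u (pshift t X)" "record_end u (steps X t)" "j \<le> t"
  shows "prereg u (steps X t) j \<longleftrightarrow> regen u X j"
proof
  assume P: "prereg u (steps X t) j"
  have "u \<bullet> rv (X j) \<le> u \<bullet> rv (X k)" if "k > j" for k
  proof (cases "k \<le> t")
    case True
    then show ?thesis using P that assms by (auto simp: prereg_def lev_steps)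
  next
    case False
    have "u \<bullet> rv (X j) \<le> u \<bullet> rv (X t)"
      using record_end_lev[OF assms(3), of j] assms by (simp add: lev_steps)
    also have "\<dots> \<le> u \<bullet> rv (X k)" using assms(2) False by (auto simp: Dinf_shift)
    finally show ?thesis .
  qed
  then show "regen u X j"
    using P assms by (auto simp: prereg_def regen_def lev_steps)
next
  assume "regen u X j"
  then show "prereg u (steps X t) j"
    using assms by (auto simp: prereg_def regen_def lev_steps)
qed

declare tau.simps(2) [simp del]

lemma tau_1: "tau u X (Suc 0) = (if \<exists>j. regen u X j then enat (LEAST j. regen u X j) else \<infinity>)"
proof -
  have "0 < j \<and> regen u X j \<longleftrightarrow> regen u X j" for j
    by (auto simp: regen_def)
  then show ?thesis unfolding tau.simps zero_enat_def enat.case by simp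
qed

lemma tau_1_eq_iff: "tau u X (Suc 0) = enat t \<longleftrightarrow> regen u X t \<and> (\<forall>j<t. \<not> regen u X j)"
proof
  assume "tau u X (Suc 0) = enat t"
  then have "(\<exists>j. regen u X j) \<and> t = (LEAST j. regen u X j)"
    by (auto simp: tau_1 split: if_splits)
  then show "regen u X t \<and> (\<forall>j<t. \<not> regen u X j)"
    by (auto dest: not_less_Least intro: LeastI)
next
  assume A: "regen u X t \<and> (\<forall>j<t. \<not> regen u X j)"
  then have "(LEAST j. regen u X j) = t"
    by (intro Least_equality) (auto simp: not_less[symmetric])
  then show "tau u X (Suc 0) = enat t" using A by (auto simp: tau_1)
qed

lemma tau_1_gt: "(\<forall>j\<le>n. \<not> regen u X j) \<Longrightarrow> enat n < tau u X (Suc 0)"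
proof (cases "tau u X (Suc 0)")
  case (enat t)
  assume A: "\<forall>j\<le>n. \<not> regen u X j"
  have "regen u X t" using enat by (simp only: tau_1_eq_iff)
  then have "n < t" using A by (meson not_le)
  then show ?thesis using enat by simp
qed simp

lemma tau_1_eq_first_block:
  assumes "nnpath X"
  shows "tau u X (Suc 0) = enat t \<longleftrightarrow> steps X t \<in> first_blocks u \<and> Dinf u (pshift t X)"
proof -
  have X0: "X 0 = 0" using assms by (simp add: nnpath_def)
  show ?thesis
  proof
    assume "tau u X (Suc 0) = enat t"
    then have A: "regen u X t" "\<forall>j<t. \<not> regen u X j" by (auto simp: tau_1_eq_iff)
    then have B: "0 < t" "record_end u (steps X t)" "Dinf u (pshift t X)"
      using regen_iff[of X u, OF X0] by auto
    have "\<not> prereg u (steps X t) j" if "j < t" for j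
      using A(2) that prereg_iff_regen[OF X0 B(3) B(2), of j] by simp
    then show "steps X t \<in> first_blocks u \<and> Dinf u (pshift t X)"
      using B set_steps[OF assms, of t] unfolding first_blocks_def by (auto simp: steps_def)
  next
    assume A: "steps X t \<in> first_blocks u \<and> Dinf u (pshift t X)"
    then have B: "0 < t" "record_end u (steps X t)" "Dinf u (pshift t X)"
      and C: "\<And>j. j < t \<Longrightarrow> \<not> prereg u (steps X t) j"
      by (auto simp: first_blocks_def steps_def)
    have "\<not> regen u X j" if "j < t" for j
      using C[OF that] that prereg_iff_regen[OF X0 B(3) B(2), of j] by simp
    moreover have "regen u X t" using B regen_iff[of X u t, OF X0] by blast
    ultimately show "tau u X (Suc 0) = enat t"
      unfolding tau_1_eq_iff by blast
  qed
qed

lemma nonneg_path_steps: "X 0 = 0 \<Longrightarrow> Dinf u X \<Longrightarrow> nonneg_path u (steps X t)"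
  by (auto simp: nonneg_path_def lev_steps Dinf_def)

text \<open>Induction on \<open>t\<close>: cut at the last regeneration time before
  \<open>t\<close>. The stretch from there to \<open>t\<close> contains no regeneration time in its
  interior and never goes below its start, so it is a block.\<close>

lemma regen_decomposition:
  assumes "nnpath X" "regen u X t"
  shows "\<exists>b\<in>first_blocks u. \<exists>bs\<in>lists (blocks u). steps X t = b @ concat bs"
  using assms(2)
proof (induction t rule: less_induct)
  case (less t)
  have X0: "X 0 = 0" using assms by (simp add: nnpath_def)
  show ?case
  proof (cases "\<exists>j<t. regen u X j")
    case False
    then have "tau u X (Suc 0) = enat t" using less.prems by (simp add: tau_1_eq_iff)
    then have "steps X t \<in> first_blocks u" using tau_1_eq_first_block[OF assms(1)] by simp
    show ?thesis
      by (rule bexI[where x = "steps X t"], rule bexI[where x = "[]"])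
        (simp_all add: \<open>steps X t \<in> first_blocks u\<close>)
  next
    case True
    \<comment> \<open>Taking the last earlier regeneration time makes \<open>t - s\<close> the first
      regeneration time of the recentred path.\<close>
    define s where "s = (GREATEST j. j < t \<and> regen u X j)"
    have s: "s < t \<and> regen u X s"
      unfolding s_def using True by (rule GreatestI_ex_nat[where b = t]) auto
    have smax: "j \<le> s" if "j < t" "regen u X j" for j
      unfolding s_def using conjI[OF that] by (rule Greatest_le_nat[where b = t]) auto
    obtain b bs where b: "b \<in> first_blocks u" "bs \<in> lists (blocks u)" "steps X s = b @ concat bs"
      using less.IH[of s] s by blast
    define Y where "Y = pshift s X"
    have Y: "nnpath Y" "Dinf u Y"
      using assms s regen_iff[of X u, OF X0] by (auto simp: Y_def nnpath_shift)
    have "tau u Y (Suc 0) = enat (t - s)"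
      unfolding tau_1_eq_iff
    proof (intro conjI allI impI)
      show "regen u Y (t - s)"
        using regen_shift[of u X s "t - s"] s less.prems by (auto simp: Y_def)
      fix j assume j: "j < t - s"
      show "\<not> regen u Y j"
      proof
        assume R: "regen u Y j"
        then have "0 < j" by (simp add: regen_def)
        then have "regen u X (s + j)" using regen_shift[of u X s j] s R by (simp add: Y_def)
        then show False using smax[of "s + j"] j \<open>0 < j\<close> by linarith
      qed
    qed
    then have "steps Y (t - s) \<in> blocks u"
      using tau_1_eq_first_block[OF Y(1)] nonneg_path_steps[OF _ Y(2)] Y(1)
      by (auto simp: blocks_def nnpath_def)
    have eq: "steps X t = b @ concat (bs @ [steps Y (t - s)])"
      using steps_add[of X s "t - s"] s b by (simp add: Y_def)
    have mem: "bs @ [steps Y (t - s)] \<in> lists (blocks u)"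
      using b(2) \<open>steps Y (t - s) \<in> blocks u\<close> by simp
    show ?thesis
      by (rule bexI[where x = b], rule bexI[where x = "bs @ [steps Y (t - s)]"]) (fact eq mem b(1))+
  qed
qed

lemma tau_Suc_shift:
  assumes "tau u X (Suc 0) = enat t"
  shows "tau u X (Suc m) = enat t + tau u (pshift t X) m"
proof (induction m)
  case 0
  then show ?case using assms by (simp add: zero_enat_def[symmetric])
next
  case (Suc m)
  have reg: "regen u X t" using assms by (simp add: tau_1_eq_iff)
  show ?case
  proof (cases "tau u (pshift t X) m")
    case infinity
    then show ?thesis using Suc by (simp add: tau.simps(2))
  next
    case (enat s)
    have eq: "(\<exists>j>t + s. regen u X j) \<longleftrightarrow> (\<exists>j>s. regen u (pshift t X) j)"
    proof
      assume "\<exists>j>t + s. regen u X j"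
      then obtain j where "j > t + s" "regen u X j" by auto
      then show "\<exists>j>s. regen u (pshift t X) j"
        using regen_shift[OF reg, of "j - t"] by (intro exI[of _ "j - t"]) auto
    next
      assume "\<exists>j>s. regen u (pshift t X) j"
      then obtain j where "j > s" "regen u (pshift t X) j" by auto
      then show "\<exists>j>t + s. regen u X j"
        using regen_shift[OF reg, of "j"] by (intro exI[of _ "t + j"]) auto
    qed
    have "(LEAST j. t + s < j \<and> regen u X j) = t + (LEAST j. s < j \<and> regen u (pshift t X) j)"
      if ex: "\<exists>j>s. regen u (pshift t X) j"
    proof (rule Least_equality)
      define l where "l = (LEAST j. s < j \<and> regen u (pshift t X) j)"
      have l: "s < l \<and> regen u (pshift t X) l"
        unfolding l_def by (rule LeastI_ex) (use ex in auto)
      then show "t + s < t + l \<and> regen u X (t + l)"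
        using regen_shift[OF reg, of l] by auto
      fix y assume y: "t + s < y \<and> regen u X y"
      then have "s < y - t \<and> regen u (pshift t X) (y - t)"
        using regen_shift[OF reg, of "y - t"] by auto
      then have "l \<le> y - t" unfolding l_def by (rule Least_le)
      then show "t + l \<le> y" using y by auto
    qed
    then show ?thesis using Suc enat eq by (simp add: tau.simps(2))
  qed
qed

text \<open>If the regeneration times run out, the list stops short of \<open>K\<close> entries;
  hence the condition on the length in \<open>blk_eqD\<close>.\<close>

primrec blk :: "real^'d \<Rightarrow> nat \<Rightarrow> (nat \<Rightarrow> int^'d) \<Rightarrow> (int^'d) list list" where
  "blk u 0 X = []"
| "blk u (Suc K) X = (case tau u X (Suc 0) of \<infinity> \<Rightarrow> [] | enat t \<Rightarrow> steps X t # blk u K (pshift t X))"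

text \<open>Together with \<open>blk_eqD\<close>: on \<open>Dinf\<close>, prescribing the first
  blocks amounts to a cylinder followed by \<open>Dinf\<close> for the recentred path, an event
  whose probability \<open>regen_emeasure\<close> computes.\<close>

lemma blk_eqI:
  assumes "nnpath X" "bs \<in> lists (blocks u)" "steps X (length (concat bs)) = concat bs"
    "Dinf u (pshift (length (concat bs)) X)"
  shows "blk u (length bs) X = bs \<and> tau u X (length bs) = enat (length (concat bs)) \<and> Dinf u X"
  using assms
proof (induction bs arbitrary: X)
  case Nil
  then show ?case by (simp add: zero_enat_def[symmetric] nnpath_def pshift_0)
next
  case (Cons b bs)
  define Y where "Y = pshift (length b) X"
  have st: "steps X (length b) = b" "steps Y (length (concat bs)) = concat bs"
    using Cons.prems(3) by (auto simp: steps_add Y_def)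
  have IH: "blk u (length bs) Y = bs \<and> tau u Y (length bs) = enat (length (concat bs)) \<and> Dinf u Y"
  proof (rule Cons.IH)
    show "nnpath Y" using Cons.prems(1) by (simp add: Y_def nnpath_shift)
    show "bs \<in> lists (blocks u)" using Cons.prems(2) by simp
    show "steps Y (length (concat bs)) = concat bs" by (rule st(2))
    show "Dinf u (pshift (length (concat bs)) Y)"
      using Cons.prems(4) by (simp add: Y_def pshift_shift)
  qed
  then have t1: "tau u X (Suc 0) = enat (length b)"
    using tau_1_eq_first_block[OF Cons.prems(1), of u "length b"] Cons.prems(2) st(1)
    by (simp add: Y_def blocks_def)
  have X0: "X 0 = 0" using Cons.prems by (simp add: nnpath_def)
  have b: "b \<in> blocks u" using Cons.prems by simp
  have "Dinf u X"
    unfolding Dinf_def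
  proof
    fix k
    show "u \<bullet> rv (X 0) \<le> u \<bullet> rv (X k)"
    proof (cases "k \<le> length b")
      case True
      then show ?thesis
        using b lev_steps[of X, OF X0 True, of u] st nonneg_path_lev[of u b k] X0 by (auto simp: blocks_def)
    next
      case False
      have "u \<bullet> rv (X (length b)) \<le> u \<bullet> rv (X k)"
        using IH False by (auto simp: Y_def Dinf_shift)
      moreover have "0 \<le> u \<bullet> rv (X (length b))"
        using b lev_steps[of X, OF X0 order_refl, of u "length b"] st nonneg_path_lev[of u b "length b"] by (auto simp: blocks_def)
      ultimately show ?thesis using X0 by simp
    qed
  qed
  moreover have "tau u X (Suc (length bs)) = enat (length b) + enat (length (concat bs))"
    using conjunct1[OF conjunct2[OF IH]] tau_Suc_shift[OF t1, of "length bs"] by (simp only: Y_def)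
  moreover have "blk u (Suc (length bs)) X = b # bs"
    unfolding blk.simps t1 enat.case using conjunct1[OF IH] st(1) by (simp add: Y_def)
  ultimately show ?case by (simp del: blk.simps)
qed

lemma blk_eqD:
  assumes "nnpath X" "Dinf u X" "blk u K X = bs" "length bs = K"
  shows "bs \<in> lists (blocks u) \<and> steps X (length (concat bs)) = concat bs \<and>
    Dinf u (pshift (length (concat bs)) X)"
  using assms
proof (induction K arbitrary: X bs)
  case 0
  then show ?case by (simp add: nnpath_def pshift_0)
next
  case (Suc K)
  obtain t where t: "tau u X (Suc 0) = enat t"
    using Suc.prems by (cases "tau u X (Suc 0)") auto
  then have bs: "bs = steps X t # blk u K (pshift t X)"
    using Suc.prems by simp
  have A: "steps X t \<in> first_blocks u \<and> Dinf u (pshift t X)"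
    using t tau_1_eq_first_block[OF Suc.prems(1)] by simp
  have "nonneg_path u (steps X t)"
    using Suc.prems by (auto intro!: nonneg_path_steps simp: nnpath_def)
  then have B: "steps X t \<in> blocks u" using A by (simp add: blocks_def)
  define cs where "cs = blk u K (pshift t X)"
  have len: "length cs = K" using Suc.prems(4) bs by (simp add: cs_def)
  have IH: "cs \<in> lists (blocks u) \<and> steps (pshift t X) (length (concat cs)) = concat cs \<and>
    Dinf u (pshift (length (concat cs)) (pshift t X))"
    by (rule Suc.IH[OF nnpath_shift[OF Suc.prems(1)] _ _ len]) (simp_all add: A cs_def)
  have "bs = steps X t # cs" using bs by (simp add: cs_def)
  then show ?case using B IH by (simp add: steps_add pshift_shift)
qed

subsection \<open>The averaged law on finite paths\<close>

lemma finite_nnU: "finite (nnU :: (int^'d::finite) set)"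
proof -
  have "nnU \<subseteq> vec_lambda ` (PiE UNIV (\<lambda>_::'d. {-1..1::int}))"
  proof
    fix z :: "int^'d" assume z: "z \<in> nnU"
    have "\<bar>z $ i\<bar> \<le> 1" for i
    proof -
      have "\<bar>z $ i\<bar> \<le> (\<Sum>i\<in>UNIV. \<bar>z $ i\<bar>)" by (rule member_le_sum) auto
      then show ?thesis using z by (simp add: nnU_def)
    qed
    then have "(\<lambda>i. z $ i) \<in> PiE UNIV (\<lambda>_::'d. {-1..1::int})" by (auto simp: abs_le_iff)
    moreover have "z = vec_lambda (\<lambda>i. z $ i)" by simp
    ultimately show "z \<in> vec_lambda ` (PiE UNIV (\<lambda>_::'d. {-1..1::int}))" by blast
  qed
  then show ?thesis by (rule finite_subset) (intro finite_imageI finite_PiE, auto)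
qed

lemma space_siteM [simp]: "space siteM = UNIV"
  by (simp add: siteM_def space_PiM)

lemma space_envM [simp]: "space envM = UNIV"
  by (simp add: envM_def space_PiM)

lemma space_pathM [simp]: "space pathM = UNIV"
  by (simp add: pathM_def space_PiM)

lemma measurable_coord [measurable]: "(\<lambda>X. X k) \<in> pathM \<rightarrow>\<^sub>M count_space UNIV"
  unfolding pathM_def by measurable

lemma measurable_steps [measurable]:
  "(\<lambda>X :: nat \<Rightarrow> int^'d::finite. steps X n) \<in> pathM \<rightarrow>\<^sub>M count_space UNIV"
proof (induction n)
  case (Suc n)
  have *: "(\<lambda>X :: nat \<Rightarrow> int^'d. steps X (Suc n)) = (\<lambda>X. steps X n @ [X (Suc n) - X n])"
    by (simp add: steps_def)
  have 1: "(\<lambda>X :: nat \<Rightarrow> int^'d. X (Suc n) - X n) \<in> pathM \<rightarrow>\<^sub>M count_space UNIV"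
    by (rule measurable_compose_countable[OF _ measurable_coord, where f = "\<lambda>a X. a - X n"])
      (rule measurable_compose[OF measurable_coord], simp)
  show ?case unfolding *
    by (rule measurable_compose_countable[OF _ Suc, where f = "\<lambda>w X. w @ [X (Suc n) - X n]"])
      (rule measurable_compose[OF 1], simp)
qed (simp add: steps_def)

text \<open>The starting point belongs to the event because \<open>steps\<close> records increments
  only.\<close>

definition cyl :: "(int^'d) list \<Rightarrow> (nat \<Rightarrow> int^'d) set" where
  "cyl w = {X. X 0 = 0 \<and> steps X (length w) = w}"

lemma cyl_eq: "cyl w = {X. \<forall>i\<le>length w. X i = sum_list (take i w)}"
proof (intro set_eqI iffI)
  fix X assume "X \<in> cyl w"
  then have X: "X 0 = 0" "steps X (length w) = w" by (auto simp: cyl_def)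
  then show "X \<in> {X. \<forall>i\<le>length w. X i = sum_list (take i w)}"
    using sum_list_take_steps[of X _ "length w"] by auto
next
  fix X assume X: "X \<in> {X. \<forall>i\<le>length w. X i = sum_list (take i w)}"
  have "steps X (length w) = w"
    by (rule nth_equalityI) (use X in \<open>auto simp: steps_def take_Suc_conv_app_nth\<close>)
  then show "X \<in> cyl w" using X by (auto simp: cyl_def)
qed

lemma sets_cyl [measurable]: "cyl (w :: (int^'d::finite) list) \<in> sets pathM"
proof -
  have "{X\<in>space pathM. X 0 = (0::int^'d) \<and> steps X (length w) = w} \<in> sets pathM"
    by measurable
  then show ?thesis by (simp add: cyl_def)
qed

locale rwre =
  fixes \<mu> :: "(int^'d::finite \<Rightarrow> real) measure"
    and Pq :: "(int^'d \<Rightarrow> int^'d \<Rightarrow> real) \<Rightarrow> (nat \<Rightarrow> int^'d) measure"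
    and c1 :: real
  assumes mu_prob: "prob_space \<mu>"
    and mu_sets: "sets \<mu> = sets siteM"
    and mu_simplex: "AE p in \<mu>. p \<in> trans_simplex"
    and c1_pos: "0 < c1"
    and elliptic: "AE p in \<mu>. \<forall>z\<in>nnU. c1 \<le> p z"
    and quenched: "is_quenched_law Pq"
begin

abbreviation P0 :: "(nat \<Rightarrow> int^'d) measure" where "P0 \<equiv> annealed \<mu> Pq"

abbreviation W :: "(int^'d) list \<Rightarrow> real" where "W w \<equiv> measure P0 (cyl w)"

sublocale mu: prob_space \<mu> by (rule mu_prob)

sublocale env: product_prob_space "\<lambda>_::int^'d. \<mu>" UNIV
  by unfold_locales

lemma prob_env: "prob_space (envlaw \<mu>)"
  unfolding envlaw_def by unfold_locales

lemma sets_env: "sets (envlaw \<mu>) = sets envM"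
  unfolding envlaw_def envM_def by (rule sets_PiM_cong) (auto simp: mu_sets)

lemma space_env [simp]: "space (envlaw \<mu>) = UNIV"
  using sets_eq_imp_space_eq[OF sets_env] by simp

lemma env_in: "envlaw \<mu> \<in> space (prob_algebra envM)"
  by (simp add: space_prob_algebra prob_env sets_env)

lemma Pq_meas: "Pq \<in> envM \<rightarrow>\<^sub>M prob_algebra pathM"
  using quenched by (simp add: is_quenched_law_def)

sublocale P: prob_space P0
  unfolding annealed_def by (rule prob_space_bind'[OF env_in Pq_meas])

lemma sets_P0 [simp, measurable_cong]: "sets P0 = sets pathM"
  unfolding annealed_def by (rule sets_bind'[OF env_in Pq_meas])

lemma space_P0 [simp]: "space P0 = UNIV"
  using sets_eq_imp_space_eq[OF sets_P0] by simp

section \<open>Independence of the sites and multiplicativity of the averaged weight\<close>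

lemma AE_env:
  assumes "AE p in \<mu>. Q p"
  shows "AE \<omega> in envlaw \<mu>. \<forall>y. Q (\<omega> y)"
  unfolding AE_all_countable envlaw_def
  using assms by (auto intro!: AE_PiM_component mu_prob)

text \<open>Restriction to the finitely many coordinates in \<open>J\<close> turns the infinite
  product into a finite one, on which the integral of a product of single-site functions
  factorises.\<close>

lemma nn_integral_env_prod:
  assumes "finite J" "\<And>x. x \<in> J \<Longrightarrow> g x \<in> borel_measurable siteM"
  shows "(\<integral>\<^sup>+\<omega>. (\<Prod>x\<in>J. g x (\<omega> x)) \<partial>envlaw \<mu>) = (\<Prod>x\<in>J. \<integral>\<^sup>+p. g x p \<partial>\<mu>)"
proof -
  have g [measurable]: "\<And>x. x \<in> J \<Longrightarrow> g x \<in> borel_measurable \<mu>"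
    using assms(2) by (simp add: measurable_cong_sets[OF mu_sets refl])
  have "(\<Prod>x\<in>J. \<integral>\<^sup>+p. g x p \<partial>\<mu>) = (\<integral>\<^sup>+\<omega>. (\<Prod>x\<in>J. g x (\<omega> x)) \<partial>PiM J (\<lambda>_. \<mu>))"
    using assms(1) g by (intro env.product_nn_integral_prod[symmetric]) auto
  also have "\<dots> = (\<integral>\<^sup>+\<omega>. (\<Prod>x\<in>J. g x (\<omega> x)) \<partial>distr (PiM UNIV (\<lambda>_. \<mu>)) (PiM J (\<lambda>_. \<mu>)) (\<lambda>x. restrict x J))"
    using env.distr_PiM_restrict_finite[OF assms(1)] by simp
  also have "\<dots> = (\<integral>\<^sup>+\<omega>. (\<Prod>x\<in>J. g x (\<omega> x)) \<partial>envlaw \<mu>)"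
    unfolding envlaw_def
    by (subst nn_integral_distr)
      (auto intro!: borel_measurable_prod_ennreal nn_integral_cong prod.cong measurable_compose[OF _ g]
        measurable_restrict_subset)
  finally show ?thesis by simp
qed

lemma measurable_eval_site [measurable]: "(\<lambda>p. p z) \<in> borel_measurable siteM"
  unfolding siteM_def by measurable

lemma emeasure_P0:
  "A \<in> sets pathM \<Longrightarrow> emeasure P0 A = (\<integral>\<^sup>+\<omega>. emeasure (Pq \<omega>) A \<partial>envlaw \<mu>)"
  unfolding annealed_def by (rule emeasure_bind_prob_algebra[OF env_in Pq_meas])

lemma AE_simplex: "AE \<omega> in envlaw \<mu>. \<forall>y. \<omega> y \<in> trans_simplex"
  by (rule AE_env[OF mu_simplex])

lemma emeasure_cyl_quenched:
  assumes "\<forall>y. \<omega> y \<in> trans_simplex"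
  shows "emeasure (Pq \<omega>) (cyl w) = (\<Prod>i<length w. ennreal (\<omega> (sum_list (take i w)) (w ! i)))"
proof -
  have "emeasure (Pq \<omega>) {X\<in>space pathM. \<forall>i\<le>length w. X i = sum_list (take i w)} =
    ennreal (\<Prod>i<length w. \<omega> (sum_list (take i w)) (sum_list (take (Suc i) w) - sum_list (take i w)))"
    using quenched assms by (simp add: is_quenched_law_def)
  also have "(\<Prod>i<length w. \<omega> (sum_list (take i w)) (sum_list (take (Suc i) w) - sum_list (take i w))) =
      (\<Prod>i<length w. \<omega> (sum_list (take i w)) (w ! i))"
    by (rule prod.cong) (auto simp: take_Suc_conv_app_nth)
  finally show ?thesis
    using assms by (simp add: cyl_eq prod_ennreal trans_simplex_def)
qed

text \<open>The averaged probability of all steps that \<open>w\<close> makes from the single site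
  \<open>x\<close>. A site from which no step is made contributes 1.\<close>

definition siteW :: "(int^'d) list \<Rightarrow> int^'d \<Rightarrow> ennreal" where
  "siteW w x = (\<integral>\<^sup>+p. (\<Prod>i<length w. if sum_list (take i w) = x then ennreal (p (w ! i)) else 1) \<partial>\<mu>)"

text \<open>The sites from which a step is made. The endpoint of \<open>w\<close> is not counted for
  its final visit, because the step made there belongs to the word that follows.\<close>

definition sites :: "(int^'d) list \<Rightarrow> (int^'d) set" where
  "sites w = (\<lambda>i. sum_list (take i w)) ` {..<length w}"

text \<open>The step probabilities are regrouped by site, and distinct sites are independent. The
  freedom in \<open>J\<close> allows a concatenation to be evaluated on a union of two site
  sets.\<close>

lemma emeasure_cyl:
  assumes "finite J" "sites w \<subseteq> J"
  shows "emeasure P0 (cyl w) = (\<Prod>x\<in>J. siteW w x)"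
proof -
  have "emeasure P0 (cyl w) = (\<integral>\<^sup>+\<omega>. emeasure (Pq \<omega>) (cyl w) \<partial>envlaw \<mu>)"
    by (rule emeasure_P0) simp
  also have "\<dots> = (\<integral>\<^sup>+\<omega>. (\<Prod>i<length w. ennreal (\<omega> (sum_list (take i w)) (w ! i))) \<partial>envlaw \<mu>)"
    using AE_simplex by (intro nn_integral_cong_AE) (auto simp: emeasure_cyl_quenched)
  also have "\<dots> = (\<integral>\<^sup>+\<omega>. (\<Prod>x\<in>J. \<Prod>i<length w. if sum_list (take i w) = x then ennreal (\<omega> x (w ! i)) else 1) \<partial>envlaw \<mu>)"
  proof (intro nn_integral_cong)
    fix \<omega> :: "int^'d \<Rightarrow> int^'d \<Rightarrow> real"
    have "(\<Prod>x\<in>J. \<Prod>i<length w. if sum_list (take i w) = x then ennreal (\<omega> x (w ! i)) else 1) =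
      (\<Prod>i<length w. \<Prod>x\<in>J. if sum_list (take i w) = x then ennreal (\<omega> x (w ! i)) else 1)"
      by (rule prod.swap)
    also have "\<dots> = (\<Prod>i<length w. ennreal (\<omega> (sum_list (take i w)) (w ! i)))"
      using assms by (intro prod.cong) (auto simp: sites_def)
    finally show "(\<Prod>i<length w. ennreal (\<omega> (sum_list (take i w)) (w ! i))) =
      (\<Prod>x\<in>J. \<Prod>i<length w. if sum_list (take i w) = x then ennreal (\<omega> x (w ! i)) else 1)" ..
  qed
  also have "\<dots> = (\<Prod>x\<in>J. siteW w x)"
    unfolding siteW_def using assms(1)
    by (intro nn_integral_env_prod borel_measurable_prod_ennreal) (auto intro!: measurable_If_set)
  finally show ?thesis .
qed

lemma W_Nil [simp]: "W [] = 1"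
proof -
  have "emeasure P0 (cyl []) = 1"
    by (subst emeasure_cyl[of "{}"]) (auto simp: sites_def)
  then show ?thesis by (simp add: measure_def)
qed

text \<open>The sites left during \<open>w\<close> lie strictly below the level of its endpoint,
  those left during \<open>v\<close> at or above it. The two words thus read disjoint parts of the
  environment, and translation invariance of the environment law turns the second factor into
  \<open>W v\<close>.\<close>

lemma W_append:
  assumes rec: "record_end u w" and nn: "nonneg_path u v"
  shows "W (w @ v) = W w * W v"
proof -
  define A where "A = sites w"
  define B where "B = (+) (sum_list w) ` sites v"
  have fin: "finite A" "finite B" "finite (sites v)" by (auto simp: A_def B_def sites_def)
  have lA: "u \<bullet> rv x < u \<bullet> rv (sum_list w)" if "x \<in> A" for x
    using that rec by (auto simp: A_def sites_def record_end_def lev_def)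
  have lB: "u \<bullet> rv (sum_list w) \<le> u \<bullet> rv x" if "x \<in> B" for x
    using that nn by (auto simp: B_def sites_def nonneg_path_def lev_def rv_add inner_add_right)
  have disj: "A \<inter> B = {}" using lA lB by force
  have sub: "sites (w @ v) \<subseteq> A \<union> B"
  proof
    fix x assume "x \<in> sites (w @ v)"
    then obtain i where i: "i < length w + length v" "x = sum_list (take i w) + sum_list (take (i - length w) v)"
      by (auto simp: sites_def)
    show "x \<in> A \<union> B"
    proof (cases "i < length w")
      case True
      then show ?thesis using i by (auto simp: A_def sites_def)
    next
      case False
      then have "x = sum_list w + sum_list (take (i - length w) v)" using i by simp
      moreover have "i - length w < length v" using i False by auto
      ultimately show ?thesis by (auto simp: B_def sites_def)
    qed
  qed
  have split: "(\<Prod>i<length w + length v. g i) = (\<Prod>i<length w. g i) * (\<Prod>i<length v. g (length w + i))"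
    for g :: "nat \<Rightarrow> ennreal"
  proof -
    have "{..<length w + length v} = {..<length w} \<union> (+) (length w) ` {..<length v}"
    proof (intro set_eqI iffI)
      fix x assume "x \<in> {..<length w + length v}"
      then show "x \<in> {..<length w} \<union> (+) (length w) ` {..<length v}"
        by (cases "x < length w") (auto intro!: image_eqI[of _ _ "x - length w"])
    qed auto
    then have "(\<Prod>i<length w + length v. g i) = (\<Prod>i<length w. g i) * (\<Prod>i\<in>(+) (length w) ` {..<length v}. g i)"
      by (simp only:) (rule prod.union_disjoint, auto)
    then show ?thesis by (simp add: prod.reindex)
  qed
  have SW: "siteW (w @ v) x =
     (\<integral>\<^sup>+p. (\<Prod>i<length w. if sum_list (take i w) = x then ennreal (p (w ! i)) else 1) *
       (\<Prod>i<length v. if sum_list w + sum_list (take i v) = x then ennreal (p (v ! i)) else 1) \<partial>\<mu>)" for x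
    unfolding siteW_def length_append split
    by (intro nn_integral_cong arg_cong2[where f = "(*)"] prod.cong) (auto simp: nth_append)
  have SA: "siteW (w @ v) x = siteW w x" if "x \<in> A" for x
  proof -
    have "sum_list w + sum_list (take i v) \<noteq> x" if "i < length v" for i
      using disj \<open>x \<in> A\<close> that by (auto simp: B_def sites_def)
    then show ?thesis unfolding SW unfolding siteW_def by (intro nn_integral_cong) simp
  qed
  have SB: "siteW (w @ v) (sum_list w + y) = siteW v y" if "y \<in> sites v" for y
  proof -
    have "sum_list (take i w) \<noteq> sum_list w + y" if "i < length w" for i
      using disj \<open>y \<in> sites v\<close> that by (auto simp: A_def B_def sites_def)
    then show ?thesis unfolding SW unfolding siteW_def by (intro nn_integral_cong) simp
  qed
  have "emeasure P0 (cyl (w @ v)) = (\<Prod>x\<in>A \<union> B. siteW (w @ v) x)"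
    by (rule emeasure_cyl) (use fin sub in auto)
  also have "\<dots> = (\<Prod>x\<in>A. siteW (w @ v) x) * (\<Prod>x\<in>B. siteW (w @ v) x)"
    using fin disj by (intro prod.union_disjoint) auto
  also have "(\<Prod>x\<in>B. siteW (w @ v) x) = (\<Prod>y\<in>sites v. siteW (w @ v) (sum_list w + y))"
    unfolding B_def by (subst prod.reindex) auto
  also have "\<dots> = (\<Prod>y\<in>sites v. siteW v y)" by (intro prod.cong) (auto simp: SB)
  also have "\<dots> = emeasure P0 (cyl v)" by (rule emeasure_cyl[symmetric]) (use fin in auto)
  also have "(\<Prod>x\<in>A. siteW (w @ v) x) = (\<Prod>x\<in>A. siteW w x)" by (intro prod.cong) (auto simp: SA)
  also have "\<dots> = emeasure P0 (cyl w)" by (rule emeasure_cyl[symmetric]) (use fin A_def in auto)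
  finally show ?thesis by (simp add: measure_def enn2real_mult)
qed

lemma W_bad:
  assumes "\<not> set w \<subseteq> nnU"
  shows "emeasure P0 (cyl w) = 0"
proof -
  obtain i where i: "i < length w" "w ! i \<notin> nnU"
    using assms by (auto simp: subset_eq in_set_conv_nth)
  have "emeasure P0 (cyl w) = (\<integral>\<^sup>+\<omega>. emeasure (Pq \<omega>) (cyl w) \<partial>envlaw \<mu>)"
    by (rule emeasure_P0) simp
  also have "\<dots> = (\<integral>\<^sup>+\<omega>. 0 \<partial>envlaw \<mu>)"
  proof (rule nn_integral_cong_AE, use AE_simplex in eventually_elim)
    fix \<omega> :: "int^'d \<Rightarrow> int^'d \<Rightarrow> real" assume w: "\<forall>y. \<omega> y \<in> trans_simplex"
    then have "ennreal (\<omega> (sum_list (take i w)) (w ! i)) = 0"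
      using i by (auto simp: trans_simplex_def)
    then have "(\<Prod>i<length w. ennreal (\<omega> (sum_list (take i w)) (w ! i))) = 0"
      using i by (intro prod_zero) auto
    then show "emeasure (Pq \<omega>) (cyl w) = 0" using emeasure_cyl_quenched[OF w] by simp
  qed
  finally show ?thesis by simp
qed

lemma AE_nnpath: "AE X in P0. nnpath X"
proof -
  have z: "emeasure P0 (cyl []) = 1"
    by (subst emeasure_cyl[of "{}"]) (auto simp: sites_def)
  have "AE X in P0. X \<in> cyl []"
    using z by (subst P.AE_in_set_eq_1) (auto simp: P.emeasure_eq_measure)
  \<comment> \<open>There are only countably many words, so all cylinders with a forbidden step can
    be discarded at once.\<close>
  moreover have "AE X in P0. \<forall>w. \<not> set w \<subseteq> nnU \<longrightarrow> X \<notin> cyl w"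
    unfolding AE_all_countable
  proof
    fix w
    show "AE X in P0. \<not> set w \<subseteq> nnU \<longrightarrow> X \<notin> cyl w"
      using W_bad[of w] AE_not_in[of "cyl w" P0] by (cases "set w \<subseteq> nnU") (auto simp: null_sets_def)
  qed
  ultimately show ?thesis
  proof eventually_elim
    case (elim X)
    have X0: "X 0 = 0" using elim by (simp add: cyl_def)
    have "X (Suc i) - X i \<in> nnU" for i
    proof -
      have "X \<in> cyl (steps X (Suc i))" using X0 by (simp add: cyl_def)
      then have "set (steps X (Suc i)) \<subseteq> nnU" using elim by blast
      then show ?thesis by (auto simp: steps_def)
    qed
    then show ?case using X0 by (simp add: nnpath_def)
  qed
qed

definition paths :: "nat \<Rightarrow> (int^'d) list set" where
  "paths n = {w. set w \<subseteq> nnU \<and> length w = n}"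

lemma finite_paths: "finite (paths n)"
  unfolding paths_def by (rule finite_lists_length_eq[OF finite_nnU])

lemma nn_integral_steps:
  fixes g :: "(int^'d) list \<Rightarrow> ennreal"
  shows "(\<integral>\<^sup>+X. g (steps X n) \<partial>P0) = (\<Sum>w\<in>paths n. ennreal (W w) * g w)"
proof -
  have "(\<integral>\<^sup>+X. g (steps X n) \<partial>P0) = (\<integral>\<^sup>+X. (\<Sum>w\<in>paths n. indicator (cyl w) X * g w) \<partial>P0)"
  proof (rule nn_integral_cong_AE, use AE_nnpath in eventually_elim)
    case (elim X)
    have "(\<Sum>w\<in>paths n. indicator (cyl w) X * g w) = (\<Sum>w\<in>paths n. if w = steps X n then g w else 0)"
      using elim by (intro sum.cong) (auto simp: paths_def cyl_def nnpath_def)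
    also have "\<dots> = g (steps X n)"
      using finite_paths set_steps[OF elim, of n] by (simp add: sum.delta paths_def)
    finally show ?case by simp
  qed
  also have "\<dots> = (\<Sum>w\<in>paths n. ennreal (W w) * g w)"
    by (subst nn_integral_sum)
      (auto simp: nn_integral_multc P.emeasure_eq_measure intro!: sum.cong)
  finally show ?thesis .
qed

lemma prob_steps:
  "measure P0 {X. S (steps X n)} = (\<Sum>w\<in>{w\<in>paths n. S w}. W w)"
proof -
  have "emeasure P0 {X. S (steps X n)} = (\<integral>\<^sup>+X. indicator {w. S w} (steps X n) \<partial>P0)"
  proof -
    have "{X\<in>space P0. S (steps X n)} \<in> sets P0" by measurable
    then have "emeasure P0 {X. S (steps X n)} = (\<integral>\<^sup>+X. indicator {X. S (steps X n)} X \<partial>P0)"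
      by (subst nn_integral_indicator) auto
    then show ?thesis by (simp add: indicator_def)
  qed
  also have "\<dots> = (\<Sum>w\<in>paths n. ennreal (W w) * indicator {w. S w} w)"
    by (rule nn_integral_steps)
  also have "\<dots> = (\<Sum>w\<in>{w\<in>paths n. S w}. ennreal (W w))"
    unfolding sum.inter_filter[OF finite_paths] by (intro sum.cong) auto
  also have "\<dots> = ennreal (\<Sum>w\<in>{w\<in>paths n. S w}. W w)"
    by (rule sum_ennreal) simp
  finally show ?thesis
    by (simp add: P.emeasure_eq_measure sum_nonneg)
qed

end

subsection \<open>Regeneration\<close>

lemma measurable_pshift [measurable]: "pshift t \<in> pathM \<rightarrow>\<^sub>M (pathM :: (nat \<Rightarrow> int^'d::finite) measure)"
proof -
  have "(\<lambda>X :: nat \<Rightarrow> int^'d. X (t + i) - X t) \<in> pathM \<rightarrow>\<^sub>M count_space UNIV" for i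
    by (rule measurable_compose_countable[OF _ measurable_coord, where f = "\<lambda>a X. a - X t"])
      (rule measurable_compose[OF measurable_coord], simp)
  then have "(\<lambda>X i. X (t + i) - X t) \<in> (pathM :: (nat \<Rightarrow> int^'d) measure) \<rightarrow>\<^sub>M pathM"
    unfolding pathM_def[of] by (intro measurable_PiM_single') (auto simp: pathM_def)
  then show ?thesis by (simp add: pshift_def[abs_def])
qed

lemma measurable_level [measurable]: "(\<lambda>X. u \<bullet> rv (X k)) \<in> borel_measurable pathM"
  by (rule measurable_compose[OF measurable_coord]) simp

lemma pred_Dinf [measurable]: "Measurable.pred pathM (\<lambda>X :: nat \<Rightarrow> int^'d::finite. Dinf u X)"
  unfolding Dinf_def by measurable

lemma pred_regen [measurable]: "Measurable.pred pathM (\<lambda>X :: nat \<Rightarrow> int^'d::finite. regen u X t)"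
  unfolding regen_def by measurable

text \<open>The offset \<open>m\<close> starts the approximating horizons late enough to decide also
  an event of the first \<open>m\<close> positions.\<close>

lemma Dinf_iff_nonneg_path:
  assumes "X 0 = 0"
  shows "Dinf u X \<longleftrightarrow> (\<forall>N. nonneg_path u (steps X (m + N)))"
proof
  assume A: "\<forall>N. nonneg_path u (steps X (m + N))"
  show "Dinf u X" unfolding Dinf_def
  proof
    fix k
    have "nonneg_path u (steps X (m + k))" using A by simp
    then have "0 \<le> lev u (steps X (m + k)) k" by (rule nonneg_path_lev)
    then show "u \<bullet> rv (X 0) \<le> u \<bullet> rv (X k)" using assms by (simp add: lev_steps)
  qed
qed (simp add: nonneg_path_steps assms)

context rwre
begin

text \<open>Finite-horizon form of the renewal property: both sides are sums over words, and
  \<open>W_append\<close> factorises them term by term, which requires the nonnegativity of the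
  continuation.\<close>

lemma markov_finite:
  assumes "record_end u w"
  shows "measure P0 {X. X \<in> cyl w \<and> R (steps (pshift (length w) X) n) \<and>
      nonneg_path u (steps (pshift (length w) X) n)} =
    W w * measure P0 {X. R (steps X n) \<and> nonneg_path u (steps X n)}"
proof -
  define S where "S l \<longleftrightarrow> take (length w) l = w \<and> R (drop (length w) l) \<and> nonneg_path u (drop (length w) l)"
    for l :: "(int^'d) list"
  define F where "F = {v\<in>paths n. R v \<and> nonneg_path u v}"
  have "measure P0 {X\<in>space P0. X \<in> cyl w \<and> R (steps (pshift (length w) X) n) \<and>
      nonneg_path u (steps (pshift (length w) X) n)} = measure P0 {X\<in>space P0. S (steps X (length w + n))}"
  proof (rule P.finite_measure_eq_AE)
    show "AE X in P0. X \<in> {X\<in>space P0. X \<in> cyl w \<and> R (steps (pshift (length w) X) n) \<and>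
      nonneg_path u (steps (pshift (length w) X) n)} \<longleftrightarrow> X \<in> {X\<in>space P0. S (steps X (length w + n))}"
      using AE_nnpath
    proof eventually_elim
      case (elim X)
      then show ?case by (auto simp: S_def cyl_def steps_add nnpath_def)
    qed
  qed measurable
  also have "\<dots> = (\<Sum>l\<in>{l\<in>paths (length w + n). S l}. W l)" using prob_steps by simp
  also have "\<dots> = (\<Sum>v\<in>F. W (w @ v))"
  proof (cases "set w \<subseteq> nnU")
    case True
    have "{l\<in>paths (length w + n). S l} = (@) w ` F"
    proof (intro set_eqI iffI)
      fix l assume l: "l \<in> {l\<in>paths (length w + n). S l}"
      then have "l = w @ drop (length w) l" by (metis (mono_tags) S_def append_take_drop_id mem_Collect_eq)
      moreover have "drop (length w) l \<in> F"
        using l set_drop_subset[of "length w" l] by (auto simp: F_def S_def paths_def)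
      ultimately show "l \<in> (@) w ` F" by blast
    next
      fix l assume "l \<in> (@) w ` F"
      then show "l \<in> {l\<in>paths (length w + n). S l}"
        using True by (auto simp: F_def S_def paths_def)
    qed
    then show ?thesis by (simp add: sum.reindex inj_on_def)
  next
    \<comment> \<open>A forbidden step in \<open>w\<close> makes both sides vanish.\<close>
    case False
    have "{l\<in>paths (length w + n). S l} = {}"
      using False by (auto simp: S_def paths_def dest: in_set_takeD)
        (metis False in_set_takeD subsetD subsetI)
    moreover have "W (w @ v) = 0" for v
      using W_bad[of "w @ v"] False by (auto simp: measure_def)
    ultimately show ?thesis by (simp only: sum.empty sum.neutral_const)
  qed
  also have "\<dots> = (\<Sum>v\<in>F. W w * W v)"
    by (intro sum.cong refl W_append[OF assms]) (auto simp: F_def)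
  also have "\<dots> = W w * measure P0 {X. R (steps X n) \<and> nonneg_path u (steps X n)}"
    using prob_steps[of "\<lambda>v. R v \<and> nonneg_path u v" n] by (simp add: sum_distrib_left F_def)
  finally show ?thesis by simp
qed

text \<open>Finite measures on path space are determined by rectangles, and on a rectangle
  \<open>Dinf\<close> is the decreasing limit of the finite-horizon events of
  \<open>markov_finite\<close>. The identity is left unnormalised, since \<open>pD\<close> is shown
  to be positive only later.\<close>

lemma regen_measure:
  assumes rec: "record_end u w"
  shows "distr (density P0 (\<lambda>X. indicator {X. X \<in> cyl w \<and> Dinf u (pshift (length w) X)} X)) pathM (pshift (length w))
    = density P0 (\<lambda>X. ennreal (W w) * indicator {X. Dinf u X} X)" (is "?L = ?R")
proof (rule measure_eqI_PiM_infinite[where I = UNIV and M = "\<lambda>_. count_space UNIV"])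
  show "sets ?L = sets (PiM UNIV (\<lambda>_. count_space UNIV))" "sets ?R = sets (PiM UNIV (\<lambda>_. count_space UNIV))"
    by (simp_all add: pathM_def)
  have mD: "{X. X \<in> cyl w \<and> Dinf u (pshift (length w) X)} \<in> sets P0"
  proof -
    have "{X\<in>space P0. X \<in> cyl w \<and> Dinf u (pshift (length w) X)} \<in> sets P0" by measurable
    then show ?thesis by simp
  qed
  have mD': "{X. Dinf u X} \<in> sets P0"
  proof -
    have "{X\<in>space P0. Dinf u X} \<in> sets P0" by measurable
    then show ?thesis by simp
  qed
  show "finite_measure ?L"
  proof (rule finite_measureI)
    have U: "UNIV \<in> sets pathM" using sets.top[of pathM] by simp
    have "emeasure ?L (space ?L) = (\<integral>\<^sup>+X. indicator {X. X \<in> cyl w \<and> Dinf u (pshift (length w) X)} X \<partial>P0)"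
      unfolding space_distr space_pathM
      using U mD borel_measurable_indicator[OF mD]
      by (subst emeasure_distr)
        (auto simp: emeasure_density[OF borel_measurable_indicator[OF mD]] simp del: nn_integral_indicator)
    also have "\<dots> = emeasure P0 {X. X \<in> cyl w \<and> Dinf u (pshift (length w) X)}"
      using mD by (rule nn_integral_indicator)
    finally show "emeasure ?L (space ?L) \<noteq> \<infinity>" by (simp add: P.emeasure_eq_measure)
  qed
  fix A :: "nat \<Rightarrow> (int^'d) set" and J :: "nat set"
  assume J: "finite J"
  \<comment> \<open>Every coordinate tested by the rectangle lies at or before time
    \<open>m\<close>, so the word of any length \<open>m + N\<close> decides the rectangle.\<close>
  define m where "m = Max (insert 0 J)"
  have jm: "j \<le> m" if "j \<in> J" for j using J that by (simp add: m_def)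
  define E where "E = {X. \<forall>j\<in>J. X j \<in> A j}"
  have E: "prod_emb UNIV (\<lambda>_. count_space UNIV) J (Pi\<^sub>E J A) = E"
    by (auto simp: prod_emb_def E_def PiE_iff)
  have pE [measurable]: "Measurable.pred pathM (\<lambda>X. X \<in> E)"
  proof -
    have "Measurable.pred pathM (\<lambda>X. X j \<in> A j)" for j
      by (rule measurable_compose[OF measurable_coord]) simp
    then show ?thesis unfolding E_def mem_Collect_eq using J by measurable
  qed
  have mE: "E \<in> sets pathM" using pE by (simp add: pred_def)
  define R where "R l \<longleftrightarrow> (\<forall>j\<in>J. sum_list (take j l) \<in> A j)" for l :: "(int^'d) list"
  have R: "R (steps Y (m + N)) \<longleftrightarrow> Y \<in> E" if "Y 0 = 0" for Y N
    using that jm by (auto simp: R_def E_def sum_list_take_steps trans_le_add1)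
  define LL where "LL N = {X. X \<in> cyl w \<and> R (steps (pshift (length w) X) (m + N)) \<and>
      nonneg_path u (steps (pshift (length w) X) (m + N))}" for N
  define KK where "KK N = {X. X 0 = 0 \<and> R (steps X (m + N)) \<and> nonneg_path u (steps X (m + N))}" for N
  have mLL: "LL N \<in> sets P0" for N
  proof -
    have "{X\<in>space P0. X \<in> cyl w \<and> R (steps (pshift (length w) X) (m + N)) \<and>
      nonneg_path u (steps (pshift (length w) X) (m + N))} \<in> sets P0" by measurable
    then show ?thesis by (simp add: LL_def)
  qed
  have mKK: "KK N \<in> sets P0" for N
  proof -
    have "{X\<in>space P0. X 0 = 0 \<and> R (steps X (m + N)) \<and> nonneg_path u (steps X (m + N))} \<in> sets P0" by measurable
    then show ?thesis by (simp add: KK_def)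
  qed
  have dec: "nonneg_path u (steps Y (m + N))" if "nonneg_path u (steps Y (m + N'))" "N \<le> N'" for Y N N'
    using nonneg_path_take[OF that(1), of "m + N"] that(2) by (simp add: take_steps)
  have "decseq LL" unfolding decseq_def LL_def using R dec by (auto simp: )
  then have 1: "(\<lambda>N. measure P0 (LL N)) \<longlonglongrightarrow> measure P0 (\<Inter>N. LL N)"
    using mLL by (intro P.finite_Lim_measure_decseq) auto
  have "decseq KK" unfolding decseq_def KK_def using R dec by auto
  then have 2: "(\<lambda>N. measure P0 (KK N)) \<longlonglongrightarrow> measure P0 (\<Inter>N. KK N)"
    using mKK by (intro P.finite_Lim_measure_decseq) auto
  have 3: "measure P0 (LL N) = W w * measure P0 (KK N)" for N
  proof -
    have "measure P0 {X\<in>space P0. R (steps X (m + N)) \<and> nonneg_path u (steps X (m + N))} = measure P0 {X\<in>space P0. X \<in> KK N}"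
    proof (rule P.finite_measure_eq_AE)
      show "AE X in P0. X \<in> {X\<in>space P0. R (steps X (m + N)) \<and> nonneg_path u (steps X (m + N))}
        \<longleftrightarrow> X \<in> {X\<in>space P0. X \<in> KK N}"
        using AE_nnpath by eventually_elim (auto simp: KK_def nnpath_def)
      show "{X\<in>space P0. X \<in> KK N} \<in> sets P0" using mKK[of N] by simp
      show "{X\<in>space P0. R (steps X (m + N)) \<and> nonneg_path u (steps X (m + N))} \<in> sets P0" by measurable
    qed
    then show ?thesis unfolding LL_def by (subst markov_finite[OF rec]) simp
  qed
  have "measure P0 (\<Inter>N. LL N) = W w * measure P0 (\<Inter>N. KK N)"
    using LIMSEQ_unique[OF 1] tendsto_mult[OF tendsto_const[of "W w"] 2] unfolding 3 by blast
  moreover have "(\<Inter>N. LL N) = {X. X \<in> cyl w \<and> Dinf u (pshift (length w) X)} \<inter> pshift (length w) -` E"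
    using R Dinf_iff_nonneg_path[where m = m and u = u] by (auto simp: LL_def)
  moreover have "(\<Inter>N. KK N) = {X. X 0 = 0} \<inter> ({X. Dinf u X} \<inter> E)"
    using R Dinf_iff_nonneg_path[where m = m and u = u] by (auto simp: KK_def)
  moreover have "measure P0 ({X. X 0 = 0} \<inter> ({X. Dinf u X} \<inter> E)) = measure P0 ({X. Dinf u X} \<inter> E)"
  proof (rule P.finite_measure_eq_AE)
    show "AE X in P0. X \<in> {X. X 0 = 0} \<inter> ({X. Dinf u X} \<inter> E) \<longleftrightarrow> X \<in> {X. Dinf u X} \<inter> E"
      using AE_nnpath by eventually_elim (auto simp: nnpath_def)
    show "{X. Dinf u X} \<inter> E \<in> sets P0" using mD' mE by auto
    have "{X\<in>space P0. X 0 = (0 :: int^'d)} \<in> sets P0" by measurable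
    then show "{X. X 0 = 0} \<inter> ({X. Dinf u X} \<inter> E) \<in> sets P0" using mD' mE by auto
  qed
  ultimately have key: "measure P0 ({X. X \<in> cyl w \<and> Dinf u (pshift (length w) X)} \<inter> pshift (length w) -` E)
     = W w * measure P0 ({X. Dinf u X} \<inter> E)" by simp
  have pre: "pshift (length w) -` E \<in> sets P0"
    using measurable_sets[OF measurable_pshift mE, of "length w"] by simp
  have "emeasure ?L E = emeasure P0 ({X. X \<in> cyl w \<and> Dinf u (pshift (length w) X)} \<inter> pshift (length w) -` E)"
  proof -
    have "emeasure ?L E = (\<integral>\<^sup>+X. indicator {X. X \<in> cyl w \<and> Dinf u (pshift (length w) X)} X * indicator (pshift (length w) -` E) X \<partial>P0)"
      using mE pre mD by (simp add: emeasure_distr emeasure_density)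
    also have "\<dots> = (\<integral>\<^sup>+X. indicator ({X. X \<in> cyl w \<and> Dinf u (pshift (length w) X)} \<inter> pshift (length w) -` E) X \<partial>P0)"
      by (simp add: indicator_inter_arith)
    also have "\<dots> = emeasure P0 ({X. X \<in> cyl w \<and> Dinf u (pshift (length w) X)} \<inter> pshift (length w) -` E)"
      using mD pre by (intro nn_integral_indicator) auto
    finally show ?thesis .
  qed
  also have "\<dots> = ennreal (W w) * emeasure P0 ({X. Dinf u X} \<inter> E)"
    by (simp add: P.emeasure_eq_measure key ennreal_mult)
  also have "\<dots> = (\<integral>\<^sup>+X. ennreal (W w) * indicator ({X. Dinf u X} \<inter> E) X \<partial>P0)"
    using mD' mE by (subst nn_integral_cmult_indicator) auto
  also have "\<dots> = emeasure ?R E"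
    using mE mD' by (simp add: emeasure_density indicator_inter_arith mult.assoc)
  finally show "emeasure ?L (prod_emb UNIV (\<lambda>_. count_space UNIV) J (Pi\<^sub>E J A)) =
      emeasure ?R (prod_emb UNIV (\<lambda>_. count_space UNIV) J (Pi\<^sub>E J A))" unfolding E .
qed

lemma regen_nn_integral:
  assumes rec: "record_end u w" and G [measurable]: "G \<in> borel_measurable pathM"
  shows "(\<integral>\<^sup>+X. indicator {X. X \<in> cyl w \<and> Dinf u (pshift (length w) X)} X * G (pshift (length w) X) \<partial>P0) =
    ennreal (W w) * (\<integral>\<^sup>+X. indicator {X. Dinf u X} X * G X \<partial>P0)"
proof -
  have mD: "{X. X \<in> cyl w \<and> Dinf u (pshift (length w) X)} \<in> sets pathM"
  proof -
    have "{X\<in>space pathM. X \<in> cyl w \<and> Dinf u (pshift (length w) X)} \<in> sets pathM" by measurable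
    then show ?thesis by simp
  qed
  have mD': "{X :: nat \<Rightarrow> int^'d. Dinf u X} \<in> sets pathM"
  proof -
    have "{X :: nat \<Rightarrow> int^'d. X \<in> space pathM \<and> Dinf u X} \<in> sets pathM" by measurable
    then show ?thesis by simp
  qed
  note [measurable] = mD mD'
  have "(\<integral>\<^sup>+X. indicator {X. X \<in> cyl w \<and> Dinf u (pshift (length w) X)} X * G (pshift (length w) X) \<partial>P0) =
    (\<integral>\<^sup>+X. G (pshift (length w) X) \<partial>density P0 (\<lambda>X. indicator {X. X \<in> cyl w \<and> Dinf u (pshift (length w) X)} X))"
    by (subst nn_integral_density) auto
  also have "\<dots> = (\<integral>\<^sup>+X. G X \<partial>distr (density P0 (\<lambda>X. indicator {X. X \<in> cyl w \<and> Dinf u (pshift (length w) X)} X)) pathM (pshift (length w)))"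
    by (subst nn_integral_distr) auto
  also have "\<dots> = (\<integral>\<^sup>+X. G X \<partial>density P0 (\<lambda>X. ennreal (W w) * indicator {X. Dinf u X} X))"
    unfolding regen_measure[OF rec] ..
  also have "\<dots> = (\<integral>\<^sup>+X. ennreal (W w) * (indicator {X. Dinf u X} X * G X) \<partial>P0)"
    by (subst nn_integral_density) (auto simp: mult.assoc)
  also have "\<dots> = ennreal (W w) * (\<integral>\<^sup>+X. indicator {X. Dinf u X} X * G X \<partial>P0)"
    by (rule nn_integral_cmult) auto
  finally show ?thesis .
qed

definition pD :: "real^'d \<Rightarrow> real" where
  "pD u = measure P0 {X. Dinf u X}"

lemma regen_emeasure:
  assumes "record_end u w"
  shows "emeasure P0 {X. X \<in> cyl w \<and> Dinf u (pshift (length w) X)} = ennreal (W w * pD u)"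
proof -
  have mD: "{X. X \<in> cyl w \<and> Dinf u (pshift (length w) X)} \<in> sets P0"
  proof -
    have "{X\<in>space P0. X \<in> cyl w \<and> Dinf u (pshift (length w) X)} \<in> sets P0" by measurable
    then show ?thesis by simp
  qed
  have mD': "{X :: nat \<Rightarrow> int^'d. Dinf u X} \<in> sets P0"
  proof -
    have "{X \<in> space P0. Dinf u X} \<in> sets P0" by measurable
    then show ?thesis by simp
  qed
  show ?thesis
    using regen_nn_integral[OF assms, of "\<lambda>_. 1"] mD mD'
    by (simp add: P.emeasure_eq_measure pD_def ennreal_mult)
qed

end

subsection \<open>Laws of the regeneration blocks\<close>

lemma pmf_replicate_pmf:
  "pmf (replicate_pmf n p) xs = (if length xs = n then prod_list (map (pmf p) xs) else 0)"
proof (induction n arbitrary: xs)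
  case (Suc n)
  have *: "replicate_pmf (Suc n) p = map_pmf (\<lambda>(x, xs). x # xs) (pair_pmf p (replicate_pmf n p))"
    by (simp add: map_pmf_def pair_pmf_def bind_assoc_pmf bind_return_pmf)
  show ?case
  proof (cases xs)
    case Nil
    have "[] \<notin> set_pmf (replicate_pmf (Suc n) p)" by (auto simp: set_replicate_pmf)
    then show ?thesis using Nil by (simp add: pmf_eq_0_set_pmf)
  next
    case (Cons y ys)
    have "pmf (replicate_pmf (Suc n) p) (y # ys) = pmf (pair_pmf p (replicate_pmf n p)) (y, ys)"
      unfolding * using pmf_map_inj'[of "\<lambda>(x, xs). x # xs" "pair_pmf p (replicate_pmf n p)" "(y, ys)"]
      by (auto simp: inj_def)
    then show ?thesis using Cons by (simp add: pmf_pair Suc)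
  qed
qed (simp add: indicator_def)

lemma nn_integral_replicate_pmf_Suc:
  "(\<integral>\<^sup>+xs. f xs \<partial>replicate_pmf (Suc n) p) = (\<integral>\<^sup>+x. (\<integral>\<^sup>+xs. f (x # xs) \<partial>replicate_pmf n p) \<partial>p)"
  by simp

lemma sum_pmf_le_nn_integral:
  assumes "finite F"
  shows "(\<Sum>x\<in>F. ennreal (pmf p x) * f x) \<le> (\<integral>\<^sup>+x. f x \<partial>measure_pmf p)"
proof -
  have "(\<Sum>x\<in>F. ennreal (pmf p x) * f x) = (\<integral>\<^sup>+x. ennreal (pmf p x) * f x \<partial>count_space F)"
    using assms by (simp add: nn_integral_count_space_finite)
  also have "\<dots> = (\<integral>\<^sup>+x. ennreal (pmf p x) * f x * indicator F x \<partial>count_space UNIV)"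
    by (simp add: nn_integral_count_space_indicator)
  also have "\<dots> \<le> (\<integral>\<^sup>+x. ennreal (pmf p x) * f x \<partial>count_space UNIV)"
    by (intro nn_integral_mono) (auto simp: indicator_def)
  also have "\<dots> = (\<integral>\<^sup>+x. f x \<partial>measure_pmf p)" by (simp add: nn_integral_measure_pmf)
  finally show ?thesis .
qed

lemma measurable_tau_1 [measurable]:
  "(\<lambda>X :: nat \<Rightarrow> int^'d::finite. tau u X (Suc 0)) \<in> pathM \<rightarrow>\<^sub>M count_space UNIV"
proof -
  have fin: "{X :: nat \<Rightarrow> int^'d. tau u X (Suc 0) = enat t} \<in> sets pathM" for t
  proof -
    have "{X \<in> space pathM. regen u (X :: nat \<Rightarrow> int^'d) t \<and> (\<forall>j<t. \<not> regen u X j)} \<in> sets pathM"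
      by measurable
    then show ?thesis by (simp add: tau_1_eq_iff)
  qed
  have inf: "{X :: nat \<Rightarrow> int^'d. tau u X (Suc 0) = \<infinity>} \<in> sets pathM"
  proof -
    have "{X :: nat \<Rightarrow> int^'d. tau u X (Suc 0) = \<infinity>} = space pathM - (\<Union>t. {X. tau u X (Suc 0) = enat t})"
      by auto
    then show ?thesis using fin by (simp only:) (intro sets.Diff sets.top sets.countable_UN, auto)
  qed
  show ?thesis
    unfolding measurable_count_space_eq2_countable
  proof (intro conjI ballI)
    fix a
    show "(\<lambda>X :: nat \<Rightarrow> int^'d. tau u X (Suc 0)) -` {a} \<inter> space pathM \<in> sets pathM"
      using fin inf by (cases a) (auto simp: vimage_def)
  qed auto
qed

lemma measurable_blk [measurable]:
  "(\<lambda>X :: nat \<Rightarrow> int^'d::finite. blk u K X) \<in> pathM \<rightarrow>\<^sub>M count_space UNIV"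
proof (induction K)
  case (Suc K)
  have "(\<lambda>X :: nat \<Rightarrow> int^'d. case tau u X (Suc 0) of \<infinity> \<Rightarrow> [] | enat t \<Rightarrow> steps X t # blk u K (pshift t X))
      \<in> pathM \<rightarrow>\<^sub>M count_space UNIV"
  proof (rule measurable_compose_countable[OF _ measurable_tau_1,
        where f = "\<lambda>s X. case s of \<infinity> \<Rightarrow> [] | enat t \<Rightarrow> steps X t # blk u K (pshift t X)"])
    fix s :: enat
    show "(\<lambda>X :: nat \<Rightarrow> int^'d. case s of \<infinity> \<Rightarrow> [] | enat t \<Rightarrow> steps X t # blk u K (pshift t X))
      \<in> pathM \<rightarrow>\<^sub>M count_space UNIV"
    proof (cases s)
      case (enat t)
      have 1: "(\<lambda>X :: nat \<Rightarrow> int^'d. blk u K (pshift t X)) \<in> pathM \<rightarrow>\<^sub>M count_space UNIV"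
        by (rule measurable_compose[OF measurable_pshift Suc])
      have "(\<lambda>X :: nat \<Rightarrow> int^'d. steps X t # blk u K (pshift t X)) \<in> pathM \<rightarrow>\<^sub>M count_space UNIV"
        by (rule measurable_compose_countable[OF _ measurable_steps, where f = "\<lambda>w X. w # blk u K (pshift t X)"])
          (rule measurable_compose[OF 1], simp)
      then show ?thesis using enat by simp
    qed simp
  qed
  then show ?case by simp
qed simp

text \<open>Almost sure existence of a regeneration time comes from the moment assumptions, by
  different arguments in the nestling and the non-nestling case; the locale keeps what follows
  uniform.\<close>

locale rwre_dir = rwre \<mu> Pq c1
  for \<mu> :: "(int^'d::finite \<Rightarrow> real) measure" and Pq c1 +
  fixes u :: "real^'d"
  assumes AE_regen: "AE X in P0. \<exists>t. regen u X t"
begin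

abbreviation Eset :: "(int^'d) list \<Rightarrow> (nat \<Rightarrow> int^'d) set" where
  "Eset w \<equiv> {X. X \<in> cyl w \<and> Dinf u (pshift (length w) X)}"

lemma sets_Eset [measurable]: "Eset w \<in> sets pathM"
proof -
  have "{X\<in>space pathM. X \<in> cyl w \<and> Dinf u (pshift (length w) X)} \<in> sets pathM" by measurable
  then show ?thesis by simp
qed

lemma sets_Dinf [measurable]: "{X :: nat \<Rightarrow> int^'d. Dinf u X} \<in> sets pathM"
proof -
  have "{X\<in>space pathM. Dinf u (X :: nat \<Rightarrow> int^'d)} \<in> sets pathM" by measurable
  then show ?thesis by simp
qed

lemma first_block_Eset:
  assumes "nnpath X"
  shows "tau u X (Suc 0) = enat t \<longleftrightarrow> steps X t \<in> first_blocks u \<and> X \<in> Eset (steps X t)"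
  using tau_1_eq_first_block[OF assms, of u t] assms by (auto simp: cyl_def nnpath_def)

lemma regen_ex_tau: "(\<exists>t. regen u X t) \<longleftrightarrow> (\<exists>t. tau u X (Suc 0) = enat t)"
  by (auto simp: tau_1)

text \<open>Each event \<open>Eset b\<close> has probability \<open>W b * pD u\<close>. If
  \<open>pD u\<close> were zero, these countably many events would all be null, although almost
  surely one of them occurs.\<close>

lemma pD_pos: "0 < pD u"
proof (rule ccontr)
  assume "\<not> 0 < pD u"
  then have "pD u = 0" by (simp add: pD_def not_less measure_le_0_iff)
  then have "emeasure P0 (Eset b) = 0" if "b \<in> first_blocks u" for b
    using regen_emeasure[of u b] that by (simp add: first_blocks_def)
  then have "AE X in P0. b \<in> first_blocks u \<longrightarrow> X \<notin> Eset b" for b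
    using AE_not_in[of "Eset b" P0] by (cases "b \<in> first_blocks u") (auto simp: null_sets_def)
  then have "AE X in P0. \<forall>b. b \<in> first_blocks u \<longrightarrow> X \<notin> Eset b"
    unfolding AE_all_countable by blast
  then have "AE X in P0. False"
    using AE_nnpath AE_regen
  proof eventually_elim
    case (elim X)
    then obtain t where "tau u X (Suc 0) = enat t" using regen_ex_tau by blast
    then show ?case using elim first_block_Eset by blast
  qed
  then show False by simp
qed

definition PD :: "(nat \<Rightarrow> int^'d) measure" where
  "PD = uniform_measure P0 {X. Dinf u X}"

lemma emeasure_Dinf: "emeasure P0 {X. Dinf u X} = ennreal (pD u)"
  by (simp add: pD_def P.emeasure_eq_measure)

sublocale PD: prob_space PD
  unfolding PD_def by (rule prob_space_uniform_measure) (use pD_pos in \<open>auto simp: emeasure_Dinf\<close>)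

lemma sets_PD [simp, measurable_cong]: "sets PD = sets pathM"
  by (simp add: PD_def)

lemma space_PD [simp]: "space PD = UNIV"
  by (simp add: PD_def)

lemma AE_PD: "AE X in PD. nnpath X \<and> Dinf u X \<and> (\<exists>t. tau u X (Suc 0) = enat t)"
proof -
  have "AE X in PD. nnpath X \<and> (\<exists>t. regen u X t)"
    unfolding PD_def using AE_nnpath AE_regen by (intro AE_uniform_measureI) auto
  moreover have "AE X in PD. X \<in> {X. Dinf u X}"
    unfolding PD_def using pD_pos by (intro AE_uniform_measureI) auto
  ultimately show ?thesis by eventually_elim (auto simp: regen_ex_tau)
qed

text \<open>The factor \<open>pD u\<close> for the future after the last block cancels the
  normalisation of the conditional law.\<close>

lemma emeasure_PD_blk:
  assumes "bs \<in> lists (blocks u)" "length bs = K"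
  shows "emeasure PD {X. blk u K X = bs} = ennreal (W (concat bs))"
proof -
  have meas: "{X. blk u K X = bs} \<in> sets pathM"
    using measurable_sets[OF measurable_blk, of "{bs}" u K] by (simp add: vimage_def)
  have "emeasure PD {X. blk u K X = bs} =
      emeasure P0 ({X. Dinf u X} \<inter> {X. blk u K X = bs}) / ennreal (pD u)"
    unfolding PD_def using meas by (subst emeasure_uniform_measure) (auto simp: emeasure_Dinf)
  also have "emeasure P0 ({X. Dinf u X} \<inter> {X. blk u K X = bs}) = emeasure P0 (Eset (concat bs))"
  proof (rule emeasure_eq_AE)
    show "AE X in P0. X \<in> {X. Dinf u X} \<inter> {X. blk u K X = bs} \<longleftrightarrow> X \<in> Eset (concat bs)"
      using AE_nnpath
    proof eventually_elim
      case (elim X)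
      show ?case
      proof
        assume "X \<in> {X. Dinf u X} \<inter> {X. blk u K X = bs}"
        then show "X \<in> Eset (concat bs)"
          using blk_eqD[OF elim, of u K bs] assms elim by (auto simp: cyl_def nnpath_def)
      next
        assume "X \<in> Eset (concat bs)"
        then show "X \<in> {X. Dinf u X} \<inter> {X. blk u K X = bs}"
          using blk_eqI[OF elim, of bs u] assms by (auto simp: cyl_def)
      qed
    qed
    show "{X. Dinf u X} \<inter> {X. blk u K X = bs} \<in> sets P0" using meas sets_Dinf by simp
    show "Eset (concat bs) \<in> sets P0" by simp
  qed
  also have "\<dots> = ennreal (W (concat bs) * pD u)"
    using concat_blocks[OF assms(1)] by (intro regen_emeasure) simp
  also have "\<dots> / ennreal (pD u) = ennreal (W (concat bs))"
    using pD_pos by (simp add: divide_ennreal)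
  finally show ?thesis .
qed

lemma W_concat: "bs \<in> lists (blocks u) \<Longrightarrow> W (concat bs) = prod_list (map W bs)"
proof (induction bs)
  case Nil
  then show ?case by simp
next
  case (Cons b bs)
  then have "W (b @ concat bs) = W b * W (concat bs)"
    using concat_blocks[of bs u] by (intro W_append[where u = u]) (auto simp: blocks_def first_blocks_def)
  then show ?case using Cons by simp
qed

definition \<beta> :: "(int^'d) list pmf" where
  "\<beta> = embed_pmf (\<lambda>b. if b \<in> blocks u then W b else 0)"

text \<open>The total mass is 1 because the weights are the law of the first block under
  \<open>PD\<close>, and almost surely there is a first block.\<close>

lemma pmf_\<beta>: "pmf \<beta> b = (if b \<in> blocks u then W b else 0)"
  unfolding \<beta>_def
proof (rule pmf_embed_pmf)
  have m1: "(\<lambda>X. hd (blk u 1 X)) \<in> PD \<rightarrow>\<^sub>M count_space UNIV"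
    by (rule measurable_compose[of "blk u 1" _ "count_space UNIV"]) auto
  define M where "M = distr PD (count_space UNIV) (\<lambda>X. hd (blk u 1 X))"
  interpret M: prob_space M unfolding M_def by (rule PD.prob_space_distr[OF m1])
  have "ennreal (if b \<in> blocks u then W b else 0) = emeasure M {b}" for b
  proof -
    have "emeasure M {b} = emeasure PD {X. hd (blk u 1 X) = b}"
      unfolding M_def using m1 by (subst emeasure_distr) (auto simp: vimage_def)
    also have "\<dots> = emeasure PD {X. b \<in> blocks u \<and> blk u 1 X = [b]}"
    proof (rule emeasure_eq_AE)
      show "AE X in PD. X \<in> {X. hd (blk u 1 X) = b} \<longleftrightarrow> X \<in> {X. b \<in> blocks u \<and> blk u 1 X = [b]}"
        using AE_PD
      proof eventually_elim
        case (elim X)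
        then obtain t where t: "tau u X (Suc 0) = enat t" by blast
        then have bl: "blk u 1 X = [steps X t]" by simp
        then show ?case using blk_eqD[of X u 1 "[steps X t]"] elim by auto
      qed
      show "{X. hd (blk u 1 X) = b} \<in> sets PD"
        using measurable_sets[OF m1, of "{b}"] by (simp add: vimage_def)
      show "{X. b \<in> blocks u \<and> blk u 1 X = [b]} \<in> sets PD"
        using measurable_sets[OF measurable_blk, of "{[b]}" u 1] by (cases "b \<in> blocks u") (auto simp: vimage_def)
    qed
    also have "\<dots> = ennreal (if b \<in> blocks u then W b else 0)"
      using emeasure_PD_blk[of "[b]" 1] by simp
    finally show ?thesis by simp
  qed
  then have "(\<integral>\<^sup>+b. ennreal (if b \<in> blocks u then W b else 0) \<partial>count_space UNIV) = (\<integral>\<^sup>+b. emeasure M {b} \<partial>count_space UNIV)"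
    by simp
  also have "\<dots> = emeasure M UNIV"
    by (rule emeasure_countable_singleton[symmetric]) (auto simp: M_def)
  also have "\<dots> = 1" using M.emeasure_space_1 by (simp add: M_def)
  finally show "(\<integral>\<^sup>+b. ennreal (if b \<in> blocks u then W b else 0) \<partial>count_space UNIV) = 1" .
qed simp

lemma set_\<beta>: "set_pmf \<beta> \<subseteq> blocks u"
  by (auto simp: set_pmf_eq pmf_\<beta> split: if_splits)

lemma pmf_replicate_\<beta>:
  assumes "bs \<in> lists (blocks u)"
  shows "pmf (replicate_pmf (length bs) \<beta>) bs = W (concat bs)"
proof -
  have "map (pmf \<beta>) bs = map W bs" using assms by (auto simp: pmf_\<beta>)
  then have "prod_list (map (pmf \<beta>) bs) = prod_list (map W bs)" by (rule arg_cong)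
  then show ?thesis using W_concat[OF assms] by (simp add: pmf_replicate_pmf)
qed

text \<open>The blocks are independent with common law \<open>\<beta>\<close>. Both measures agree
  on the singletons of the countable set \<open>S\<close> of lists of exactly \<open>K\<close>
  blocks, and both are carried by \<open>S\<close>.\<close>

lemma distr_blk: "distr PD (count_space UNIV) (blk u K) = measure_pmf (replicate_pmf K \<beta>)"
proof -
  define M where "M = distr PD (count_space UNIV) (blk u K)"
  define S where "S = {bs\<in>lists (blocks u). length bs = K}"
  have m1: "blk u K \<in> PD \<rightarrow>\<^sub>M count_space UNIV" by simp
  interpret M: prob_space M unfolding M_def by (rule PD.prob_space_distr[OF m1])
  have single: "emeasure M {bs} = emeasure (measure_pmf (replicate_pmf K \<beta>)) {bs}" if "bs \<in> S" for bs
  proof -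
    have "emeasure M {bs} = emeasure PD {X. blk u K X = bs}"
      unfolding M_def using m1 by (subst emeasure_distr) (auto simp: vimage_def)
    then show ?thesis
      using that emeasure_PD_blk[of bs K] pmf_replicate_\<beta>[of bs] by (auto simp: S_def emeasure_pmf_single)
  qed
  have "set_pmf (replicate_pmf K \<beta>) \<subseteq> S"
    using set_\<beta> by (auto simp: S_def set_replicate_pmf)
  then have Q1: "emeasure (measure_pmf (replicate_pmf K \<beta>)) S = 1"
    by (intro measure_pmf.emeasure_eq_1_AE) (auto simp: AE_measure_pmf_iff)
  \<comment> \<open>That almost surely \<open>K\<close> blocks exist is not proved by iterating the
    regeneration; it follows because the singletons in \<open>S\<close> already exhaust mass
    1.\<close>
  have M1: "emeasure M S = 1"
  proof -
    have "emeasure M S = (\<integral>\<^sup>+bs. emeasure M {bs} \<partial>count_space S)"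
      by (rule emeasure_countable_singleton) (auto simp: M_def)
    also have "\<dots> = (\<integral>\<^sup>+bs. emeasure (measure_pmf (replicate_pmf K \<beta>)) {bs} \<partial>count_space S)"
      by (intro nn_integral_cong) (auto simp: single)
    also have "\<dots> = 1"
      unfolding Q1[symmetric] by (rule emeasure_countable_singleton[symmetric]) auto
    finally show ?thesis .
  qed
  have 0: "emeasure N {bs} = 0" if "prob_space N" "sets N = UNIV" "emeasure N S = 1" "bs \<notin> S"
    for N :: "(int^'d) list list measure" and bs
  proof -
    interpret N: prob_space N by fact
    have "AE x in N. x \<in> S" using that by (subst N.AE_in_set_eq_1) (auto simp: N.emeasure_eq_measure)
    then have "AE x in N. x \<notin> {bs}" by eventually_elim (use that in auto)
    then show ?thesis using that by (subst (asm) AE_iff_measurable[of "{bs}"]) (auto simp: sets_eq_imp_space_eq[of N "count_space UNIV"])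
  qed
  have "M = measure_pmf (replicate_pmf K \<beta>)"
  proof (rule measure_eqI_countable[of _ UNIV])
    show "emeasure M {bs} = emeasure (measure_pmf (replicate_pmf K \<beta>)) {bs}" for bs
    proof (cases "bs \<in> S")
      case False
      then show ?thesis
        using 0[of M bs] 0[of "measure_pmf (replicate_pmf K \<beta>)" bs] M1 Q1 M.prob_space_axioms
          measure_pmf.prob_space_axioms[of "replicate_pmf K \<beta>"] by (simp add: M_def)
    qed (rule single)
  qed (auto simp: M_def)
  then show ?thesis by (simp add: M_def)
qed

end

subsection \<open>Decomposition at the last regeneration time\<close>

definition ew :: "real^'d \<Rightarrow> real \<Rightarrow> (int^'d) list \<Rightarrow> real" where
  "ew \<theta> r w = exp (\<theta> \<bullet> rv (sum_list w) - r * real (length w))"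

lemma ew_pos [simp]: "0 < ew \<theta> r w" "0 \<le> ew \<theta> r w"
  by (simp_all add: ew_def)

lemma ew_Nil [simp]: "ew \<theta> r [] = 1"
  by (simp add: ew_def)

lemma ew_append: "ew \<theta> r (w @ v) = ew \<theta> r w * ew \<theta> r v"
  by (simp add: ew_def rv_add inner_add_right algebra_simps flip: exp_add)

text \<open>One supremum serves two purposes: \<open>k = tau_1\<close> gives the weight of the first
  block, smaller \<open>k\<close> the weight of a stretch that has not regenerated yet. For infinite
  \<open>tau_1\<close> all \<open>k\<close> take part.\<close>

definition supA :: "real^'d \<Rightarrow> real^'d \<Rightarrow> real \<Rightarrow> (nat \<Rightarrow> int^'d) \<Rightarrow> ennreal" where
  "supA u \<theta> r X = (SUP k\<in>{k. enat k \<le> tau u X (Suc 0)}. ennreal (exp (\<theta> \<bullet> rv (X k) - r * real k)))"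

lemma ew_le_supA:
  assumes "X 0 = 0" "enat k \<le> tau u X (Suc 0)"
  shows "ennreal (ew \<theta> r (steps X k)) \<le> supA u \<theta> r X"
  unfolding supA_def ew_def using assms by (intro SUP_upper2[of k]) (auto simp: sum_list_steps)

lemma length_concat_blocks: "bs \<in> lists (blocks u) \<Longrightarrow> length bs \<le> length (concat bs)"
proof (induction bs)
  case (Cons b bs)
  then have "b \<noteq> []" by (auto simp: blocks_def first_blocks_def)
  then show ?case using Cons by (cases b) auto
qed simp

context rwre_dir
begin

definition AA :: "real^'d \<Rightarrow> real \<Rightarrow> ennreal" where
  "AA \<theta> r = (\<integral>\<^sup>+X. supA u \<theta> r X \<partial>P0)"

text \<open>The moment generating function of a single block at growth rate \<open>r\<close>. As in
  renewal theory, the exponential growth rate of the moments will be the root of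
  \<open>Phi \<theta> r = 1\<close>.\<close>

definition Phi :: "real^'d \<Rightarrow> real \<Rightarrow> ennreal" where
  "Phi \<theta> r = (\<integral>\<^sup>+b. ennreal (ew \<theta> r b) \<partial>\<beta>)"

text \<open>For distinct first blocks the events \<open>Eset b\<close> are almost surely disjoint,
  since each of them fixes both \<open>tau_1\<close> and the word up to it; on each event the weight
  of \<open>b\<close> is one of the terms of \<open>supA\<close>.\<close>

lemma sum_first_blocks_le:
  assumes F: "finite F" "F \<subseteq> first_blocks u"
  shows "(\<Sum>b\<in>F. ennreal (W b * pD u) * ennreal (ew \<theta> r b)) \<le> AA \<theta> r"
proof -
  have "(\<Sum>b\<in>F. ennreal (W b * pD u) * ennreal (ew \<theta> r b)) =
      (\<Sum>b\<in>F. \<integral>\<^sup>+X. indicator (Eset b) X * ennreal (ew \<theta> r b) \<partial>P0)"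
  proof (intro sum.cong refl)
    fix b assume "b \<in> F"
    then have "emeasure P0 (Eset b) = ennreal (W b * pD u)"
      using F by (intro regen_emeasure) (auto simp: first_blocks_def)
    then show "ennreal (W b * pD u) * ennreal (ew \<theta> r b) = (\<integral>\<^sup>+X. indicator (Eset b) X * ennreal (ew \<theta> r b) \<partial>P0)"
      by (subst nn_integral_multc) auto
  qed
  also have "\<dots> = (\<integral>\<^sup>+X. (\<Sum>b\<in>F. indicator (Eset b) X * ennreal (ew \<theta> r b)) \<partial>P0)"
    by (rule nn_integral_sum[symmetric]) auto
  also have "\<dots> \<le> (\<integral>\<^sup>+X. supA u \<theta> r X \<partial>P0)"
  proof (rule nn_integral_mono_AE, use AE_nnpath in eventually_elim)
    case (elim X)
    have X0: "X 0 = 0" using elim by (simp add: nnpath_def)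
    have E: "b = steps X (length b) \<and> tau u X (Suc 0) = enat (length b)" if "b \<in> F" "X \<in> Eset b" for b
      using first_block_Eset[OF elim, of "length b"] that F by (auto simp: cyl_def)
    show "(\<Sum>b\<in>F. indicator (Eset b) X * ennreal (ew \<theta> r b)) \<le> supA u \<theta> r X"
    proof (cases "\<exists>b\<in>F. X \<in> Eset b")
      case True
      then obtain b where b: "b \<in> F" "X \<in> Eset b" by blast
      have other: "X \<notin> Eset c" if "c \<in> F" "c \<noteq> b" for c
        using E[OF b] E[OF that(1)] that(2) by (metis enat.inject)
      have "(\<Sum>c\<in>F. indicator (Eset c) X * ennreal (ew \<theta> r c)) = (\<Sum>c\<in>{b}. indicator (Eset c) X * ennreal (ew \<theta> r c))"
        using F(1) b other by (intro sum.mono_neutral_right) (auto simp: indicator_def)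
      also have "\<dots> = ennreal (ew \<theta> r b)" using b by simp
      also have "\<dots> \<le> supA u \<theta> r X"
        using ew_le_supA[of X "length b" u \<theta> r, OF X0] E[OF b] by simp
      finally show ?thesis .
    next
      case False
      then have "(\<Sum>b\<in>F. indicator (Eset b) X * ennreal (ew \<theta> r b)) = 0" by (intro sum.neutral) auto
      then show ?thesis by simp
    qed
  qed
  finally show ?thesis by (simp add: AA_def)
qed

lemma nn_integral_\<beta>: "(\<integral>\<^sup>+b. g b \<partial>\<beta>) = (\<integral>\<^sup>+X. g (hd (blk u 1 X)) \<partial>PD)"
proof -
  have "(\<integral>\<^sup>+X. g (hd (blk u 1 X)) \<partial>PD) = (\<integral>\<^sup>+bs. g (hd bs) \<partial>distr PD (count_space UNIV) (blk u 1))"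
    by (subst nn_integral_distr) auto
  also have "\<dots> = (\<integral>\<^sup>+bs. g (hd bs) \<partial>replicate_pmf 1 \<beta>)" unfolding distr_blk ..
  also have "\<dots> = (\<integral>\<^sup>+b. g b \<partial>\<beta>)" unfolding replicate_pmf_1 by simp
  finally show ?thesis ..
qed

text \<open>Given \<open>Dinf\<close>, the first block ends at \<open>tau_1\<close>, where
  \<open>supA\<close> dominates its weight. Removing the conditioning produces the factor
  \<open>pD u\<close>.\<close>

lemma Phi_le: "Phi \<theta> r * ennreal (pD u) \<le> AA \<theta> r"
proof -
  have meas: "(\<lambda>X. ennreal (ew \<theta> r (hd (blk u 1 X)))) \<in> borel_measurable pathM"
    by (rule measurable_compose[OF measurable_blk]) simp
  have "Phi \<theta> r = (\<integral>\<^sup>+X. ennreal (ew \<theta> r (hd (blk u 1 X))) * indicator {X. Dinf u X} X \<partial>P0) / ennreal (pD u)"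
    unfolding Phi_def nn_integral_\<beta> PD_def
    by (subst nn_integral_uniform_measure) (use meas in \<open>auto simp: emeasure_Dinf\<close>)
  then have "Phi \<theta> r * ennreal (pD u) = (\<integral>\<^sup>+X. ennreal (ew \<theta> r (hd (blk u 1 X))) * indicator {X. Dinf u X} X \<partial>P0)"
    using pD_pos by (simp add: ennreal_divide_times ennreal_times_divide mult_divide_eq_ennreal)
  also have "\<dots> \<le> (\<integral>\<^sup>+X. supA u \<theta> r X \<partial>P0)"
  proof (rule nn_integral_mono_AE, use AE_nnpath AE_regen in eventually_elim)
    case (elim X)
    then obtain t where t: "tau u X (Suc 0) = enat t" using regen_ex_tau by blast
    then have "ennreal (ew \<theta> r (hd (blk u 1 X))) \<le> supA u \<theta> r X"
      using ew_le_supA[of X t u \<theta> r] elim by (simp add: nnpath_def)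
    then show ?case by (auto simp: indicator_def)
  qed
  finally show ?thesis by (simp add: AA_def)
qed

lemma no_regen_le:
  "(\<integral>\<^sup>+X. indicator {X. \<forall>j\<le>n. \<not> regen u X j} X * ennreal (ew \<theta> r (steps X n)) \<partial>P0) \<le> AA \<theta> r"
  unfolding AA_def
proof (rule nn_integral_mono_AE, use AE_nnpath in eventually_elim)
  case (elim X)
  show "indicator {X. \<forall>j\<le>n. \<not> regen u X j} X * ennreal (ew \<theta> r (steps X n)) \<le> supA u \<theta> r X"
  proof (cases "\<forall>j\<le>n. \<not> regen u X j")
    case True
    then have "enat n \<le> tau u X (Suc 0)" using tau_1_gt[of n u X] by simp
    then show ?thesis using ew_le_supA[of X n u \<theta> r] elim True by (simp add: nnpath_def)
  qed simp
qed

lemma finite_block_lists: "finite {bs\<in>lists (blocks u). length (concat bs) \<le> n}" (is "finite ?S")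
proof (rule finite_imageD)
  have "concat ` ?S \<subseteq> (\<Union>m\<le>n. paths m)"
    using concat_blocks by (force simp: paths_def)
  then show "finite (concat ` ?S)" by (rule finite_subset) (auto simp: finite_paths)
  show "inj_on concat ?S" by (rule inj_on_subset[OF concat_blocks_inj]) auto
qed

text \<open>Cut at the last regeneration time up to \<open>n\<close>. Without one, \<open>H1\<close>
  and \<open>no_regen_le\<close> give the first term. Otherwise the word is
  \<open>b @ concat bs @ v\<close>: the first block and the unfinished stretch \<open>v\<close> are
  each controlled by \<open>AA\<close>, and the complete blocks in between contribute the mean of
  \<open>\<psi>\<close> under independent blocks. \<open>F\<close> and \<open>\<psi>\<close> are
  left open because the bound serves both for plain moments and for moments weighted with the sum of
  \<open>f\<close>.\<close>

lemma decomposition_bound: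
  fixes F :: "(int^'d) list \<Rightarrow> ennreal" and \<psi> :: "(int^'d) list list \<Rightarrow> ennreal" and c :: ennreal
  assumes H1: "\<And>w. F w \<le> c * ennreal (ew \<theta> r w)"
    and H2: "\<And>b bs v. b \<in> first_blocks u \<Longrightarrow> bs \<in> lists (blocks u) \<Longrightarrow>
      F (b @ concat bs @ v) \<le> c * (ennreal (ew \<theta> r b) * \<psi> bs * ennreal (ew \<theta> r v))"
  shows "(\<integral>\<^sup>+X. F (steps X n) \<partial>P0) * ennreal (pD u) \<le>
    c * AA \<theta> r * ennreal (pD u) + c * AA \<theta> r * AA \<theta> r * (\<Sum>M\<le>n. \<integral>\<^sup>+bs. \<psi> bs \<partial>replicate_pmf M \<beta>)"
proof -
  define F1 where "F1 = {b\<in>first_blocks u. length b \<le> n}"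
  define FB where "FB = {bs\<in>lists (blocks u). length (concat bs) \<le> n}"
  define FF where "FF = {(b, bs). (b, bs) \<in> F1 \<times> FB \<and> length b + length (concat bs) \<le> n}"
  define G :: "nat \<Rightarrow> (nat \<Rightarrow> int^'d) \<Rightarrow> ennreal" where
    "G k Y = indicator {Y. \<forall>j\<le>k. \<not> regen u Y j} Y * ennreal (ew \<theta> r (steps Y k))" for k Y
  have fin1: "finite F1"
  proof -
    have "F1 \<subseteq> (\<Union>m\<le>n. paths m)" by (auto simp: F1_def paths_def first_blocks_def)
    then show ?thesis by (rule finite_subset) (auto simp: finite_paths)
  qed
  have finB: "finite FB" unfolding FB_def by (rule finite_block_lists)
  have finF: "finite FF" by (rule finite_subset[of _ "F1 \<times> FB"]) (auto simp: FF_def fin1 finB)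
  have Gm [measurable]: "G k \<in> borel_measurable pathM" for k
  proof -
    have [measurable]: "{Y :: nat \<Rightarrow> int^'d. \<forall>j\<le>k. \<not> regen u Y j} \<in> sets pathM"
    proof -
      have "{Y \<in> space pathM. \<forall>j\<le>k. \<not> regen u (Y :: nat \<Rightarrow> int^'d) j} \<in> sets pathM" by measurable
      then show ?thesis by simp
    qed
    have [measurable]: "(\<lambda>Y. ennreal (ew \<theta> r (steps Y k))) \<in> borel_measurable pathM"
      by (rule measurable_compose[OF measurable_steps]) simp
    show ?thesis unfolding G_def by measurable
  qed
  have Gle: "(\<integral>\<^sup>+X. G k X \<partial>P0) \<le> AA \<theta> r" for k
    unfolding G_def by (rule no_regen_le)
  define T where "T = (\<lambda>(b, bs) X. c * (ennreal (ew \<theta> r b) * \<psi> bs) *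
     (indicator (Eset (b @ concat bs)) X * G (n - length (b @ concat bs)) (pshift (length (b @ concat bs)) X)))"
  have Tm: "T p \<in> borel_measurable P0" for p
  proof (cases p)
    case (Pair b bs)
    have [measurable]: "(\<lambda>X. G (n - length (b @ concat bs)) (pshift (length (b @ concat bs)) X)) \<in> borel_measurable pathM"
      by (rule measurable_compose[OF measurable_pshift Gm])
    show ?thesis unfolding Pair T_def prod.case by measurable
  qed
  have rec: "record_end u (b @ concat bs)" if "b \<in> F1" "bs \<in> FB" for b bs
    using that concat_blocks[of bs u]
    by (intro record_end_append) (auto simp: F1_def FB_def first_blocks_def)
  have "(\<integral>\<^sup>+X. F (steps X n) \<partial>P0) \<le> (\<integral>\<^sup>+X. c * G n X + (\<Sum>p\<in>FF. T p X) \<partial>P0)"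
  proof (rule nn_integral_mono_AE, use AE_nnpath in eventually_elim)
    case (elim X)
    have X0: "X 0 = 0" using elim by (simp add: nnpath_def)
    show "F (steps X n) \<le> c * G n X + (\<Sum>p\<in>FF. T p X)"
    proof (cases "\<exists>j\<le>n. regen u X j")
      case False
      then have "G n X = ennreal (ew \<theta> r (steps X n))" by (simp add: G_def)
      then show ?thesis using H1[of "steps X n"] by (simp add: add_increasing2)
    next
      case True
      define s where "s = (GREATEST j. j \<le> n \<and> regen u X j)"
      have s: "s \<le> n \<and> regen u X s"
        unfolding s_def using True by (rule GreatestI_ex_nat[where b = n]) auto
      have smax: "j \<le> s" if "j \<le> n" "regen u X j" for j
        unfolding s_def using conjI[OF that] by (rule Greatest_le_nat[where b = n]) auto
      obtain b bs where b: "b \<in> first_blocks u" "bs \<in> lists (blocks u)" "steps X s = b @ concat bs"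
        using regen_decomposition[OF elim, of u s] s by blast
      have len: "length (b @ concat bs) = s" using length_steps[of X s] unfolding b(3) .
      have inFF: "(b, bs) \<in> FF" using b len s by (auto simp: FF_def F1_def FB_def)
      have E: "X \<in> Eset (b @ concat bs)"
        unfolding mem_Collect_eq len using b(3) s regen_iff[of X u s, OF X0] X0 len by (simp add: cyl_def)
      have ind: "indicator (Eset (b @ concat bs)) X = (1 :: ennreal)"
        using E by (rule indicator_simps(1))
      have noreg: "\<forall>j\<le>n - s. \<not> regen u (pshift s X) j"
      proof (intro allI impI notI)
        fix j assume j: "j \<le> n - s" and R: "regen u (pshift s X) j"
        have "0 < j" using R by (simp add: regen_def)
        then have "regen u X (s + j)" using regen_shift[of u X s j] s R by simp
        then show False using smax[of "s + j"] j s \<open>0 < j\<close> by linarith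
      qed
      have st: "steps X n = b @ concat bs @ steps (pshift s X) (n - s)"
        using steps_add[of X s "n - s"] s b(3) by simp
      have "F (steps X n) \<le> c * (ennreal (ew \<theta> r b) * \<psi> bs * ennreal (ew \<theta> r (steps (pshift s X) (n - s))))"
        unfolding st by (rule H2[OF b(1,2)])
      also have "\<dots> = T (b, bs) X"
        unfolding T_def prod.case unfolding ind unfolding len using noreg by (simp add: G_def mult.assoc)
      also have "\<dots> \<le> (\<Sum>p\<in>FF. T p X)"
        using finF inFF by (intro member_le_sum) auto
      finally show ?thesis by (simp add: add_increasing)
    qed
  qed
  also have "\<dots> = c * (\<integral>\<^sup>+X. G n X \<partial>P0) + (\<Sum>p\<in>FF. \<integral>\<^sup>+X. T p X \<partial>P0)"
    using Tm Gm by (subst nn_integral_add) (auto simp: nn_integral_cmult nn_integral_sum)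
  also have "\<dots> \<le> c * AA \<theta> r + (\<Sum>p\<in>FF. case p of (b, bs) \<Rightarrow>
      c * AA \<theta> r * (ennreal (W b) * ennreal (ew \<theta> r b) * (ennreal (W (concat bs)) * \<psi> bs)))"
  proof (intro add_mono sum_mono mult_left_mono Gle)
    fix p assume p: "p \<in> FF"
    obtain b bs where pp: "p = (b, bs)" by (cases p)
    then have bb: "b \<in> F1" "bs \<in> FB" using p by (auto simp: FF_def)
    have m2: "(\<lambda>X. indicator (Eset (b @ concat bs)) X * G (n - length (b @ concat bs)) (pshift (length (b @ concat bs)) X))
       \<in> borel_measurable P0"
    proof -
      have [measurable]: "(\<lambda>X. G (n - length (b @ concat bs)) (pshift (length (b @ concat bs)) X)) \<in> borel_measurable pathM"
        by (rule measurable_compose[OF measurable_pshift Gm])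
      show ?thesis by measurable
    qed
    have WW: "W (b @ concat bs) = W b * W (concat bs)"
      using bb concat_blocks[of bs u]
      by (intro W_append[where u = u]) (auto simp: F1_def FB_def first_blocks_def)
    have "(\<integral>\<^sup>+X. T p X \<partial>P0) = c * (ennreal (ew \<theta> r b) * \<psi> bs) *
       (ennreal (W (b @ concat bs)) * (\<integral>\<^sup>+X. indicator {X. Dinf u X} X * G (n - length (b @ concat bs)) X \<partial>P0))"
      unfolding pp T_def prod.case nn_integral_cmult[OF m2] regen_nn_integral[OF rec[OF bb] Gm] ..
    also have "\<dots> \<le> c * (ennreal (ew \<theta> r b) * \<psi> bs) * (ennreal (W (b @ concat bs)) * AA \<theta> r)"
    proof (intro mult_left_mono)
      have "(\<integral>\<^sup>+X. indicator {X. Dinf u X} X * G (n - length (b @ concat bs)) X \<partial>P0) \<le>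
         (\<integral>\<^sup>+X. G (n - length (b @ concat bs)) X \<partial>P0)"
        by (intro nn_integral_mono) (auto simp: indicator_def)
      also have "\<dots> \<le> AA \<theta> r" by (rule Gle)
      finally show "(\<integral>\<^sup>+X. indicator {X. Dinf u X} X * G (n - length (b @ concat bs)) X \<partial>P0) \<le> AA \<theta> r" .
    qed auto
    also have "\<dots> = c * AA \<theta> r * (ennreal (W b) * ennreal (ew \<theta> r b) * (ennreal (W (concat bs)) * \<psi> bs))"
      by (simp add: WW ennreal_mult mult_ac)
    finally show "(\<integral>\<^sup>+X. T p X \<partial>P0) \<le> (case p of (b, bs) \<Rightarrow>
      c * AA \<theta> r * (ennreal (W b) * ennreal (ew \<theta> r b) * (ennreal (W (concat bs)) * \<psi> bs)))"
      by (simp add: pp)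
  qed auto
  finally have B1: "(\<integral>\<^sup>+X. F (steps X n) \<partial>P0) \<le> c * AA \<theta> r + (\<Sum>p\<in>FF. case p of (b, bs) \<Rightarrow>
      c * AA \<theta> r * (ennreal (W b) * ennreal (ew \<theta> r b) * (ennreal (W (concat bs)) * \<psi> bs)))" .
  \<comment> \<open>Dropping the restriction on the total length makes the double sum
    factorise.\<close>
  have "(\<Sum>p\<in>FF. case p of (b, bs) \<Rightarrow>
      c * AA \<theta> r * (ennreal (W b) * ennreal (ew \<theta> r b) * (ennreal (W (concat bs)) * \<psi> bs)))
    \<le> (\<Sum>p\<in>F1 \<times> FB. case p of (b, bs) \<Rightarrow>
      c * AA \<theta> r * (ennreal (W b) * ennreal (ew \<theta> r b) * (ennreal (W (concat bs)) * \<psi> bs)))"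
    using fin1 finB by (intro sum_mono2) (auto simp: FF_def)
  also have "\<dots> = c * AA \<theta> r * ((\<Sum>b\<in>F1. ennreal (W b) * ennreal (ew \<theta> r b)) * (\<Sum>bs\<in>FB. ennreal (W (concat bs)) * \<psi> bs))"
    unfolding sum_product sum.cartesian_product unfolding sum_distrib_left by (simp add: split_beta)
  finally have B2: "(\<integral>\<^sup>+X. F (steps X n) \<partial>P0) \<le> c * AA \<theta> r +
     c * AA \<theta> r * ((\<Sum>b\<in>F1. ennreal (W b) * ennreal (ew \<theta> r b)) * (\<Sum>bs\<in>FB. ennreal (W (concat bs)) * \<psi> bs))"
    using B1 by (meson add_left_mono order_trans)
  have B3: "(\<Sum>b\<in>F1. ennreal (W b) * ennreal (ew \<theta> r b)) * ennreal (pD u) \<le> AA \<theta> r"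
  proof -
    have "(\<Sum>b\<in>F1. ennreal (W b) * ennreal (ew \<theta> r b)) * ennreal (pD u) = (\<Sum>b\<in>F1. ennreal (W b * pD u) * ennreal (ew \<theta> r b))"
      unfolding sum_distrib_right using pD_pos by (intro sum.cong) (auto simp: ennreal_mult mult_ac)
    also have "\<dots> \<le> AA \<theta> r" using fin1 by (intro sum_first_blocks_le) (auto simp: F1_def)
    finally show ?thesis .
  qed
  have B4: "(\<Sum>bs\<in>FB. ennreal (W (concat bs)) * \<psi> bs) \<le> (\<Sum>M\<le>n. \<integral>\<^sup>+bs. \<psi> bs \<partial>replicate_pmf M \<beta>)"
  proof -
    \<comment> \<open>No block is empty, so at most \<open>n\<close> blocks fit into
      \<open>n\<close> steps.\<close>
    have "length ` FB \<subseteq> {..n}" using length_concat_blocks[of _ u] by (fastforce simp: FB_def)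
    then have "(\<Sum>bs\<in>FB. ennreal (W (concat bs)) * \<psi> bs) =
       (\<Sum>M\<le>n. \<Sum>bs\<in>{bs\<in>FB. length bs = M}. ennreal (W (concat bs)) * \<psi> bs)"
      using finB by (intro sum.group[symmetric]) auto
    also have "\<dots> \<le> (\<Sum>M\<le>n. \<integral>\<^sup>+bs. \<psi> bs \<partial>replicate_pmf M \<beta>)"
    proof (rule sum_mono)
      fix M
      have "(\<Sum>bs\<in>{bs\<in>FB. length bs = M}. ennreal (W (concat bs)) * \<psi> bs) =
        (\<Sum>bs\<in>{bs\<in>FB. length bs = M}. ennreal (pmf (replicate_pmf M \<beta>) bs) * \<psi> bs)"
      proof (intro sum.cong refl)
        fix bs assume "bs \<in> {bs\<in>FB. length bs = M}"
        then have "W (concat bs) = pmf (replicate_pmf M \<beta>) bs"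
          using pmf_replicate_\<beta>[of bs] by (auto simp: FB_def)
        then show "ennreal (W (concat bs)) * \<psi> bs = ennreal (pmf (replicate_pmf M \<beta>) bs) * \<psi> bs"
          by (rule arg_cong)
      qed
      also have "\<dots> \<le> (\<integral>\<^sup>+bs. \<psi> bs \<partial>replicate_pmf M \<beta>)"
        using finB by (intro sum_pmf_le_nn_integral) auto
      finally show "(\<Sum>bs\<in>{bs\<in>FB. length bs = M}. ennreal (W (concat bs)) * \<psi> bs) \<le>
        (\<integral>\<^sup>+bs. \<psi> bs \<partial>replicate_pmf M \<beta>)" .
    qed
    finally show ?thesis .
  qed
  have "(\<integral>\<^sup>+X. F (steps X n) \<partial>P0) * ennreal (pD u) \<le> (c * AA \<theta> r +
     c * AA \<theta> r * ((\<Sum>b\<in>F1. ennreal (W b) * ennreal (ew \<theta> r b)) * (\<Sum>bs\<in>FB. ennreal (W (concat bs)) * \<psi> bs))) * ennreal (pD u)"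
    by (rule mult_right_mono[OF B2]) simp
  also have "\<dots> = c * AA \<theta> r * ennreal (pD u) + c * AA \<theta> r *
     (((\<Sum>b\<in>F1. ennreal (W b) * ennreal (ew \<theta> r b)) * ennreal (pD u)) * (\<Sum>bs\<in>FB. ennreal (W (concat bs)) * \<psi> bs))"
    by (simp add: distrib_left distrib_right mult_ac)
  also have "\<dots> \<le> c * AA \<theta> r * ennreal (pD u) + c * AA \<theta> r *
     (AA \<theta> r * (\<Sum>M\<le>n. \<integral>\<^sup>+bs. \<psi> bs \<partial>replicate_pmf M \<beta>))"
    by (intro add_left_mono mult_left_mono mult_mono B3 B4) auto
  finally show ?thesis by (simp add: mult.assoc)
qed

lemma nn_integral_ew_replicate:
  "(\<integral>\<^sup>+bs. ennreal (ew \<theta> r (concat bs)) \<partial>replicate_pmf M \<beta>) = Phi \<theta> r ^ M"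
proof (induction M)
  case (Suc M)
  have "(\<integral>\<^sup>+bs. ennreal (ew \<theta> r (concat bs)) \<partial>replicate_pmf (Suc M) \<beta>) =
    (\<integral>\<^sup>+b. ennreal (ew \<theta> r b) * (\<integral>\<^sup>+bs. ennreal (ew \<theta> r (concat bs)) \<partial>replicate_pmf M \<beta>) \<partial>\<beta>)"
    unfolding nn_integral_replicate_pmf_Suc
    by (intro nn_integral_cong) (simp add: ew_append ennreal_mult nn_integral_cmult)
  also have "\<dots> = Phi \<theta> r * Phi \<theta> r ^ M"
    unfolding Suc by (simp add: nn_integral_multc Phi_def)
  finally show ?case by simp
qed simp

lemma moment_upper:
  assumes "Phi \<theta> r \<le> 1"
  shows "(\<integral>\<^sup>+X. ennreal (ew \<theta> r (steps X n)) \<partial>P0) * ennreal (pD u) \<le>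
    AA \<theta> r * ennreal (pD u) + AA \<theta> r * AA \<theta> r * of_nat (Suc n)"
proof -
  have "(\<integral>\<^sup>+X. ennreal (ew \<theta> r (steps X n)) \<partial>P0) * ennreal (pD u) \<le>
    1 * AA \<theta> r * ennreal (pD u) + 1 * AA \<theta> r * AA \<theta> r * (\<Sum>M\<le>n. \<integral>\<^sup>+bs. ennreal (ew \<theta> r (concat bs)) \<partial>replicate_pmf M \<beta>)"
    by (rule decomposition_bound) (auto simp: ew_append ennreal_mult mult_ac)
  also have "\<dots> \<le> 1 * AA \<theta> r * ennreal (pD u) + 1 * AA \<theta> r * AA \<theta> r * (\<Sum>M\<le>n. 1)"
    unfolding nn_integral_ew_replicate using assms
    by (intro add_left_mono mult_left_mono sum_mono power_le_one) auto
  finally show ?thesis by simp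
qed

end

subsection \<open>Growth rate of the exponential moments\<close>

lemma norm_rv_step: "z \<in> nnU \<Longrightarrow> norm (rv z :: real^'d::finite) \<le> 1"
proof -
  assume z: "z \<in> nnU"
  have "norm (rv z :: real^'d) \<le> (\<Sum>i\<in>UNIV. \<bar>rv z $ i\<bar>)" by (rule norm_le_l1_cart)
  also have "\<dots> = real_of_int (\<Sum>i\<in>UNIV. \<bar>z $ i\<bar>)" by (simp add: rv_def)
  also have "\<dots> = 1" using z by (simp only: nnU_def mem_Collect_eq of_int_1)
  finally show ?thesis .
qed

lemma norm_rv_sum_list:
  "set w \<subseteq> nnU \<Longrightarrow> norm (rv (sum_list w) :: real^'d::finite) \<le> real (length w)"
proof (induction w)
  case (Cons z w)
  have "norm (rv z + rv (sum_list w) :: real^'d) \<le> norm (rv z :: real^'d) + norm (rv (sum_list w) :: real^'d)"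
    by (rule norm_triangle_ineq)
  then show ?case using Cons norm_rv_step[of z] by (simp add: rv_add)
qed simp

context rwre
begin

lemma emeasure_cyl_snoc:
  assumes "\<forall>y. \<omega> y \<in> trans_simplex"
  shows "emeasure (Pq \<omega>) (cyl (w @ [z])) = emeasure (Pq \<omega>) (cyl w) * ennreal (\<omega> (sum_list w) z)"
  unfolding emeasure_cyl_quenched[OF assms] by (simp add: nth_append)

lemma AE_elliptic: "AE \<omega> in envlaw \<mu>. \<forall>y. \<forall>z\<in>nnU. c1 \<le> \<omega> y z"
  by (rule AE_env[OF elliptic])

lemma measurable_Pq_cyl [measurable]: "(\<lambda>\<omega>. emeasure (Pq \<omega>) (cyl w)) \<in> borel_measurable (envlaw \<mu>)"
proof -
  have "(\<lambda>\<omega>. emeasure (Pq \<omega>) (cyl w)) \<in> borel_measurable envM"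
    by (rule measurable_compose[OF measurable_prob_algebraD[OF Pq_meas]]) simp
  then show ?thesis by (simp add: measurable_cong_sets[OF sets_env refl])
qed

lemma W_snoc_ge:
  assumes "z \<in> nnU"
  shows "c1 * W w \<le> W (w @ [z])"
proof -
  have "ennreal c1 * emeasure P0 (cyl w) = (\<integral>\<^sup>+\<omega>. ennreal c1 * emeasure (Pq \<omega>) (cyl w) \<partial>envlaw \<mu>)"
    by (simp add: emeasure_P0 nn_integral_cmult)
  also have "\<dots> \<le> (\<integral>\<^sup>+\<omega>. emeasure (Pq \<omega>) (cyl (w @ [z])) \<partial>envlaw \<mu>)"
  proof (rule nn_integral_mono_AE, use AE_simplex AE_elliptic in eventually_elim)
    fix \<omega> :: "int^'d \<Rightarrow> int^'d \<Rightarrow> real"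
    assume A: "\<forall>y. \<omega> y \<in> trans_simplex" "\<forall>y. \<forall>z\<in>nnU. c1 \<le> \<omega> y z"
    have "ennreal c1 \<le> ennreal (\<omega> (sum_list w) z)" using A(2) assms by (intro ennreal_leI) auto
    then have "emeasure (Pq \<omega>) (cyl w) * ennreal c1 \<le> emeasure (Pq \<omega>) (cyl w) * ennreal (\<omega> (sum_list w) z)"
      by (intro mult_left_mono) auto
    then show "ennreal c1 * emeasure (Pq \<omega>) (cyl w) \<le> emeasure (Pq \<omega>) (cyl (w @ [z]))"
      unfolding emeasure_cyl_snoc[OF A(1)] by (simp add: mult.commute)
  qed
  also have "\<dots> = emeasure P0 (cyl (w @ [z]))" by (simp add: emeasure_P0)
  finally have "ennreal (c1 * W w) \<le> ennreal (W (w @ [z]))"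
    using c1_pos by (simp add: P.emeasure_eq_measure ennreal_mult)
  then show ?thesis by (simp add: ennreal_le_iff)
qed

definition Zn :: "real^'d \<Rightarrow> nat \<Rightarrow> real" where
  "Zn \<theta> n = (\<integral>X. exp (\<theta> \<bullet> rv (X n)) \<partial>P0)"

lemma Zn_eq: "Zn \<theta> n = (\<Sum>w\<in>paths n. W w * exp (\<theta> \<bullet> rv (sum_list w)))"
proof -
  have meas: "(\<lambda>X. exp (\<theta> \<bullet> rv (X n))) \<in> borel_measurable P0"
    by simp
  have "(\<integral>\<^sup>+X. ennreal (exp (\<theta> \<bullet> rv (X n))) \<partial>P0) = (\<integral>\<^sup>+X. ennreal (exp (\<theta> \<bullet> rv (sum_list (steps X n)))) \<partial>P0)"
    by (rule nn_integral_cong_AE, use AE_nnpath in eventually_elim) (simp add: nnpath_def sum_list_steps)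
  also have "\<dots> = (\<Sum>w\<in>paths n. ennreal (W w) * ennreal (exp (\<theta> \<bullet> rv (sum_list w))))"
    by (rule nn_integral_steps)
  also have "\<dots> = ennreal (\<Sum>w\<in>paths n. W w * exp (\<theta> \<bullet> rv (sum_list w)))"
    by (simp add: ennreal_mult flip: sum_ennreal)
  finally have "has_bochner_integral P0 (\<lambda>X. exp (\<theta> \<bullet> rv (X n))) (\<Sum>w\<in>paths n. W w * exp (\<theta> \<bullet> rv (sum_list w)))"
    using meas by (intro has_bochner_integral_nn_integral) (auto intro!: sum_nonneg)
  then show ?thesis by (simp add: Zn_def has_bochner_integral_integral_eq)
qed

lemma sum_W_paths: "(\<Sum>w\<in>paths n. W w) = 1"
  using prob_steps[of "\<lambda>_. True" n] P.prob_space by simp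

lemma Zn_ge: "exp (- norm \<theta> * real n) \<le> Zn \<theta> n"
proof -
  have "exp (- norm \<theta> * real n) = (\<Sum>w\<in>paths n. W w * exp (- norm \<theta> * real n))"
    by (simp add: sum_W_paths flip: sum_distrib_right)
  also have "\<dots> \<le> Zn \<theta> n"
    unfolding Zn_eq
  proof (intro sum_mono mult_left_mono)
    fix w assume "w \<in> paths n"
    then have "norm (rv (sum_list w) :: real^'d) \<le> real n" using norm_rv_sum_list[of w] by (simp add: paths_def)
    then have "norm \<theta> * norm (rv (sum_list w)) \<le> norm \<theta> * real n" by (intro mult_left_mono) auto
    moreover have "\<bar>\<theta> \<bullet> rv (sum_list w)\<bar> \<le> norm \<theta> * norm (rv (sum_list w))" by (rule Cauchy_Schwarz_ineq2)
    ultimately show "exp (- norm \<theta> * real n) \<le> exp (\<theta> \<bullet> rv (sum_list w))" by simp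
  qed simp
  finally show ?thesis .
qed

lemma Zn_pos: "0 < Zn \<theta> n"
  using Zn_ge[of \<theta> n] exp_gt_zero[of "- norm \<theta> * real n"] by linarith

lemma nn_integral_ew_steps:
  "(\<integral>\<^sup>+X. ennreal (ew \<theta> r (steps X n)) \<partial>P0) = ennreal (Zn \<theta> n * exp (- r * real n))"
proof -
  have "(\<integral>\<^sup>+X. ennreal (ew \<theta> r (steps X n)) \<partial>P0) = (\<Sum>w\<in>paths n. ennreal (W w) * ennreal (ew \<theta> r w))"
    by (rule nn_integral_steps)
  also have "\<dots> = (\<Sum>w\<in>paths n. ennreal (W w * exp (\<theta> \<bullet> rv (sum_list w)) * exp (- r * real n)))"
    by (intro sum.cong) (auto simp: paths_def ew_def ennreal_mult[symmetric] mult.assoc exp_diff exp_minus divide_inverse)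
  also have "\<dots> = ennreal (Zn \<theta> n * exp (- r * real n))"
    by (subst sum_ennreal) (auto simp: Zn_eq sum_distrib_right)
  finally show ?thesis .
qed

end

context rwre_dir
begin

text \<open>The linear factor counts the possible numbers of complete blocks before time
  \<open>n\<close>; each number contributes at most a constant when
  \<open>Phi \<theta> r \<le> 1\<close>.\<close>

lemma Zn_upper:
  assumes "Phi \<theta> r \<le> 1" "AA \<theta> r < \<infinity>"
  shows "\<exists>C>0. \<forall>n. Zn \<theta> n \<le> C * real (Suc n) * exp (r * real n)"
proof -
  obtain a where a: "0 \<le> a" "AA \<theta> r = ennreal a" using assms(2) by (cases "AA \<theta> r") auto
  define C where "C = 1 + a + a * a / pD u"
  have C: "0 < C" using a pD_pos by (auto simp: C_def intro!: add_pos_nonneg divide_nonneg_pos)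
  have "Zn \<theta> n \<le> C * real (Suc n) * exp (r * real n)" for n
  proof -
    have pos: "0 \<le> Zn \<theta> n * exp (- r * real n)" using Zn_pos[of \<theta> n] by simp
    have "ennreal (Zn \<theta> n * exp (- r * real n)) * ennreal (pD u) \<le>
        AA \<theta> r * ennreal (pD u) + AA \<theta> r * AA \<theta> r * of_nat (Suc n)"
      using moment_upper[OF assms(1), of n] unfolding nn_integral_ew_steps .
    also have "\<dots> = ennreal (a * pD u + a * a * real (Suc n))"
    proof -
      have x: "of_nat (Suc n) = ennreal (real (Suc n))" by (rule ennreal_of_nat_eq_real_of_nat)
      have p: "0 \<le> pD u" "0 \<le> a * pD u" "0 \<le> a * a" "0 \<le> real (Suc n)" "0 \<le> a * a * real (Suc n)"
        using a(1) pD_pos by auto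
      show ?thesis
        unfolding a(2) x ennreal_plus[OF p(2,5)] ennreal_mult[OF a(1) p(1)] ennreal_mult[OF p(3,4)] ennreal_mult[OF a(1) a(1)] ..
    qed
    finally have "ennreal (Zn \<theta> n * exp (- r * real n) * pD u) \<le> ennreal (a * pD u + a * a * real (Suc n))"
      unfolding ennreal_mult[OF pos less_imp_le[OF pD_pos]] .
    moreover have "0 \<le> a * pD u + a * a * real (Suc n)"
      using a(1) pD_pos by (intro add_nonneg_nonneg mult_nonneg_nonneg) auto
    ultimately have "Zn \<theta> n * exp (- r * real n) * pD u \<le> a * pD u + a * a * real (Suc n)"
      by (simp only: ennreal_le_iff)
    then have "Zn \<theta> n * exp (- r * real n) \<le> (a * pD u + a * a * real (Suc n)) / pD u"
      using pD_pos by (simp add: pos_le_divide_eq)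
    also have "\<dots> = a + a * a / pD u * real (Suc n)" using pD_pos by (simp add: field_simps)
    also have "\<dots> \<le> (1 + a) * real (Suc n) + a * a / pD u * real (Suc n)"
    proof -
      have "a * 1 \<le> (1 + a) * real (Suc n)" using a by (intro mult_mono) auto
      then show ?thesis by simp
    qed
    also have "\<dots> = C * real (Suc n)" by (simp add: C_def distrib_right)
    finally have "Zn \<theta> n * exp (- r * real n) * exp (r * real n) \<le> C * real (Suc n) * exp (r * real n)"
      by (intro mult_right_mono) auto
    then show ?thesis by (simp add: mult.assoc exp_minus)
  qed
  then show ?thesis using C by blast
qed

section \<open>Bridges and the lower bound for the exponential moments\<close>

definition bridges :: "nat \<Rightarrow> (int^'d) list set" where
  "bridges n = {w\<in>paths n. record_end u w \<and> nonneg_path u w}"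

definition an :: "real^'d \<Rightarrow> real \<Rightarrow> nat \<Rightarrow> real" where
  "an \<theta> r n = (\<Sum>w\<in>bridges n. W w * ew \<theta> r w)"

lemma finite_bridges: "finite (bridges n)"
  by (rule finite_subset[OF _ finite_paths[of n]]) (auto simp: bridges_def)

lemma an_nonneg: "0 \<le> an \<theta> r n"
  unfolding an_def by (intro sum_nonneg mult_nonneg_nonneg) auto

text \<open>Bridges are closed under concatenation, and by \<open>W_append\<close> their weights
  multiply; the length of the first factor fixes the cut, so no bridge is produced twice.\<close>

lemma an_superadditive: "an \<theta> r m * an \<theta> r n \<le> an \<theta> r (m + n)"
proof -
  have "an \<theta> r m * an \<theta> r n = (\<Sum>(w, v)\<in>bridges m \<times> bridges n. W w * ew \<theta> r w * (W v * ew \<theta> r v))"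
    by (simp add: an_def sum_product sum.cartesian_product)
  also have "\<dots> = (\<Sum>p\<in>bridges m \<times> bridges n. W (fst p @ snd p) * ew \<theta> r (fst p @ snd p))"
  proof (intro sum.cong refl, clarify)
    fix w v assume "w \<in> bridges m" "v \<in> bridges n"
    then have "W (w @ v) = W w * W v" by (intro W_append[where u = u]) (auto simp: bridges_def)
    then show "W w * ew \<theta> r w * (W v * ew \<theta> r v) = W (fst (w, v) @ snd (w, v)) * ew \<theta> r (fst (w, v) @ snd (w, v))"
      by (simp add: ew_append)
  qed
  also have "\<dots> = (\<Sum>l\<in>(\<lambda>(w, v). w @ v) ` (bridges m \<times> bridges n). W l * ew \<theta> r l)"
  proof -
    have inj: "inj_on (\<lambda>(w, v). w @ v) (bridges m \<times> bridges n)"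
      by (rule inj_on_append[where m = m]) (simp add: bridges_def paths_def)
    show ?thesis unfolding sum.reindex[OF inj] by (simp add: split_beta)
  qed
  also have "\<dots> \<le> an \<theta> r (m + n)"
    unfolding an_def
    by (intro sum_mono2 finite_bridges)
      (auto simp: bridges_def paths_def intro: record_end_append nonneg_path_append)
  finally show ?thesis .
qed

lemma an_le_Zn: "an \<theta> r n \<le> Zn \<theta> n * exp (- r * real n)"
proof -
  have "an \<theta> r n \<le> (\<Sum>w\<in>paths n. W w * ew \<theta> r w)"
    unfolding an_def by (intro sum_mono2 finite_paths) (auto simp: bridges_def)
  also have "\<dots> = Zn \<theta> n * exp (- r * real n)"
    unfolding Zn_eq sum_distrib_right
    by (intro sum.cong) (auto simp: paths_def ew_def mult.assoc exp_diff exp_minus divide_inverse)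
  finally show ?thesis .
qed

text \<open>\<open>Phi ^ M\<close> is the total weight of all lists of \<open>M\<close> blocks.
  Concatenation is injective on such lists and yields bridges, so the sum over \<open>M\<close> is
  dominated by the sum over all bridges.\<close>

lemma sum_Phi_le_an: "(\<Sum>M<L. Phi \<theta> r ^ M) \<le> (\<Sum>n. ennreal (an \<theta> r n))"
proof -
  define h where "h w = ennreal (W w * ew \<theta> r w)" for w
  define B where "B = {w. set w \<subseteq> nnU \<and> record_end u w \<and> nonneg_path u w}"
  have "(\<Sum>M<L. Phi \<theta> r ^ M) = (\<Sum>M<L. \<integral>\<^sup>+bs. h (concat bs) * indicator {bs\<in>lists (blocks u). length bs = M} bs \<partial>count_space UNIV)"
  proof (intro sum.cong refl)
    fix M
    have "Phi \<theta> r ^ M = (\<integral>\<^sup>+bs. ennreal (pmf (replicate_pmf M \<beta>) bs) * ennreal (ew \<theta> r (concat bs)) \<partial>count_space UNIV)"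
      by (simp only: nn_integral_ew_replicate[symmetric] nn_integral_measure_pmf)
    also have "\<dots> = (\<integral>\<^sup>+bs. h (concat bs) * indicator {bs\<in>lists (blocks u). length bs = M} bs \<partial>count_space UNIV)"
    proof (intro nn_integral_cong)
      fix bs
      show "ennreal (pmf (replicate_pmf M \<beta>) bs) * ennreal (ew \<theta> r (concat bs)) =
        h (concat bs) * indicator {bs\<in>lists (blocks u). length bs = M} bs"
      proof (cases "bs \<in> lists (blocks u) \<and> length bs = M")
        case True
        then have "pmf (replicate_pmf M \<beta>) bs = W (concat bs)" using pmf_replicate_\<beta>[of bs] by auto
        then show ?thesis using True by (simp add: h_def ennreal_mult)
      next
        case False
        then have "bs \<notin> set_pmf (replicate_pmf M \<beta>)" using set_\<beta> by (auto simp: set_replicate_pmf)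
        then have "pmf (replicate_pmf M \<beta>) bs = 0" by (simp add: pmf_eq_0_set_pmf)
        then show ?thesis using False by (simp only: indicator_def) auto
      qed
    qed
    finally show "Phi \<theta> r ^ M = (\<integral>\<^sup>+bs. h (concat bs) * indicator {bs\<in>lists (blocks u). length bs = M} bs \<partial>count_space UNIV)" .
  qed
  also have "\<dots> = (\<integral>\<^sup>+bs. (\<Sum>M<L. h (concat bs) * indicator {bs\<in>lists (blocks u). length bs = M} bs) \<partial>count_space UNIV)"
    by (rule nn_integral_sum[symmetric]) simp
  \<comment> \<open>A list determines its own \<open>M\<close>, so it is counted at most
    once.\<close>
  also have "\<dots> \<le> (\<integral>\<^sup>+bs. h (concat bs) * indicator (lists (blocks u)) bs \<partial>count_space UNIV)"
  proof (intro nn_integral_mono)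
    fix bs
    have "(\<Sum>M<L. h (concat bs) * indicator {bs\<in>lists (blocks u). length bs = M} bs) \<le>
       (\<Sum>M<L. if M = length bs then h (concat bs) * indicator (lists (blocks u)) bs else 0)"
      by (intro sum_mono) (auto simp: indicator_def)
    also have "\<dots> \<le> h (concat bs) * indicator (lists (blocks u)) bs" by (simp add: sum.delta)
    finally show "(\<Sum>M<L. h (concat bs) * indicator {bs\<in>lists (blocks u). length bs = M} bs) \<le>
      h (concat bs) * indicator (lists (blocks u)) bs" .
  qed
  also have "\<dots> = (\<integral>\<^sup>+bs. h (concat bs) \<partial>count_space (lists (blocks u)))"
    by (simp add: nn_integral_count_space_indicator)
  also have "\<dots> = (\<integral>\<^sup>+w. h w \<partial>count_space (concat ` lists (blocks u)))"
    by (rule nn_integral_bij_count_space) (simp add: bij_betw_def concat_blocks_inj)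
  also have "\<dots> = (\<integral>\<^sup>+w. h w * indicator (concat ` lists (blocks u)) w \<partial>count_space UNIV)"
    by (simp add: nn_integral_count_space_indicator)
  also have "\<dots> \<le> (\<integral>\<^sup>+w. h w * indicator B w \<partial>count_space UNIV)"
  proof (intro nn_integral_mono mult_left_mono)
    have "concat ` lists (blocks u) \<subseteq> B"
    proof
      fix w assume "w \<in> concat ` lists (blocks u)"
      then obtain bs where "w = concat bs" "bs \<in> lists (blocks u)" by blast
      then show "w \<in> B" using concat_blocks[of bs u] by (simp add: B_def)
    qed
    then show "indicator (concat ` lists (blocks u)) w \<le> (indicator B w :: ennreal)" for w
      by (metis indicator_simps(1) indicator_simps(2) order_refl subsetD zero_le)
  qed simp
  also have "\<dots> = (\<integral>\<^sup>+w. (\<Sum>n. h w * indicator (bridges n) w) \<partial>count_space UNIV)"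
  proof (intro nn_integral_cong)
    fix w
    have "(\<Sum>n. h w * indicator (bridges n) w) = (\<Sum>n\<in>{length w}. h w * indicator (bridges n) w)"
      by (rule suminf_finite) (auto simp: bridges_def paths_def)
    also have "\<dots> = h w * indicator B w" by (auto simp: bridges_def paths_def B_def indicator_def)
    finally show "h w * indicator B w = (\<Sum>n. h w * indicator (bridges n) w)" ..
  qed
  also have "\<dots> = (\<Sum>n. \<integral>\<^sup>+w. h w * indicator (bridges n) w \<partial>count_space UNIV)"
    by (rule nn_integral_suminf) simp
  also have "\<dots> = (\<Sum>n. ennreal (an \<theta> r n))"
  proof (intro suminf_cong)
    fix n
    have "(\<integral>\<^sup>+w. h w * indicator (bridges n) w \<partial>count_space UNIV) = (\<integral>\<^sup>+w. h w \<partial>count_space (bridges n))"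
      by (simp add: nn_integral_count_space_indicator)
    also have "\<dots> = (\<Sum>w\<in>bridges n. h w)" by (rule nn_integral_count_space_finite[OF finite_bridges])
    also have "\<dots> = ennreal (an \<theta> r n)" unfolding h_def an_def by (rule sum_ennreal) simp
    finally show "(\<integral>\<^sup>+w. h w * indicator (bridges n) w \<partial>count_space UNIV) = ennreal (an \<theta> r n)" .
  qed
  finally show ?thesis .
qed

text \<open>If all \<open>an \<theta> r N\<close> with \<open>N \<ge> 1\<close> were below a
  geometric sequence, their sum would be finite; but \<open>1 \<le> Phi \<theta> r\<close> pushes
  the partial sums of \<open>Phi ^ M\<close> above every integer.\<close>

lemma an_large:
  assumes "1 \<le> Phi \<theta> r" "0 < \<kappa>"
  shows "\<exists>N\<ge>1. exp (- \<kappa> * real N) \<le> an \<theta> r N"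
proof (rule ccontr)
  assume neg: "\<not> (\<exists>N\<ge>1. exp (- \<kappa> * real N) \<le> an \<theta> r N)"
  have small: "an \<theta> r n < exp (- \<kappa>) ^ n" if "n \<ge> 1" for n
  proof -
    have "exp (- \<kappa>) ^ n = exp (real n * - \<kappa>)" by (rule exp_of_nat_mult[symmetric])
    also have "real n * - \<kappa> = - \<kappa> * real n" by simp
    finally show ?thesis using neg that by (metis not_le)
  qed
  \<comment> \<open>The geometric bound starts at 1, so the value at 0 is added by hand.\<close>
  define b where "b n = (if n = 0 then an \<theta> r 0 else 0) + exp (- \<kappa>) ^ n" for n
  have "summable b"
    unfolding b_def using assms(2)
    by (intro summable_add summable_geometric summable_If_finite[of "\<lambda>n. n = 0"]) auto
  have bn: "an \<theta> r n \<le> b n" for n using small[of n] by (cases n) (auto simp: b_def)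
  have b0: "0 \<le> b n" for n using bn[of n] an_nonneg[of \<theta> r n] by linarith
  have "of_nat L \<le> ennreal (suminf b)" for L
  proof -
    have "of_nat L = (\<Sum>M<L. (1::ennreal))" by simp
    also have "\<dots> \<le> (\<Sum>M<L. Phi \<theta> r ^ M)" by (intro sum_mono one_le_power assms(1))
    also have "\<dots> \<le> (\<Sum>n. ennreal (an \<theta> r n))" by (rule sum_Phi_le_an)
    also have "\<dots> \<le> (\<Sum>n. ennreal (b n))" by (intro suminf_le ennreal_leI bn) auto
    also have "\<dots> = ennreal (suminf b)" by (rule suminf_ennreal2[OF b0 \<open>summable b\<close>])
    finally show ?thesis .
  qed
  then have "real L \<le> suminf b" for L
    by (metis b0 \<open>summable b\<close> ennreal_le_iff ennreal_of_nat_eq_real_of_nat suminf_nonneg)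
  moreover obtain L where "suminf b < real L" using reals_Archimedean2 by blast
  ultimately show False using not_le by blast
qed

text \<open>A unit step along an axis on which \<open>u\<close> does not vanish, with matching sign,
  is a bridge, and ellipticity gives it positive weight. Such steps fill the lengths between
  multiples of \<open>N\<close> in \<open>Zn_lower\<close>.\<close>

lemma an_1_pos:
  assumes "u \<noteq> 0"
  shows "0 < an \<theta> r 1"
proof -
  obtain i where i: "u $ i \<noteq> 0" using assms by (auto simp: vec_eq_iff)
  define z :: "int^'d" where "z = axis i (if u $ i > 0 then 1 else -1)"
  have ax: "(\<Sum>j\<in>UNIV. \<bar>axis i c $ j\<bar>) = \<bar>c\<bar>" for c :: int
    by (simp add: axis_def if_distrib[of abs] sum.delta cong: if_cong)
  have z: "z \<in> nnU" by (simp add: z_def nnU_def ax)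
  have "u \<bullet> rv z = u $ i * (if u $ i > 0 then 1 else -1)"
    by (simp add: inner_vec_def rv_def z_def axis_def if_distrib[of real_of_int] if_distrib[of "\<lambda>x. _ * x"] sum.delta cong: if_cong)
  then have uz: "0 < u \<bullet> rv z" using i by auto
  have "[z] \<in> bridges 1"
    using z uz by (auto simp: bridges_def paths_def record_end_def nonneg_path_def lev_def le_Suc_eq)
  then have "W [z] * ew \<theta> r [z] \<le> an \<theta> r 1"
    unfolding an_def by (intro member_le_sum finite_bridges) auto
  moreover have "0 < W [z]" using W_snoc_ge[OF z, of "[]"] c1_pos by simp
  ultimately show ?thesis by (smt (verit) ew_pos(1) mult_pos_pos)
qed

text \<open>Supermultiplicativity propagates one good length \<open>N\<close> to all lengths: repeat
  bridges of length \<open>N\<close> as often as they fit, and complete the rest by single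
  steps.\<close>

lemma Zn_lower:
  assumes "1 \<le> Phi \<theta> r" "0 < \<kappa>" "u \<noteq> 0"
  shows "\<exists>c>0. \<forall>n. c * exp ((r - \<kappa>) * real n) \<le> Zn \<theta> n"
proof -
  obtain N where N: "N \<ge> 1" "exp (- \<kappa> * real N) \<le> an \<theta> r N" using an_large[OF assms(1,2)] by blast
  \<comment> \<open>The cap at 1 makes \<open>a1 ^ N\<close> a lower bound for the contribution of
    every remainder below \<open>N\<close>.\<close>
  define a1 where "a1 = min 1 (an \<theta> r 1)"
  have a1: "0 < a1" "a1 \<le> 1" "a1 \<le> an \<theta> r 1" using an_1_pos[OF assms(3), of \<theta> r] by (auto simp: a1_def)
  have a0: "an \<theta> r 0 = 1"
  proof -
    have "bridges 0 = {[]}" by (auto simp: bridges_def paths_def)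
    then show ?thesis by (simp add: an_def)
  qed
  have pow: "an \<theta> r k ^ q \<le> an \<theta> r (q * k)" for k q
  proof (induction q)
    case (Suc q)
    have "an \<theta> r k ^ Suc q \<le> an \<theta> r k * an \<theta> r (q * k)"
      using Suc an_nonneg[of \<theta> r k] by (simp add: mult_left_mono)
    also have "\<dots> \<le> an \<theta> r (k + q * k)" by (rule an_superadditive)
    finally show ?case by simp
  qed (simp add: a0)
  have "a1 ^ N * exp ((r - \<kappa>) * real n) \<le> Zn \<theta> n" for n
  proof -
    define q j where "q = n div N" and "j = n mod N"
    have n: "n = q * N + j * 1" "j \<le> N" using N by (auto simp: q_def j_def less_imp_le)
    have "a1 ^ N * exp (- \<kappa> * real n) \<le> a1 ^ j * exp (- \<kappa> * real (q * N))"
      using a1 assms(2) n by (intro mult_mono power_decreasing) auto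
    also have "\<dots> = exp (- \<kappa> * real N) ^ q * a1 ^ j"
    proof -
      have "exp (- \<kappa> * real N) ^ q = exp (real q * (- \<kappa> * real N))" by (rule exp_of_nat_mult[symmetric])
      also have "real q * (- \<kappa> * real N) = - \<kappa> * real (q * N)" by simp
      finally show ?thesis by (simp only: mult.commute)
    qed
    also have "\<dots> \<le> an \<theta> r N ^ q * an \<theta> r 1 ^ j"
      using a1 N by (intro mult_mono power_mono) (auto intro!: zero_le_power[OF an_nonneg])
    also have "\<dots> \<le> an \<theta> r (q * N) * an \<theta> r (j * 1)"
      by (intro mult_mono pow zero_le_power an_nonneg)
    also have "\<dots> \<le> an \<theta> r n" unfolding n(1) by (rule an_superadditive)
    also have "\<dots> \<le> Zn \<theta> n * exp (- r * real n)" by (rule an_le_Zn)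
    finally have "a1 ^ N * exp (- \<kappa> * real n) * exp (r * real n) \<le> Zn \<theta> n * exp (- r * real n) * exp (r * real n)"
      by (intro mult_right_mono) auto
    then show ?thesis by (simp add: mult.assoc algebra_simps flip: exp_add)
  qed
  then show ?thesis using a1 by (intro exI[of _ "a1 ^ N"]) auto
qed

lemma ln_Zn_upper:
  assumes "Phi \<theta> r \<le> 1" "AA \<theta> r < \<infinity>" "0 < \<kappa>"
  shows "eventually (\<lambda>n. ln (Zn \<theta> n) / real n \<le> r + \<kappa>) sequentially"
proof -
  obtain C where C: "C > 0" "\<And>n. Zn \<theta> n \<le> C * real (Suc n) * exp (r * real n)"
    using Zn_upper[OF assms(1,2)] by blast
  have "(\<lambda>n. (ln C + ln (real (Suc n))) / real n) \<longlonglongrightarrow> 0"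
    by real_asymp
  then have "eventually (\<lambda>n. (ln C + ln (real (Suc n))) / real n < \<kappa>) sequentially"
    using assms(3) by (rule order_tendstoD)
  then show ?thesis using eventually_gt_at_top[of 0]
  proof eventually_elim
    case (elim n)
    have "ln (Zn \<theta> n) \<le> ln (C * real (Suc n) * exp (r * real n))"
      using C(2)[of n] Zn_pos[of \<theta> n] by (intro ln_mono) auto
    also have "\<dots> = ln C + ln (real (Suc n)) + r * real n"
      using C(1) by (simp add: ln_mult del: of_nat_Suc)
    finally have "ln (Zn \<theta> n) / real n \<le> (ln C + ln (real (Suc n)) + r * real n) / real n"
      by (intro divide_right_mono) auto
    also have "\<dots> = (ln C + ln (real (Suc n))) / real n + r"
      using elim by (simp add: add_divide_distrib)
    finally show ?case using elim by linarith
  qed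
qed

lemma ln_Zn_tendsto:
  assumes "Phi \<theta> r = 1" "AA \<theta> r < \<infinity>" "u \<noteq> 0"
  shows "(\<lambda>n. ln (Zn \<theta> n) / real n) \<longlonglongrightarrow> r"
proof (rule order_tendstoI)
  fix a assume "r < a"
  then have "eventually (\<lambda>n. ln (Zn \<theta> n) / real n \<le> r + (a - r) / 2) sequentially"
    using assms by (intro ln_Zn_upper) auto
  then show "eventually (\<lambda>n. ln (Zn \<theta> n) / real n < a) sequentially"
    by eventually_elim (use \<open>r < a\<close> in \<open>simp add: field_simps\<close>)
next
  fix a assume a: "a < r"
  define \<kappa> where "\<kappa> = (r - a) / 2"
  have \<kappa>: "0 < \<kappa>" using a by (simp add: \<kappa>_def)
  obtain c where c: "c > 0" "\<And>n. c * exp ((r - \<kappa>) * real n) \<le> Zn \<theta> n"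
    using Zn_lower[OF _ \<kappa> assms(3), of \<theta> r] assms(1) by auto
  have "(\<lambda>n. ln c / real n) \<longlonglongrightarrow> 0" by real_asymp
  then have "eventually (\<lambda>n. ln c / real n > - \<kappa>) sequentially"
    using \<kappa> by (intro order_tendstoD) auto
  then show "eventually (\<lambda>n. a < ln (Zn \<theta> n) / real n) sequentially"
    using eventually_gt_at_top[of 0]
  proof eventually_elim
    case (elim n)
    have "ln c + (r - \<kappa>) * real n = ln (c * exp ((r - \<kappa>) * real n))" using c(1) by (simp add: ln_mult)
    also have "\<dots> \<le> ln (Zn \<theta> n)" using c by (intro ln_mono) auto
    finally have "(ln c + (r - \<kappa>) * real n) / real n \<le> ln (Zn \<theta> n) / real n"
      by (intro divide_right_mono) auto
    moreover have "(ln c + (r - \<kappa>) * real n) / real n = ln c / real n + (r - \<kappa>)"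
      using elim by (simp add: add_divide_distrib)
    moreover have "a = r - 2 * \<kappa>" by (simp add: \<kappa>_def field_simps)
    ultimately show ?case using elim by linarith
  qed
qed

end

subsection \<open>Nestling environments trap the walk at subexponential cost\<close>

text \<open>The Lyapunov function of the trapping argument. By completing the square it is at most a
  constant times exp (\<theta> \<bullet> x) for every \<theta>, so a slow decay of its mean bounds
  every \<open>Zn \<theta>\<close> from below.\<close>

definition gauss :: "real \<Rightarrow> int^'d \<Rightarrow> real" where
  "gauss a x = exp (- a * (norm (rv x :: real^'d))\<^sup>2)"

lemma axis_in_nnU: "\<bar>c\<bar> = 1 \<Longrightarrow> axis i c \<in> (nnU :: (int^'d::finite) set)"
proof -
  assume c: "\<bar>c\<bar> = 1"
  have "(\<Sum>j\<in>UNIV. \<bar>(axis i c :: int^'d) $ j\<bar>) = \<bar>c\<bar>"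
    by (simp add: axis_def if_distrib[of abs] sum.delta cong: if_cong)
  then show ?thesis using c by (simp add: nnU_def)
qed

lemma rv_inner_axis: "(rv x :: real^'d::finite) \<bullet> rv (axis i c) = real_of_int (x $ i) * real_of_int c"
  by (simp add: inner_vec_def rv_def axis_def if_distrib[of real_of_int] if_distrib[of "\<lambda>x. _ * x"] sum.delta cong: if_cong)

lemma gauss_step:
  assumes "0 < a" "z \<in> nnU"
  shows "gauss a x * exp (- a) * exp (- 2 * a * (rv x \<bullet> (rv z :: real^'d::finite))) \<le> gauss a (x + z)"
proof -
  have "norm (rv z :: real^'d) ^ 2 \<le> 1 ^ 2" by (intro power_mono norm_rv_step assms) simp
  moreover have "norm (rv (x + z) :: real^'d) ^ 2 = norm (rv x :: real^'d) ^ 2 + 2 * (rv x \<bullet> (rv z :: real^'d)) + norm (rv z :: real^'d) ^ 2"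
    by (simp add: rv_add power2_norm_eq_inner inner_add_left inner_add_right inner_commute)
  ultimately have "norm (rv (x + z) :: real^'d) ^ 2 \<le> norm (rv x :: real^'d) ^ 2 + 2 * (rv x \<bullet> (rv z :: real^'d)) + 1" by simp
  then have "a * norm (rv (x + z) :: real^'d) ^ 2 \<le> a * (norm (rv x :: real^'d) ^ 2 + 2 * (rv x \<bullet> (rv z :: real^'d)) + 1)"
    using assms by (intro mult_left_mono) auto
  then show ?thesis unfolding gauss_def by (simp add: algebra_simps flip: exp_add)
qed

text \<open>Inside the box the drift condition makes the Gaussian nearly subharmonic; outside the box
  ellipticity alone suffices, because a single step towards the origin gains a large factor.\<close>

lemma gauss_one_step:
  fixes p :: "int^'d::finite \<Rightarrow> real"
  assumes a: "0 < a" and c1: "0 < c1" and p: "p \<in> trans_simplex" "\<forall>z\<in>nnU. c1 \<le> p z"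
    and R: "1 \<le> c1 * exp (2 * a * R)"
    and \<eta>: "exp (- a) \<le> 1 - 2 * a * \<eta>"
    and box: "(\<forall>i. \<bar>real_of_int (x $ i)\<bar> \<le> R) \<Longrightarrow> rv x \<bullet> drift p \<le> \<eta>"
  shows "exp (- 2 * a) * gauss a x \<le> (\<Sum>z\<in>nnU. p z * gauss a (x + z))"
proof -
  have p0: "0 \<le> p z" for z using p by (simp add: trans_simplex_def)
  have g0: "0 \<le> gauss a x" for x :: "int^'d" by (simp add: gauss_def)
  have "exp (- a) \<le> (\<Sum>z\<in>nnU. p z * exp (- 2 * a * (rv x \<bullet> (rv z :: real^'d))))"
  proof (cases "\<forall>i. \<bar>real_of_int (x $ i)\<bar> \<le> R")
    case True
    have "exp (- a) \<le> 1 - 2 * a * (rv x \<bullet> drift p)"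
    proof -
      have "2 * a * (rv x \<bullet> drift p) \<le> 2 * a * \<eta>" using box[OF True] a by (intro mult_left_mono) auto
      then show ?thesis using \<eta> by linarith
    qed
    also have "\<dots> = (\<Sum>z\<in>nnU. p z * (1 - 2 * a * (rv x \<bullet> (rv z :: real^'d))))"
      using p by (simp add: trans_simplex_def drift_def inner_sum_right sum_distrib_left right_diff_distrib
          sum_subtractf mult_ac)
    also have "\<dots> \<le> (\<Sum>z\<in>nnU. p z * exp (- 2 * a * (rv x \<bullet> (rv z :: real^'d))))"
    proof (intro sum_mono mult_left_mono p0)
      fix z :: "int^'d"
      show "1 - 2 * a * (rv x \<bullet> (rv z :: real^'d)) \<le> exp (- 2 * a * (rv x \<bullet> (rv z :: real^'d)))"
        using exp_ge_add_one_self[of "- 2 * a * (rv x \<bullet> (rv z :: real^'d))"] by simp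
    qed
    finally show ?thesis .
  next
    case False
    then obtain i where i: "R < \<bar>real_of_int (x $ i)\<bar>" by (auto simp: not_le)
    define c where "c = - (if x $ i \<ge> 0 then 1 else - 1 :: int)"
    define z :: "int^'d" where "z = axis i c"
    have z: "z \<in> nnU" unfolding z_def by (rule axis_in_nnU) (simp add: c_def)
    have "rv x \<bullet> (rv z :: real^'d) = - \<bar>real_of_int (x $ i)\<bar>" by (simp add: z_def rv_inner_axis c_def)
    then have "1 \<le> c1 * exp (- 2 * a * (rv x \<bullet> (rv z :: real^'d)))"
    proof -
      assume e: "rv x \<bullet> (rv z :: real^'d) = - \<bar>real_of_int (x $ i)\<bar>"
      have "2 * a * R \<le> 2 * a * \<bar>real_of_int (x $ i)\<bar>" using i a by (intro mult_left_mono) auto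
      then have "c1 * exp (2 * a * R) \<le> c1 * exp (2 * a * \<bar>real_of_int (x $ i)\<bar>)"
        using c1 by (intro mult_left_mono) auto
      then show ?thesis using R unfolding e by simp
    qed
    also have "\<dots> \<le> p z * exp (- 2 * a * (rv x \<bullet> (rv z :: real^'d)))"
      using p z by (intro mult_right_mono) auto
    also have "\<dots> \<le> (\<Sum>z\<in>nnU. p z * exp (- 2 * a * (rv x \<bullet> (rv z :: real^'d))))"
      using z by (intro member_le_sum finite_nnU) (auto intro!: mult_nonneg_nonneg p0)
    finally show ?thesis using a by (smt (verit) one_le_exp_iff exp_le_one_iff)
  qed
  then have "gauss a x * exp (- a) * exp (- a) \<le>
     gauss a x * exp (- a) * (\<Sum>z\<in>nnU. p z * exp (- 2 * a * (rv x \<bullet> (rv z :: real^'d))))"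
    using g0[of x] by (intro mult_left_mono) auto
  also have "\<dots> = (\<Sum>z\<in>nnU. p z * (gauss a x * exp (- a) * exp (- 2 * a * (rv x \<bullet> (rv z :: real^'d)))))"
    by (simp add: sum_distrib_left mult_ac)
  also have "\<dots> \<le> (\<Sum>z\<in>nnU. p z * gauss a (x + z))"
    by (intro sum_mono mult_left_mono gauss_step a p0)
  finally show ?thesis by (simp add: mult_ac mult_2 flip: exp_add)
qed

lemma finite_box: "finite {x :: int^'d::finite. \<forall>i. \<bar>real_of_int (x $ i)\<bar> \<le> R}"
proof -
  have "{x :: int^'d. \<forall>i. \<bar>real_of_int (x $ i)\<bar> \<le> R} \<subseteq> vec_lambda ` (PiE UNIV (\<lambda>_::'d. {- \<lceil>R\<rceil>..\<lceil>R\<rceil>}))"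
  proof
    fix x :: "int^'d" assume x: "x \<in> {x. \<forall>i. \<bar>real_of_int (x $ i)\<bar> \<le> R}"
    have "- \<lceil>R\<rceil> \<le> x $ i \<and> x $ i \<le> \<lceil>R\<rceil>" for i
    proof -
      have "\<bar>real_of_int (x $ i)\<bar> \<le> R" using x by simp
      then have "real_of_int \<bar>x $ i\<bar> \<le> of_int \<lceil>R\<rceil>" by linarith
      then show ?thesis by (simp only: of_int_le_iff) linarith
    qed
    then have "(\<lambda>i. x $ i) \<in> PiE UNIV (\<lambda>_::'d. {- \<lceil>R\<rceil>..\<lceil>R\<rceil>})" by auto
    moreover have "x = vec_lambda (\<lambda>i. x $ i)" by simp
    ultimately show "x \<in> vec_lambda ` (PiE UNIV (\<lambda>_::'d. {- \<lceil>R\<rceil>..\<lceil>R\<rceil>}))" by blast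
  qed
  then show ?thesis by (rule finite_subset) (intro finite_imageI finite_PiE, auto)
qed

context rwre
begin

lemma measurable_drift [measurable]: "(drift :: (int^'d::finite \<Rightarrow> real) \<Rightarrow> real^'d) \<in> borel_measurable siteM"
  unfolding drift_def[abs_def] by (intro borel_measurable_sum borel_measurable_scaleR) auto

text \<open>Otherwise the support of the drift, and hence its convex hull, would lie in the closed
  half-space \<open>\<eta> \<le> x \<bullet> v\<close>, which misses 0 because \<open>\<eta>\<close>
  is positive.\<close>

lemma nestling_halfspace:
  assumes "nestling \<mu>" "0 < \<eta>"
  shows "0 < emeasure \<mu> {p. (x :: real^'d) \<bullet> drift p \<le> \<eta>}"
proof (rule ccontr)
  assume neg: "\<not> ?thesis"
  have meas: "{p. x \<bullet> drift p \<le> \<eta>} \<in> sets siteM"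
  proof -
    have "{p \<in> space siteM. x \<bullet> drift p \<le> \<eta>} \<in> sets siteM" by measurable
    then show ?thesis by simp
  qed
  have sp: "space \<mu> = UNIV" using sets_eq_imp_space_eq[OF mu_sets] by simp
  have dm: "drift \<in> borel_measurable \<mu>"
    using measurable_drift by (simp add: measurable_cong_sets[OF mu_sets refl])
  have "measure_support (distr \<mu> borel drift) \<subseteq> {v. \<eta> \<le> x \<bullet> v}"
  proof
    fix v assume v: "v \<in> measure_support (distr \<mu> borel drift)"
    show "v \<in> {v. \<eta> \<le> x \<bullet> v}"
    proof (rule ccontr)
      assume "v \<notin> {v. \<eta> \<le> x \<bullet> v}"
      then have "v \<in> {v. x \<bullet> v < \<eta>}" by simp
      moreover have "open {v. x \<bullet> v < \<eta>}" by (rule open_halfspace_lt)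
      ultimately obtain e where e: "e > 0" "ball v e \<subseteq> {v. x \<bullet> v < \<eta>}"
        using open_contains_ball by blast
      have "0 < emeasure (distr \<mu> borel drift) (ball v e)"
        using v e by (simp add: measure_support_def)
      also have "\<dots> = emeasure \<mu> (drift -` ball v e)"
        using dm by (subst emeasure_distr) (auto simp: sp)
      also have "\<dots> \<le> emeasure \<mu> {p. x \<bullet> drift p \<le> \<eta>}"
        using e meas by (intro emeasure_mono) (auto simp: mu_sets subset_eq intro: less_imp_le)
      finally show False using neg by simp
    qed
  qed
  then have "convex hull (measure_support (distr \<mu> borel drift)) \<subseteq> {v. \<eta> \<le> x \<bullet> v}"
    using convex_halfspace_ge[where a = x and b = \<eta>] by (intro hull_minimal) auto
  then show False using assms by (auto simp: nestling_def)
qed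

lemma paths_Suc: "paths (Suc n) = (\<lambda>(w, z). w @ [z]) ` (paths n \<times> nnU)"
proof (intro set_eqI iffI)
  fix l assume l: "l \<in> paths (Suc n)"
  then have "l \<noteq> []" by (auto simp: paths_def)
  then have "l = butlast l @ [last l]" by (auto simp: paths_def intro: append_butlast_last_id[symmetric])
  moreover have "butlast l \<in> paths n" using l by (auto simp: paths_def dest: in_set_butlastD)
  moreover have "last l \<in> nnU" using l last_in_set[OF \<open>l \<noteq> []\<close>] by (auto simp: paths_def)
  ultimately show "l \<in> (\<lambda>(w, z). w @ [z]) ` (paths n \<times> nnU)"
    by (intro image_eqI[of _ _ "(butlast l, last l)"]) auto
qed (auto simp: paths_def)

lemma sum_paths_Suc: "(\<Sum>l\<in>paths (Suc n). g l) = (\<Sum>w\<in>paths n. \<Sum>z\<in>nnU. g (w @ [z]))"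
proof -
  have "inj_on (\<lambda>(w, z). w @ [z]) (paths n \<times> nnU)" by (auto intro: inj_onI)
  then have "(\<Sum>l\<in>paths (Suc n). g l) = (\<Sum>p\<in>paths n \<times> nnU. g (case p of (w, z) \<Rightarrow> w @ [z]))"
    unfolding paths_Suc by (subst sum.reindex) (auto simp: o_def)
  then show ?thesis by (simp add: sum.cartesian_product split_beta)
qed

text \<open>The one-step inequality is iterated along the quenched chain; each step costs the factor
  exp (- 2 * a).\<close>

lemma quenched_gauss:
  assumes simplex: "\<forall>y. \<omega> y \<in> trans_simplex"
    and step: "\<And>x. exp (- 2 * a) * gauss a x \<le> (\<Sum>z\<in>nnU. \<omega> x z * gauss a (x + z))"
  shows "ennreal (exp (- 2 * a) ^ n) \<le> (\<Sum>w\<in>paths n. emeasure (Pq \<omega>) (cyl w) * ennreal (gauss a (sum_list w)))"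
proof (induction n)
  case 0
  have "paths 0 = {[]}" by (auto simp: paths_def)
  then show ?case by (simp add: emeasure_cyl_quenched[OF simplex] gauss_def)
next
  case (Suc n)
  have g0: "0 \<le> gauss a x" for x :: "int^'d" by (simp add: gauss_def)
  have w0: "0 \<le> \<omega> x z" for x z using simplex by (simp add: trans_simplex_def)
  have "ennreal (exp (- 2 * a) ^ Suc n) = ennreal (exp (- 2 * a)) * ennreal (exp (- 2 * a) ^ n)"
    by (simp add: ennreal_mult)
  also have "\<dots> \<le> ennreal (exp (- 2 * a)) * (\<Sum>w\<in>paths n. emeasure (Pq \<omega>) (cyl w) * ennreal (gauss a (sum_list w)))"
    by (intro mult_left_mono Suc) auto
  also have "\<dots> = (\<Sum>w\<in>paths n. emeasure (Pq \<omega>) (cyl w) * ennreal (exp (- 2 * a) * gauss a (sum_list w)))"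
    by (simp add: sum_distrib_left ennreal_mult g0 mult_ac)
  also have "\<dots> \<le> (\<Sum>w\<in>paths n. emeasure (Pq \<omega>) (cyl w) *
      ennreal (\<Sum>z\<in>nnU. \<omega> (sum_list w) z * gauss a (sum_list w + z)))"
    by (intro sum_mono mult_left_mono ennreal_leI step) auto
  also have "\<dots> = (\<Sum>w\<in>paths n. \<Sum>z\<in>nnU. emeasure (Pq \<omega>) (cyl (w @ [z])) * ennreal (gauss a (sum_list (w @ [z]))))"
  proof (intro sum.cong refl)
    fix w :: "(int^'d) list"
    have "ennreal (\<Sum>z\<in>nnU. \<omega> (sum_list w) z * gauss a (sum_list w + z)) =
      (\<Sum>z\<in>nnU. ennreal (\<omega> (sum_list w) z) * ennreal (gauss a (sum_list w + z)))"
      by (subst sum_ennreal[symmetric]) (auto simp: ennreal_mult w0 g0)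
    then show "emeasure (Pq \<omega>) (cyl w) * ennreal (\<Sum>z\<in>nnU. \<omega> (sum_list w) z * gauss a (sum_list w + z)) =
      (\<Sum>z\<in>nnU. emeasure (Pq \<omega>) (cyl (w @ [z])) * ennreal (gauss a (sum_list (w @ [z]))))"
      by (simp add: sum_distrib_left emeasure_cyl_snoc[OF simplex] mult.assoc)
  qed
  also have "\<dots> = (\<Sum>w\<in>paths (Suc n). emeasure (Pq \<omega>) (cyl w) * ennreal (gauss a (sum_list w)))"
    by (simp only: sum_paths_Suc)
  finally show ?case .
qed

text \<open>With positive probability the drift at every site of a fixed finite box barely points
  away from the origin: this is a requirement on finitely many independent sites, so its probability
  does not depend on \<open>n\<close>. In such an environment the mean of \<open>gauss\<close>
  decays at rate at most \<open>\<kappa>\<close>.\<close>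

lemma nestling_Zn_lower:
  assumes nest: "nestling \<mu>" and \<kappa>: "0 < \<kappa>"
  shows "\<exists>c>0. \<forall>n. c * exp (- \<kappa> * real n) \<le> Zn \<theta> n"
proof -
  \<comment> \<open>One step loses a factor exp (- 2 * a), which may be at most exp (-
    \<kappa>).\<close>
  define a where "a = \<kappa> / 2"
  have a: "0 < a" using \<kappa> by (simp add: a_def)
  \<comment> \<open>This \<open>\<eta>\<close> solves exp (- a) = 1 - 2 * a * \<open>\<eta>\<close>,
    the tolerance inside the box.\<close>
  define \<eta> where "\<eta> = (1 - exp (- a)) / (2 * a)"
  have \<eta>: "0 < \<eta>" "exp (- a) \<le> 1 - 2 * a * \<eta>" using a by (auto simp: \<eta>_def)
  \<comment> \<open>Outside this radius a single step towards the origin, of probability at least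
    \<open>c1\<close>, suffices: here \<open>c1 * exp (2 * a * R)\<close> equals 1.\<close>
  define R where "R = - ln c1 / (2 * a)"
  have R: "1 \<le> c1 * exp (2 * a * R)" using a c1_pos by (simp add: R_def exp_minus)
  define Box where "Box = {x :: int^'d. \<forall>i. \<bar>real_of_int (x $ i)\<bar> \<le> R}"
  have finBox: "finite Box" unfolding Box_def by (rule finite_box)
  define S where "S x = {p. rv x \<bullet> (drift p :: real^'d) \<le> \<eta>}" for x :: "int^'d"
  have Sm: "S x \<in> sets siteM" for x
  proof -
    have "{p \<in> space siteM. rv x \<bullet> (drift p :: real^'d) \<le> \<eta>} \<in> sets siteM" by measurable
    then show ?thesis by (simp add: S_def)
  qed
  define pG where "pG = (\<Prod>x\<in>Box. emeasure \<mu> (S x))"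
  have pG_eq: "pG = (\<integral>\<^sup>+\<omega>. (\<Prod>x\<in>Box. indicator (S x) (\<omega> x)) \<partial>envlaw \<mu>)"
    unfolding pG_def using Sm
    by (subst nn_integral_env_prod[OF finBox]) (auto simp: mu_sets)
  have pG0: "pG \<noteq> 0"
    unfolding pG_def using nestling_halfspace[OF nest \<eta>(1)] finBox by (simp add: S_def zero_less_iff_neq_zero)
  have pG1: "pG \<noteq> \<top>"
    unfolding pG_def using finBox by (auto simp: ennreal_prod_eq_top mu.emeasure_eq_measure)
  define c where "c = enn2real pG * exp (- (norm \<theta>)\<^sup>2 / (4 * a))"
  have "0 < pG" using pG0 by (metis not_gr_zero)
  moreover have "pG < \<top>" using pG1 by (simp only: top.not_eq_extremum)
  ultimately have "0 < enn2real pG" by (simp only: enn2real_positive_iff)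
  then have c0: "0 < c" by (simp add: c_def)
  have "c * exp (- \<kappa> * real n) \<le> Zn \<theta> n" for n
  proof -
    have "pG * ennreal (exp (- 2 * a) ^ n) = (\<integral>\<^sup>+\<omega>. (\<Prod>x\<in>Box. indicator (S x) (\<omega> x)) * ennreal (exp (- 2 * a) ^ n) \<partial>envlaw \<mu>)"
      unfolding pG_eq
    proof (rule nn_integral_multc[symmetric])
      have "(\<lambda>\<omega>. indicator (S x) (\<omega> x) :: ennreal) \<in> borel_measurable envM" for x
      proof (rule measurable_compose[of "\<lambda>\<omega>. \<omega> x" envM siteM])
        show "(\<lambda>\<omega>. \<omega> x) \<in> envM \<rightarrow>\<^sub>M siteM" unfolding envM_def by (rule measurable_component_singleton) simp
        show "indicator (S x) \<in> borel_measurable siteM" by (rule borel_measurable_indicator[OF Sm])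
      qed
      then have "(\<lambda>\<omega>. \<Prod>x\<in>Box. indicator (S x) (\<omega> x) :: ennreal) \<in> borel_measurable envM"
        by (intro borel_measurable_prod_ennreal)
      then show "(\<lambda>\<omega>. \<Prod>x\<in>Box. indicator (S x) (\<omega> x) :: ennreal) \<in> borel_measurable (envlaw \<mu>)"
        by (simp only: measurable_cong_sets[OF sets_env refl])
    qed
    also have "\<dots> \<le> (\<integral>\<^sup>+\<omega>. (\<Sum>w\<in>paths n. emeasure (Pq \<omega>) (cyl w) * ennreal (gauss a (sum_list w))) \<partial>envlaw \<mu>)"
    proof (rule nn_integral_mono_AE, use AE_simplex AE_elliptic in eventually_elim)
      fix \<omega> :: "int^'d \<Rightarrow> int^'d \<Rightarrow> real"
      assume A: "\<forall>y. \<omega> y \<in> trans_simplex" "\<forall>y. \<forall>z\<in>nnU. c1 \<le> \<omega> y z"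
      show "(\<Prod>x\<in>Box. indicator (S x) (\<omega> x)) * ennreal (exp (- 2 * a) ^ n) \<le>
         (\<Sum>w\<in>paths n. emeasure (Pq \<omega>) (cyl w) * ennreal (gauss a (sum_list w)))"
      proof (cases "\<forall>x\<in>Box. \<omega> x \<in> S x")
        case True
        have "ennreal (exp (- 2 * a) ^ n) \<le> (\<Sum>w\<in>paths n. emeasure (Pq \<omega>) (cyl w) * ennreal (gauss a (sum_list w)))"
        proof (rule quenched_gauss[OF A(1)])
          fix x
          show "exp (- 2 * a) * gauss a x \<le> (\<Sum>z\<in>nnU. \<omega> x z * gauss a (x + z))"
            using A True by (intro gauss_one_step[OF a c1_pos _ _ R \<eta>(2)]) (auto simp: Box_def S_def)
        qed
        then show ?thesis using True by simp
      next
        case False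
        then have "(\<Prod>x\<in>Box. indicator (S x) (\<omega> x) :: ennreal) = 0"
          using finBox by (intro prod_zero) (auto simp: indicator_def)
        then show ?thesis by (simp only: mult_zero_left zero_le)
      qed
    qed
    also have "\<dots> = (\<Sum>w\<in>paths n. ennreal (W w) * ennreal (gauss a (sum_list w)))"
      by (subst nn_integral_sum) (auto simp: nn_integral_multc P.emeasure_eq_measure simp flip: emeasure_P0)
    also have "\<dots> = ennreal (\<Sum>w\<in>paths n. W w * gauss a (sum_list w))"
      by (subst sum_ennreal[symmetric]) (auto simp: ennreal_mult gauss_def)
    finally have 1: "enn2real pG * exp (- 2 * a) ^ n \<le> (\<Sum>w\<in>paths n. W w * gauss a (sum_list w))"
    proof -
      assume A: "pG * ennreal (exp (- 2 * a) ^ n) \<le> ennreal (\<Sum>w\<in>paths n. W w * gauss a (sum_list w))"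
      have "pG = ennreal (enn2real pG)" using pG1 by (simp add: top.not_eq_extremum)
      then have "ennreal (enn2real pG * exp (- 2 * a) ^ n) = pG * ennreal (exp (- 2 * a) ^ n)"
        by (metis ennreal_mult enn2real_nonneg exp_ge_zero zero_le_power)
      then have "ennreal (enn2real pG * exp (- 2 * a) ^ n) \<le> ennreal (\<Sum>w\<in>paths n. W w * gauss a (sum_list w))"
        using A by (simp only:)
      moreover have "0 \<le> (\<Sum>w\<in>paths n. W w * gauss a (sum_list w))"
        by (intro sum_nonneg mult_nonneg_nonneg) (auto simp: gauss_def)
      ultimately show ?thesis by (simp only: ennreal_le_iff)
    qed
    have "c * exp (- \<kappa> * real n) = exp (- (norm \<theta>)\<^sup>2 / (4 * a)) * (enn2real pG * exp (- 2 * a) ^ n)"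
    proof -
      have "exp (- 2 * a) ^ n = exp (real n * (- 2 * a))" by (rule exp_of_nat_mult[symmetric])
      then show ?thesis by (simp add: c_def a_def mult_ac)
    qed
    also have "\<dots> \<le> exp (- (norm \<theta>)\<^sup>2 / (4 * a)) * (\<Sum>w\<in>paths n. W w * gauss a (sum_list w))"
      by (intro mult_left_mono 1) auto
    also have "\<dots> = (\<Sum>w\<in>paths n. W w * (exp (- (norm \<theta>)\<^sup>2 / (4 * a)) * gauss a (sum_list w)))"
      unfolding sum_distrib_left by (simp add: mult_ac)
    also have "\<dots> \<le> Zn \<theta> n"
      unfolding Zn_eq
    proof (intro sum_mono mult_left_mono)
      fix w :: "(int^'d) list"
      define y :: "real^'d" where "y = rv (sum_list w)"
      \<comment> \<open>Completing the square in \<open>y\<close> yields the constant chosen in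
        \<open>c\<close>.\<close>
      have "0 \<le> (norm (a *\<^sub>R y + (1/2) *\<^sub>R \<theta>))\<^sup>2 / a" using a by simp
      also have "(norm (a *\<^sub>R y + (1/2) *\<^sub>R \<theta>))\<^sup>2 = a\<^sup>2 * (norm y)\<^sup>2 + a * (\<theta> \<bullet> y) + (norm \<theta>)\<^sup>2 / 4"
        unfolding power2_norm_eq_inner power2_eq_square[of a]
        by (simp add: inner_add_left inner_add_right inner_commute[of y \<theta>] field_simps)
      also have "\<dots> / a = a * (norm y)\<^sup>2 + \<theta> \<bullet> y + (norm \<theta>)\<^sup>2 / (4 * a)"
        using a by (simp add: field_simps power2_eq_square)
      finally have "- (norm \<theta>)\<^sup>2 / (4 * a) + - a * (norm y)\<^sup>2 \<le> \<theta> \<bullet> y" by simp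
      then show "exp (- (norm \<theta>)\<^sup>2 / (4 * a)) * gauss a (sum_list w) \<le> exp (\<theta> \<bullet> rv (sum_list w))"
        by (simp add: gauss_def y_def flip: exp_add)
    qed auto
    finally show ?thesis .
  qed
  then show ?thesis using c0 by blast
qed

end

subsection \<open>Existence of the averaged logarithmic moment generating function\<close>

context rwre
begin

section \<open>Unboundedness of the walk and existence of regeneration times\<close>

lemma sum_W_extend:
  assumes "w \<in> paths n"
  shows "(\<Sum>v\<in>paths L. W (w @ v)) = W w"
proof -
  have "{l\<in>paths (n + L). take n l = w} = (@) w ` paths L"
  proof (intro set_eqI iffI)
    fix l assume l: "l \<in> {l\<in>paths (n + L). take n l = w}"
    then have "l = w @ drop n l" by (metis (mono_tags) append_take_drop_id mem_Collect_eq)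
    moreover have "drop n l \<in> paths L" using l set_drop_subset[of n l] by (auto simp: paths_def)
    ultimately show "l \<in> (@) w ` paths L" by blast
  qed (use assms in \<open>auto simp: paths_def\<close>)
  then have "(\<Sum>v\<in>paths L. W (w @ v)) = (\<Sum>l\<in>{l\<in>paths (n + L). take n l = w}. W l)"
    by (simp add: sum.reindex inj_on_def)
  also have "\<dots> = measure P0 {X. take n (steps X (n + L)) = w}"
    by (rule prob_steps[symmetric])
  also have "\<dots> = measure P0 {X. steps X n = w}" by (simp add: take_steps)
  also have "\<dots> = (\<Sum>l\<in>{l\<in>paths n. l = w}. W l)" by (rule prob_steps)
  also have "{l\<in>paths n. l = w} = {w}" using assms by auto
  finally show ?thesis by simp
qed

lemma W_replicate_ge:
  assumes "z \<in> nnU"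
  shows "c1 ^ L * W w \<le> W (w @ replicate L z)"
proof (induction L)
  case (Suc L)
  have "c1 ^ Suc L * W w \<le> c1 * W (w @ replicate L z)"
    using Suc c1_pos by (simp add: mult.assoc mult_left_mono)
  also have "\<dots> \<le> W ((w @ replicate L z) @ [z])" by (rule W_snoc_ge[OF assms])
  finally show ?case by (simp add: replicate_append_same)
qed simp

text \<open>From anywhere in the ball of radius \<open>R\<close>, \<open>L\<close> equal steps lead
  out of it, and by ellipticity they have averaged conditional probability at least
  \<open>c1 ^ L\<close> whatever the past word. Staying inside for \<open>m * L\<close> steps thus
  has probability at most (1 - c1 ^ L) ^ m.\<close>

lemma AE_unbounded: "AE X in P0. \<exists>k. real R < norm (rv (X k) :: real^'d)"
proof -
  \<comment> \<open>Any coordinate direction will do; \<open>undefined\<close> names some index of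
    the finite type.\<close>
  define z :: "int^'d" where "z = axis undefined 1"
  have z: "z \<in> nnU" unfolding z_def by (rule axis_in_nnU) simp
  have "1 \<le> norm (rv z :: real^'d)"
    using component_le_norm_cart[of "rv z :: real^'d" undefined] by (simp add: z_def rv_def)
  have c1_le: "c1 \<le> 1"
    by (rule order_trans[OF _ P.prob_le_1[of "cyl [z]"]]) (use W_snoc_ge[OF z, of "[]"] in simp)
  \<comment> \<open>Long enough to cross the whole diameter of the ball and leave it.\<close>
  define L where "L = 2 * R + 1"
  define q where "q = 1 - c1 ^ L"
  have q: "0 \<le> q" "q < 1" using c1_pos c1_le by (auto simp: q_def power_le_one)
  define B where "B n = {w\<in>paths n. \<forall>i\<le>n. norm (rv (sum_list (take i w)) :: real^'d) \<le> real R}" for n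
  have finB: "finite (B n)" for n by (rule finite_subset[OF _ finite_paths[of n]]) (auto simp: B_def)
  define b where "b n = (\<Sum>w\<in>B n. W w)" for n
  define rep where "rep = replicate L z"
  have rep: "rep \<in> paths L" using z by (auto simp: rep_def paths_def)
  have rvrep: "rv (sum_list (replicate m z)) = real m *\<^sub>R (rv z :: real^'d)" for m
    by (induction m) (auto simp: rv_add scaleR_left_distrib add.commute)
  have far: "w @ rep \<notin> B (n + L)" if "w \<in> B n" for w n
  proof
    assume A: "w @ rep \<in> B (n + L)"
    have len: "length w = n" using that by (simp add: B_def paths_def)
    have 1: "norm (rv (sum_list w) :: real^'d) \<le> real R"
      using that len by (auto simp: B_def dest!: spec[of _ n])
    have "norm (rv (sum_list (w @ rep)) :: real^'d) \<le> real R"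
      using A len by (auto simp: B_def rep_def dest!: spec[of _ "n + L"])
    then have 2: "norm (rv (sum_list w) + real L *\<^sub>R rv z :: real^'d) \<le> real R"
      by (simp add: rep_def rv_add rvrep)
    have "norm (real L *\<^sub>R rv z :: real^'d) \<le> norm (rv (sum_list w) + real L *\<^sub>R rv z :: real^'d) + norm (rv (sum_list w) :: real^'d)"
      using norm_triangle_ineq4[of "rv (sum_list w) + real L *\<^sub>R rv z :: real^'d" "rv (sum_list w)"] by simp
    moreover have "real L * 1 \<le> norm (real L *\<^sub>R rv z :: real^'d)"
      using \<open>1 \<le> norm (rv z)\<close> by (simp del: mult_1_right add: mult_left_mono)
    moreover have "real L = 2 * real R + 1" by (simp add: L_def)
    ultimately show False using 1 2 by linarith
  qed
  have step: "b (n + L) \<le> q * b n" for n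
  proof -
    have sub: "B (n + L) \<subseteq> (\<lambda>(w, v). w @ v) ` (B n \<times> (paths L - {rep}))"
    proof
      fix l assume l: "l \<in> B (n + L)"
      have eq: "l = take n l @ drop n l" by simp
      have t: "take n l \<in> B n"
        using l set_take_subset[of n l] by (auto simp: B_def paths_def min_def)
      have d: "drop n l \<in> paths L" using l set_drop_subset[of n l] by (auto simp: B_def paths_def)
      have "drop n l \<noteq> rep" using far[OF t] l eq by metis
      then show "l \<in> (\<lambda>(w, v). w @ v) ` (B n \<times> (paths L - {rep}))"
        using t d eq by (intro image_eqI[of _ _ "(take n l, drop n l)"]) auto
    qed
    have inj: "inj_on (\<lambda>(w, v). w @ v) (B n \<times> (paths L - {rep}))"
      by (rule inj_on_append[where m = n]) (auto simp: B_def paths_def)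
    have "b (n + L) \<le> (\<Sum>l\<in>(\<lambda>(w, v). w @ v) ` (B n \<times> (paths L - {rep})). W l)"
      unfolding b_def using sub finB finite_paths by (intro sum_mono2) auto
    also have "\<dots> = (\<Sum>w\<in>B n. \<Sum>v\<in>paths L - {rep}. W (w @ v))"
      by (subst sum.reindex[OF inj]) (simp add: sum.cartesian_product split_beta)
    also have "\<dots> \<le> (\<Sum>w\<in>B n. q * W w)"
    proof (rule sum_mono)
      fix w assume w: "w \<in> B n"
      have "(\<Sum>v\<in>paths L - {rep}. W (w @ v)) = (\<Sum>v\<in>paths L. W (w @ v)) - W (w @ rep)"
        using rep finite_paths by (simp add: sum_diff1)
      also have "\<dots> = W w - W (w @ rep)" using sum_W_extend[of w n L] w by (simp add: B_def)
      also have "\<dots> \<le> q * W w"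
        using W_replicate_ge[OF z, of L w] by (simp add: rep_def q_def left_diff_distrib)
      finally show "(\<Sum>v\<in>paths L - {rep}. W (w @ v)) \<le> q * W w" .
    qed
    finally show ?thesis by (simp add: b_def sum_distrib_left)
  qed
  have bq: "b (m * L) \<le> q ^ m" for m
  proof (induction m)
    case 0
    have "b 0 \<le> (\<Sum>w\<in>paths 0. W w)" unfolding b_def by (intro sum_mono2 finite_paths) (auto simp: B_def)
    then show ?case by (simp add: sum_W_paths)
  next
    case (Suc m)
    have "b (m * L + L) \<le> q * b (m * L)" by (rule step)
    also have "\<dots> \<le> q * q ^ m" using q Suc by (intro mult_left_mono) auto
    finally show ?case by (simp add: add.commute)
  qed
  define N where "N = {X :: nat \<Rightarrow> int^'d. \<forall>k. norm (rv (X k) :: real^'d) \<le> real R}"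
  have Nm: "N \<in> sets P0"
  proof -
    have [measurable]: "(\<lambda>X :: nat \<Rightarrow> int^'d. norm (rv (X k) :: real^'d)) \<in> borel_measurable pathM" for k
      by (rule measurable_compose[OF measurable_coord]) simp
    have "{X \<in> space P0. \<forall>k. norm (rv (X k) :: real^'d) \<le> real R} \<in> sets P0" by measurable
    then show ?thesis by (simp add: N_def)
  qed
  have "measure P0 N \<le> q ^ m" for m
  proof -
    define S where "S w \<longleftrightarrow> (\<forall>i\<le>m * L. norm (rv (sum_list (take i w)) :: real^'d) \<le> real R)" for w
    have "measure P0 N \<le> measure P0 {X\<in>space P0. S (steps X (m * L))}"
    proof (rule P.finite_measure_mono_AE)
      show "AE X in P0. X \<in> N \<longrightarrow> X \<in> {X\<in>space P0. S (steps X (m * L))}"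
        using AE_nnpath by eventually_elim (auto simp: N_def S_def nnpath_def sum_list_take_steps)
      show "{X\<in>space P0. S (steps X (m * L))} \<in> sets P0" by measurable
    qed
    also have "\<dots> = (\<Sum>w\<in>{w\<in>paths (m * L). S w}. W w)" using prob_steps by simp
    also have "{w\<in>paths (m * L). S w} = B (m * L)" by (auto simp: S_def B_def)
    finally show ?thesis using bq[of m] by (simp add: b_def)
  qed
  moreover have "(\<lambda>m. q ^ m) \<longlonglongrightarrow> 0" using q by (intro LIMSEQ_power_zero) auto
  ultimately have "measure P0 N \<le> 0" by (intro LIMSEQ_le_const) auto
  then have "N \<in> null_sets P0" using Nm by (auto simp: null_sets_def P.emeasure_eq_measure measure_le_0_iff)
  then have "AE X in P0. X \<notin> N" by (rule AE_not_in)
  then show ?thesis by eventually_elim (auto simp: N_def not_le)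
qed

lemma AE_regenI:
  assumes fin: "(\<integral>\<^sup>+X. f X \<partial>P0) < \<infinity>" and inf: "AE X in P0. tau u X (Suc 0) = \<infinity> \<longrightarrow> f X = \<infinity>"
  shows "AE X in P0. \<exists>t. regen u X t"
proof -
  define A where "A = {X :: nat \<Rightarrow> int^'d. tau u X (Suc 0) = \<infinity>}"
  have A: "A \<in> sets P0"
    using measurable_sets[OF measurable_tau_1, of "{\<infinity>}" u] by (simp add: A_def vimage_def)
  have "\<infinity> * emeasure P0 A = (\<integral>\<^sup>+X. \<infinity> * indicator A X \<partial>P0)"
    using A by (subst nn_integral_cmult_indicator) auto
  also have "\<dots> \<le> (\<integral>\<^sup>+X. f X \<partial>P0)"
    by (rule nn_integral_mono_AE, use inf in eventually_elim) (auto simp: A_def indicator_def)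
  also note fin
  finally have "emeasure P0 A = 0" by (auto simp: ennreal_mult_eq_top_iff ennreal_top_mult split: if_splits)
  then have "AE X in P0. X \<notin> A" using A by (intro AE_not_in) (auto simp: null_sets_def)
  then show ?thesis
    by eventually_elim (auto simp: A_def tau_1 split: if_splits)
qed

lemma AE_regen_nonnestling:
  assumes "(\<integral>\<^sup>+X. (case tau u X (Suc 0) of enat t \<Rightarrow> ennreal (exp (2 * c3 * real t)) | \<infinity> \<Rightarrow> \<infinity>) \<partial>P0) < \<infinity>"
  shows "AE X in P0. \<exists>t. regen u X t"
  by (rule AE_regenI[OF assms]) simp

text \<open>Without a regeneration the supremum runs over all \<open>n \<ge> 1\<close>, and it is
  infinite because the walk is almost surely unbounded; the finite mean excludes this.\<close>

lemma AE_regen_nestling: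
  assumes "0 < c4"
    and "(\<integral>\<^sup>+X. (SUP n\<in>{n. 1 \<le> n \<and> enat n \<le> tau u X (Suc 0)}. ennreal (exp (c4 * norm (rv (X n) :: real^'d)))) \<partial>P0) < \<infinity>"
  shows "AE X in P0. \<exists>t. regen u X t"
proof (rule AE_regenI[OF assms(2)])
  have "AE X in P0. \<forall>R. \<exists>k. real R < norm (rv (X k) :: real^'d)"
    unfolding AE_all_countable using AE_unbounded by blast
  then show "AE X in P0. tau u X (Suc 0) = \<infinity> \<longrightarrow>
      (SUP n\<in>{n. 1 \<le> n \<and> enat n \<le> tau u X (Suc 0)}. ennreal (exp (c4 * norm (rv (X n) :: real^'d)))) = \<infinity>"
    using AE_nnpath
  proof eventually_elim
    case (elim X)
    show ?case
    proof (intro impI)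
      assume inf: "tau u X (Suc 0) = \<infinity>"
      have "\<exists>i\<in>{n. 1 \<le> n \<and> enat n \<le> tau u X (Suc 0)}. of_nat m \<le> ennreal (exp (c4 * norm (rv (X i) :: real^'d)))" for m
      proof -
        obtain R :: nat where R: "real m / c4 \<le> real R" using real_arch_simple by blast
        obtain k where k: "real R < norm (rv (X k) :: real^'d)" using elim by blast
        have "k \<noteq> 0" using k elim by (intro notI) (simp add: nnpath_def)
        have "real m \<le> c4 * norm (rv (X k) :: real^'d)"
          using R k assms(1) by (simp add: pos_divide_le_eq mult.commute) (smt (verit) mult_left_mono)
        also have "\<dots> \<le> exp (c4 * norm (rv (X k) :: real^'d))"
          using exp_ge_add_one_self[of "c4 * norm (rv (X k) :: real^'d)"] by linarith
        finally have "of_nat m \<le> ennreal (exp (c4 * norm (rv (X k) :: real^'d)))"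
          by (simp add: ennreal_of_nat_eq_real_of_nat ennreal_leI)
        then show ?thesis using \<open>k \<noteq> 0\<close> inf by (intro bexI[of _ k]) auto
      qed
      then have "(SUP n\<in>{n. 1 \<le> n \<and> enat n \<le> tau u X (Suc 0)}. ennreal (exp (c4 * norm (rv (X n) :: real^'d)))) = top"
        by (rule ennreal_SUP_eq_top)
      then show "(SUP n\<in>{n. 1 \<le> n \<and> enat n \<le> tau u X (Suc 0)}. ennreal (exp (c4 * norm (rv (X n) :: real^'d)))) = \<infinity>"
        by simp
    qed
  qed
qed

end

context rwre_dir
begin

section \<open>Finiteness of \<open>AA\<close>, the root of \<open>Phi\<close> and the existence of
  the limit\<close>

lemma AA_antimono: "r \<le> r' \<Longrightarrow> AA \<theta> r' \<le> AA \<theta> r"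
  unfolding AA_def supA_def
  by (intro nn_integral_mono SUP_subset_mono order_refl) (auto intro!: ennreal_leI mult_right_mono)

text \<open>The walk moves at most distance \<open>k\<close> in \<open>k\<close> steps, so the
  exponent never exceeds (norm \<theta> + |r|) * tau_1.\<close>

lemma AA_finite_nonnestling:
  assumes "(\<integral>\<^sup>+X. (case tau u X (Suc 0) of enat t \<Rightarrow> ennreal (exp (2 * c3 * real t)) | \<infinity> \<Rightarrow> \<infinity>) \<partial>P0) < \<infinity>"
    and "norm \<theta> + \<bar>r\<bar> \<le> 2 * c3"
  shows "AA \<theta> r < \<infinity>"
proof -
  have "AA \<theta> r \<le> (\<integral>\<^sup>+X. (case tau u X (Suc 0) of enat t \<Rightarrow> ennreal (exp (2 * c3 * real t)) | \<infinity> \<Rightarrow> \<infinity>) \<partial>P0)"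
    unfolding AA_def
  proof (rule nn_integral_mono_AE, use AE_nnpath in eventually_elim)
    case (elim X)
    show ?case
    proof (cases "tau u X (Suc 0)")
      case (enat t)
      have "supA u \<theta> r X \<le> ennreal (exp (2 * c3 * real t))"
        unfolding supA_def
      proof (intro SUP_least ennreal_leI)
        fix k assume "k \<in> {k. enat k \<le> tau u X (Suc 0)}"
        then have k: "k \<le> t" using enat by simp
        have X: "norm (rv (X k) :: real^'d) \<le> real k"
          using norm_rv_sum_list[OF set_steps[OF elim, of k]] elim by (simp add: sum_list_steps nnpath_def)
        have "\<theta> \<bullet> rv (X k) - r * real k \<le> norm \<theta> * real k + \<bar>r\<bar> * real k"
        proof -
          have "\<theta> \<bullet> rv (X k) \<le> norm \<theta> * norm (rv (X k))" by (rule norm_cauchy_schwarz)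
          also have "\<dots> \<le> norm \<theta> * real k" using X by (intro mult_left_mono) auto
          finally have "\<theta> \<bullet> rv (X k) \<le> norm \<theta> * real k" .
          moreover have "- r * real k \<le> \<bar>r\<bar> * real k" by (intro mult_right_mono) auto
          ultimately show ?thesis by linarith
        qed
        also have "\<dots> = (norm \<theta> + \<bar>r\<bar>) * real k" by (simp add: distrib_right)
        also have "\<dots> \<le> 2 * c3 * real t"
        proof (intro mult_mono)
          show "0 \<le> 2 * c3" using assms(2) norm_ge_zero[of \<theta>] by linarith
        qed (use assms(2) k in auto)
        finally show "exp (\<theta> \<bullet> rv (X k) - r * real k) \<le> exp (2 * c3 * real t)" by simp
      qed
      then show ?thesis using enat by simp
    qed simp
  qed
  then show ?thesis using assms(1) by (rule order.strict_trans1)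
qed

lemma AA_finite_nestling:
  assumes "(\<integral>\<^sup>+X. (SUP n\<in>{n. 1 \<le> n \<and> enat n \<le> tau u X (Suc 0)}. ennreal (exp (c4 * norm (rv (X n) :: real^'d)))) \<partial>P0) < \<infinity>"
    and c4: "norm \<theta> \<le> c4" and r: "0 \<le> r"
  shows "AA \<theta> r < \<infinity>"
proof -
  have "AA \<theta> r \<le> (\<integral>\<^sup>+X. (SUP n\<in>{n. 1 \<le> n \<and> enat n \<le> tau u X (Suc 0)}. ennreal (exp (c4 * norm (rv (X n) :: real^'d)))) \<partial>P0)"
    unfolding AA_def
  proof (rule nn_integral_mono_AE, use AE_nnpath in eventually_elim)
    case (elim X)
    define T where "T = {n. 1 \<le> n \<and> enat n \<le> tau u X (Suc 0)}"
    have "enat 0 < tau u X (Suc 0)" by (rule tau_1_gt) (simp add: regen_def)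
    then have one: "1 \<in> T"
      unfolding T_def by (cases "tau u X (Suc 0)") auto
    have c40: "0 \<le> c4" using c4 norm_ge_zero order_trans by blast
    show "supA u \<theta> r X \<le> (SUP n\<in>T. ennreal (exp (c4 * norm (rv (X n) :: real^'d))))"
      unfolding supA_def
    proof (rule SUP_least)
      fix k assume k: "k \<in> {k. enat k \<le> tau u X (Suc 0)}"
      show "ennreal (exp (\<theta> \<bullet> rv (X k) - r * real k)) \<le> (SUP n\<in>T. ennreal (exp (c4 * norm (rv (X n) :: real^'d))))"
      proof (cases "k = 0")
        \<comment> \<open>The supremum in the assumption starts at 1, so the term at time 0, equal
          to 1, is compared with the one at time 1, which always belongs to the range.\<close>
        case True
        have "ennreal (exp (\<theta> \<bullet> rv (X k) - r * real k)) \<le> ennreal (exp (c4 * norm (rv (X 1) :: real^'d)))"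
          using True elim c40 by (intro ennreal_leI) (simp add: nnpath_def)
        then show ?thesis using one by (rule SUP_upper2[rotated])
      next
        case False
        have "\<theta> \<bullet> rv (X k) \<le> norm \<theta> * norm (rv (X k))" by (rule norm_cauchy_schwarz)
        also have "\<dots> \<le> c4 * norm (rv (X k))" using c4 by (intro mult_right_mono) auto
        finally have "\<theta> \<bullet> rv (X k) - r * real k \<le> c4 * norm (rv (X k))"
          using r by (smt (verit) mult_nonneg_nonneg of_nat_0_le_iff)
        then have "ennreal (exp (\<theta> \<bullet> rv (X k) - r * real k)) \<le> ennreal (exp (c4 * norm (rv (X k))))"
          by (intro ennreal_leI) simp
        moreover have "k \<in> T" using False k by (simp add: T_def)
        ultimately show ?thesis by (rule SUP_upper2[rotated])
      qed
    qed
  qed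
  then show ?thesis using assms(1) by (rule order.strict_trans1)
qed

lemma Phi_finite: "AA \<theta> r < \<infinity> \<Longrightarrow> Phi \<theta> r < \<infinity>"
proof (rule ccontr)
  assume A: "AA \<theta> r < \<infinity>" "\<not> Phi \<theta> r < \<infinity>"
  then have "Phi \<theta> r = \<infinity>" by (metis infinity_ennreal_def top.not_eq_extremum)
  then have "Phi \<theta> r * ennreal (pD u) = \<infinity>" using pD_pos by (simp add: ennreal_top_mult)
  then show False using Phi_le[of \<theta> r] A(1) by (simp add: top_unique)
qed

lemma Phi_eq_integral:
  assumes "Phi \<theta> r < \<infinity>"
  shows "integrable \<beta> (ew \<theta> r)" "Phi \<theta> r = ennreal (\<integral>b. ew \<theta> r b \<partial>\<beta>)"
proof -
  show i: "integrable \<beta> (ew \<theta> r)"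
    using assms by (intro integrableI_nonneg) (auto simp: Phi_def)
  show "Phi \<theta> r = ennreal (\<integral>b. ew \<theta> r b \<partial>\<beta>)"
    unfolding Phi_def by (rule nn_integral_eq_integral[OF i]) simp
qed

text \<open>Intermediate value theorem; continuity is dominated convergence, with the weight at the
  smallest rate \<open>lo\<close> as the dominating function.\<close>

lemma Phi_root:
  assumes fin: "AA \<theta> lo < \<infinity>" and le: "lo \<le> hi" and lo: "1 \<le> Phi \<theta> lo" and hi: "Phi \<theta> hi \<le> 1"
  shows "\<exists>r. lo \<le> r \<and> r \<le> hi \<and> Phi \<theta> r = 1"
proof -
  define f where "f r = (\<integral>b. ew \<theta> r b \<partial>\<beta>)" for r
  have P: "Phi \<theta> r < \<infinity>" if "lo \<le> r" for r
    using Phi_finite order.strict_trans1[OF AA_antimono[OF that] fin] by blast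
  have "continuous_on {lo..hi} f"
  proof (rule continuous_on_sequentiallyI)
    fix s a assume s: "\<forall>n. s n \<in> {lo..hi}" and a: "a \<in> {lo..hi}" and lim: "s \<longlonglongrightarrow> a"
    show "(\<lambda>n. f (s n)) \<longlonglongrightarrow> f a"
      unfolding f_def
    proof (rule integral_dominated_convergence[where w = "ew \<theta> lo"])
      show "integrable \<beta> (ew \<theta> lo)" using Phi_eq_integral P by blast
      show "AE b in \<beta>. (\<lambda>n. ew \<theta> (s n) b) \<longlonglongrightarrow> ew \<theta> a b"
        unfolding ew_def by (intro AE_I2 tendsto_intros lim)
      show "AE b in \<beta>. norm (ew \<theta> (s n) b) \<le> ew \<theta> lo b" for n
        using s by (intro AE_I2) (auto simp: ew_def intro!: mult_right_mono)
    qed auto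
  qed
  moreover have "1 \<le> f lo" using lo Phi_eq_integral(2)[OF P[of lo]] by (simp add: f_def)
  moreover have "f hi \<le> 1"
    using hi Phi_eq_integral(2)[OF P[of hi]] le by (simp add: f_def)
  ultimately obtain r where r: "lo \<le> r" "r \<le> hi" "f r = 1"
    using IVT2'[of f hi 1 lo] le by auto
  then have "Phi \<theta> r = 1" using Phi_eq_integral(2)[OF P[of r]] by (simp add: f_def)
  then show ?thesis using r by blast
qed

lemma AE_\<beta>_norm: "AE b in \<beta>. norm (rv (sum_list b) :: real^'d) \<le> real (length b)"
  unfolding AE_measure_pmf_iff
proof
  fix b assume "b \<in> set_pmf \<beta>"
  then have "set b \<subseteq> nnU" using set_\<beta> by (auto simp: blocks_def first_blocks_def)
  then show "norm (rv (sum_list b) :: real^'d) \<le> real (length b)" by (rule norm_rv_sum_list)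
qed

text \<open>A block of length \<open>l\<close> has displacement at most \<open>l\<close>. With
  \<open>Phi_minus_norm_ge\<close> this brackets the root between - norm \<theta> and norm
  \<theta>.\<close>

lemma Phi_norm_le: "Phi \<theta> (norm \<theta>) \<le> 1"
proof -
  have "Phi \<theta> (norm \<theta>) \<le> (\<integral>\<^sup>+b. 1 \<partial>\<beta>)"
    unfolding Phi_def
  proof (rule nn_integral_mono_AE, use AE_\<beta>_norm in eventually_elim)
    case (elim b)
    have "\<theta> \<bullet> rv (sum_list b) \<le> norm \<theta> * norm (rv (sum_list b))" by (rule norm_cauchy_schwarz)
    also have "\<dots> \<le> norm \<theta> * real (length b)" using elim by (intro mult_left_mono) auto
    finally show ?case by (simp add: ew_def)
  qed
  then show ?thesis by (simp add: measure_pmf.emeasure_space_1)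
qed

lemma Phi_minus_norm_ge: "1 \<le> Phi \<theta> (- norm \<theta>)"
proof -
  have "(\<integral>\<^sup>+b. 1 \<partial>\<beta>) \<le> Phi \<theta> (- norm \<theta>)"
    unfolding Phi_def
  proof (rule nn_integral_mono_AE, use AE_\<beta>_norm in eventually_elim)
    case (elim b)
    have "\<bar>\<theta> \<bullet> rv (sum_list b)\<bar> \<le> norm \<theta> * norm (rv (sum_list b))" by (rule Cauchy_Schwarz_ineq2)
    also have "\<dots> \<le> norm \<theta> * real (length b)" using elim by (intro mult_left_mono) auto
    finally have "0 \<le> \<theta> \<bullet> rv (sum_list b) - (- norm \<theta>) * real (length b)" by simp
    then have "1 \<le> ew \<theta> (- norm \<theta>) b" unfolding ew_def by (simp only: one_le_exp_iff)
    then show ?case by simp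
  qed
  then show ?thesis by (simp add: measure_pmf.emeasure_space_1)
qed

text \<open>What the remaining argument requires of a tilt: \<open>Lambda_a\<close> is a genuine
  limit rather than an arbitrary value of \<open>lim\<close>, it is the renewal root, and there is
  room below it for exponential moments.\<close>

definition good :: "real^'d \<Rightarrow> bool" where
  "good \<theta> \<longleftrightarrow> (\<lambda>n. ln (Zn \<theta> n) / real n) \<longlonglongrightarrow> Lambda_a P0 \<theta> \<and> Phi \<theta> (Lambda_a P0 \<theta>) = 1 \<and>
    (\<exists>\<eta>>0. AA \<theta> (Lambda_a P0 \<theta> - \<eta>) < \<infinity>)"

lemma Lambda_eqI: "(\<lambda>n. ln (Zn \<theta> n) / real n) \<longlonglongrightarrow> r \<Longrightarrow> Lambda_a P0 \<theta> = r"
  unfolding Lambda_a_def Zn_def[symmetric] by (rule limI)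

lemma good_nonnestling:
  assumes "u \<noteq> 0"
    and fin: "(\<integral>\<^sup>+X. (case tau u X (Suc 0) of enat t \<Rightarrow> ennreal (exp (2 * c3 * real t)) | \<infinity> \<Rightarrow> \<infinity>) \<partial>P0) < \<infinity>"
    and \<theta>: "norm \<theta> < c3"
  shows "good \<theta>"
proof -
  have "AA \<theta> (- norm \<theta>) < \<infinity>" using \<theta> by (intro AA_finite_nonnestling[OF fin]) auto
  then obtain r where r: "- norm \<theta> \<le> r" "r \<le> norm \<theta>" "Phi \<theta> r = 1"
    using Phi_root[of \<theta> "- norm \<theta>" "norm \<theta>"] Phi_norm_le Phi_minus_norm_ge by auto
  \<comment> \<open>Since \<open>\<bar>r\<bar>\<close> is at most norm \<theta>, this margin keeps
    norm \<theta> + \<open>\<bar>r - \<eta>\<bar>\<close> within 2 * c3.\<close>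
  define \<eta> where "\<eta> = 2 * c3 - 2 * norm \<theta>"
  have fin': "AA \<theta> (r - \<eta>) < \<infinity>"
    using r \<theta> by (intro AA_finite_nonnestling[OF fin]) (auto simp: \<eta>_def)
  have \<eta>: "\<eta> > 0" using \<theta> by (simp add: \<eta>_def)
  have "AA \<theta> r < \<infinity>" using AA_antimono[of "r - \<eta>" r \<theta>] fin' \<eta> by (auto intro: order.strict_trans1)
  then have lim: "(\<lambda>n. ln (Zn \<theta> n) / real n) \<longlonglongrightarrow> r" using r assms(1) by (intro ln_Zn_tendsto)
  show ?thesis unfolding good_def Lambda_eqI[OF lim] using lim r fin' \<eta> by blast
qed

text \<open>\<open>AA\<close> is available for nonnegative rates only, so the slack in
  \<open>good\<close> has to be the root itself, which must therefore be strictly positive. If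
  \<open>Phi \<theta> 0 \<le> 1\<close>, the limit is 0 and contradicts the assumption on
  \<open>Lambda_a\<close>.\<close>

lemma good_nestling:
  assumes "u \<noteq> 0" and nest: "nestling \<mu>"
    and fin: "(\<integral>\<^sup>+X. (SUP n\<in>{n. 1 \<le> n \<and> enat n \<le> tau u X (Suc 0)}. ennreal (exp (c4 * norm (rv (X n) :: real^'d)))) \<partial>P0) < \<infinity>"
    and \<theta>: "norm \<theta> < c4" and pos: "0 < Lambda_a P0 \<theta>"
  shows "good \<theta>"
proof -
  have fin0: "AA \<theta> r < \<infinity>" if "0 \<le> r" for r using \<theta> that by (intro AA_finite_nestling[OF fin]) auto
  show ?thesis
  proof (cases "1 < Phi \<theta> 0")
    case True
    then obtain r where r: "0 \<le> r" "Phi \<theta> r = 1"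
      using Phi_root[OF fin0[OF order_refl] norm_ge_zero less_imp_le[OF True] Phi_norm_le] by auto
    have lim: "(\<lambda>n. ln (Zn \<theta> n) / real n) \<longlonglongrightarrow> r" using r assms(1) fin0[of r] by (intro ln_Zn_tendsto)
    have "0 < r" using pos Lambda_eqI[OF lim] by simp
    \<comment> \<open>The margin is the whole of \<open>r\<close>, down to rate 0.\<close>
    moreover have "AA \<theta> (r - r) < \<infinity>" using fin0[of 0] by simp
    ultimately show ?thesis unfolding good_def Lambda_eqI[OF lim] using lim r by blast
  next
    case False
    \<comment> \<open>The upper half comes from the renewal bound at rate 0, the lower half from
      trapping.\<close>
    have "(\<lambda>n. ln (Zn \<theta> n) / real n) \<longlonglongrightarrow> 0"
    proof (rule order_tendstoI)
      fix a :: real assume a: "0 < a"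
      have "eventually (\<lambda>n. ln (Zn \<theta> n) / real n \<le> 0 + a / 2) sequentially"
        using False fin0[of 0] a by (intro ln_Zn_upper) auto
      then show "eventually (\<lambda>n. ln (Zn \<theta> n) / real n < a) sequentially"
        by eventually_elim (use a in linarith)
    next
      fix a :: real assume a: "a < 0"
      define \<kappa> where "\<kappa> = - a / 2"
      have \<kappa>: "0 < \<kappa>" using a by (simp add: \<kappa>_def)
      obtain c where c: "c > 0" "\<And>n. c * exp (- \<kappa> * real n) \<le> Zn \<theta> n"
        using nestling_Zn_lower[OF nest \<kappa>, of \<theta>] by auto
      have "(\<lambda>n. ln c / real n) \<longlonglongrightarrow> 0" by real_asymp
      then have "eventually (\<lambda>n. ln c / real n > - \<kappa>) sequentially"
        using \<kappa> by (intro order_tendstoD) auto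
      then show "eventually (\<lambda>n. a < ln (Zn \<theta> n) / real n) sequentially"
        using eventually_gt_at_top[of 0]
      proof eventually_elim
        case (elim n)
        have "ln c - \<kappa> * real n = ln (c * exp (- \<kappa> * real n))" using c(1) by (simp add: ln_mult)
        also have "\<dots> \<le> ln (Zn \<theta> n)" using c by (intro ln_mono) auto
        finally have "(ln c - \<kappa> * real n) / real n \<le> ln (Zn \<theta> n) / real n"
          by (intro divide_right_mono) auto
        moreover have "(ln c - \<kappa> * real n) / real n = ln c / real n - \<kappa>"
          using elim by (simp add: diff_divide_distrib)
        moreover have "a = - 2 * \<kappa>" by (simp add: \<kappa>_def)
        ultimately show ?case using elim by linarith
      qed
    qed
    then show ?thesis using pos Lambda_eqI by fastforce
  qed
qed

end

subsection \<open>The tilted block law\<close>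

lemma exp_le_quadratic: "exp x \<le> 1 + x + x\<^sup>2 * exp \<bar>x\<bar>" for x :: real
proof -
  obtain t where t: "\<bar>t\<bar> \<le> \<bar>x\<bar>" "exp x = (\<Sum>m<2. x ^ m / fact m) + exp t / fact 2 * x ^ 2"
    using Maclaurin_exp_le[of x 2] by blast
  have "exp t / fact 2 * x ^ 2 \<le> exp \<bar>x\<bar> * x ^ 2"
  proof (rule mult_right_mono)
    have "exp t / fact 2 \<le> exp t" by (simp add: fact_numeral)
    also have "\<dots> \<le> exp \<bar>x\<bar>" using t by simp
    finally show "exp t / fact 2 \<le> exp \<bar>x\<bar>" .
  qed simp
  then show ?thesis using t(2) by (simp add: numeral_2_eq_2 mult.commute)
qed

text \<open>Expansion at \<open>s = 0\<close>: the exponential moment is 1 + s * E V plus a term of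
  order s^2, and the negative linear term wins for small \<open>s\<close>. Half of the exponent
  \<open>\<eta>\<close> pays for V^2 and the other half for the remainder exp |s V|.\<close>

lemma exp_moment_le_1:
  fixes V :: "'a \<Rightarrow> real" and p :: "'a pmf"
  assumes \<eta>: "0 < \<eta>" and int: "integrable p (\<lambda>x. exp (\<eta> * \<bar>V x\<bar>))" and neg: "(\<integral>x. V x \<partial>p) < 0"
  shows "\<exists>s0>0. \<forall>s. 0 < s \<longrightarrow> s \<le> s0 \<longrightarrow> (\<integral>\<^sup>+x. ennreal (exp (s * V x)) \<partial>p) \<le> 1"
proof -
  \<comment> \<open>The constant 8 / \<eta>^2 arises from y^2 / 2 \<le> exp y at y = \<eta> * |V| /
    2.\<close>
  define D where "D = (8 / \<eta>\<^sup>2) * (\<integral>x. exp (\<eta> * \<bar>V x\<bar>) \<partial>p)"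
  define v where "v = (\<integral>x. V x \<partial>p)"
  have D0: "0 \<le> D" unfolding D_def by (intro mult_nonneg_nonneg integral_nonneg_AE) auto
  \<comment> \<open>A non-integrable function has integral 0 by convention, so a negative integral
    implies integrability.\<close>
  have intV: "integrable p V"
    using neg not_integrable_integral_eq[of p V] by fastforce
  \<comment> \<open>The first bound keeps |s V| within half of the exponent, the second makes v + s
    * D nonpositive.\<close>
  define s0 where "s0 = min (\<eta> / 2) (- v / (D + 1))"
  have s0: "0 < s0" using \<eta> neg D0 by (auto simp: s0_def v_def divide_neg_pos)
  have "(\<integral>\<^sup>+x. ennreal (exp (s * V x)) \<partial>p) \<le> 1" if s: "0 < s" "s \<le> s0" for s
  proof -
    define g where "g x = 1 + s * V x + s\<^sup>2 * (8 / \<eta>\<^sup>2) * exp (\<eta> * \<bar>V x\<bar>)" for x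
    have le: "exp (s * V x) \<le> g x" for x
    proof -
      define y where "y = \<eta> / 2 * \<bar>V x\<bar>"
      have y0: "0 \<le> y" using \<eta> by (simp add: y_def)
      have "y\<^sup>2 / 2 \<le> exp y"
        using exp_lower_Taylor_quadratic[OF y0] y0 by linarith
      moreover have "y\<^sup>2 / 2 = \<eta>\<^sup>2 / 8 * (V x)\<^sup>2" by (simp add: y_def power_mult_distrib power_divide)
      ultimately have "\<eta>\<^sup>2 / 8 * (V x)\<^sup>2 \<le> exp y" by simp
      then have 1: "(V x)\<^sup>2 \<le> 8 / \<eta>\<^sup>2 * exp y"
        using \<eta> by (simp add: field_simps)
      have "s \<le> \<eta> / 2" using s by (simp add: s0_def)
      then have "s * \<bar>V x\<bar> \<le> y" unfolding y_def by (rule mult_right_mono) simp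
      then have "\<bar>s * V x\<bar> \<le> y" using s by (simp add: abs_mult)
      then have 2: "exp \<bar>s * V x\<bar> \<le> exp y" by simp
      have "exp (s * V x) \<le> 1 + s * V x + (s * V x)\<^sup>2 * exp \<bar>s * V x\<bar>" by (rule exp_le_quadratic)
      also have "(s * V x)\<^sup>2 * exp \<bar>s * V x\<bar> = s\<^sup>2 * ((V x)\<^sup>2 * exp \<bar>s * V x\<bar>)" by (simp add: power_mult_distrib)
      also have "\<dots> \<le> s\<^sup>2 * ((8 / \<eta>\<^sup>2 * exp y) * exp y)"
        using 1 2 by (intro mult_left_mono mult_mono) auto
      also have "exp y * exp y = exp (\<eta> * \<bar>V x\<bar>)" by (simp add: y_def flip: exp_add)
      then have "s\<^sup>2 * ((8 / \<eta>\<^sup>2 * exp y) * exp y) = s\<^sup>2 * (8 / \<eta>\<^sup>2) * exp (\<eta> * \<bar>V x\<bar>)" by (simp add: mult.assoc)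
      finally show ?thesis by (simp add: g_def)
    qed
    have g0: "0 \<le> g x" for x using le[of x] exp_ge_zero order_trans by blast
    have ig: "integrable p g" unfolding g_def using intV int by auto
    have "(\<integral>x. g x \<partial>p) = 1 + s * v + s\<^sup>2 * D"
      unfolding g_def v_def D_def using intV int by simp
    also have "\<dots> \<le> 1"
    proof -
      have "s \<le> - v / (D + 1)" using s(2) unfolding s0_def by (rule min.boundedE)
      then have "s * (D + 1) \<le> - v" using D0 by (subst (asm) pos_le_divide_eq) auto
      then have "v + s * D \<le> 0" using s by (simp add: distrib_left)
      then have "s * (v + s * D) \<le> 0" using s by (simp add: mult_le_0_iff)
      then show ?thesis by (simp add: distrib_left power2_eq_square mult.assoc)
    qed
    finally have g1: "(\<integral>x. g x \<partial>p) \<le> 1" .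
    have "(\<integral>\<^sup>+x. ennreal (exp (s * V x)) \<partial>p) \<le> (\<integral>\<^sup>+x. ennreal (g x) \<partial>p)"
      by (intro nn_integral_mono ennreal_leI le)
    also have "\<dots> = ennreal (\<integral>x. g x \<partial>p)" by (rule nn_integral_eq_integral[OF ig]) (simp add: g0)
    also have "\<dots> \<le> 1" using ennreal_leI[OF g1] by simp
    finally show ?thesis .
  qed
  then show ?thesis using s0 by blast
qed

lemma map_pmf_take_replicate_pmf: "map_pmf (take k) (replicate_pmf (k + q) p) = replicate_pmf k p"
proof (induction k)
  case 0
  have "map_pmf (\<lambda>_. []) (replicate_pmf q p) = return_pmf []" by (simp add: map_pmf_const)
  then show ?case by (simp add: take_0[abs_def])
next
  case (Suc k)
  have "map_pmf (take (Suc k)) (replicate_pmf (Suc k + q) p) =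
    bind_pmf p (\<lambda>x. map_pmf ((#) x) (map_pmf (take k) (replicate_pmf (k + q) p)))"
    by (simp add: map_bind_pmf map_pmf_def bind_assoc_pmf bind_return_pmf)
  then show ?case unfolding Suc by (simp add: map_pmf_def bind_assoc_pmf bind_return_pmf)
qed

lemma replicate_pmf_Suc_pair:
  "replicate_pmf (Suc n) p = map_pmf (\<lambda>(x, xs). x # xs) (pair_pmf p (replicate_pmf n p))"
  by (simp add: map_pmf_def pair_pmf_def bind_assoc_pmf bind_return_pmf)

section \<open>Sums of a function of \<open>K\<close> consecutive steps along a word\<close>

definition pad :: "(int^'d) list \<Rightarrow> nat \<Rightarrow> int^'d" where
  "pad l = (\<lambda>i. if i < length l then l ! i else 0)"

text \<open>Starting positions run over \<open>w\<close> only, while \<open>v\<close> supplies the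
  steps that \<open>f\<close> reads beyond its end; in this form \<open>SL_append\<close> holds
  without error. The zeros of \<open>pad\<close> are seen only where fewer than \<open>K\<close>
  steps remain.\<close>

definition Ysum :: "((nat \<Rightarrow> int^'d) \<Rightarrow> real) \<Rightarrow> real \<Rightarrow> (int^'d) list \<Rightarrow> (int^'d) list \<Rightarrow> real" where
  "Ysum f m w v = (\<Sum>j<length w. f (pad (drop j w @ v)) - m)"

definition SL :: "((nat \<Rightarrow> int^'d) \<Rightarrow> real) \<Rightarrow> real \<Rightarrow> (int^'d) list \<Rightarrow> real" where
  "SL f m w = Ysum f m w []"

lemma SL_append: "SL f m (w @ v) = Ysum f m w v + SL f m v"
proof -
  have split: "(\<Sum>i<a + b. g i) = (\<Sum>i<a. g i) + (\<Sum>i<b. g (a + i))" for g :: "nat \<Rightarrow> real" and a b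
    by (induction b) (simp_all add: add.assoc)
  show ?thesis unfolding SL_def Ysum_def length_append split
    by (intro arg_cong2[where f = "(+)"] sum.cong) auto
qed

locale local_fun =
  fixes f :: "(nat \<Rightarrow> int^'d::finite) \<Rightarrow> real" and K :: nat and m C :: real
  assumes f_local: "\<And>w w'. (\<And>i. i < K \<Longrightarrow> w i = w' i) \<Longrightarrow> f w = f w'"
    and f_bound: "\<And>w. \<bar>f w - m\<bar> \<le> C"
begin

lemma C_nonneg: "0 \<le> C"
  using f_bound[of undefined] by linarith

lemma pad_append_local: "K \<le> length l \<Longrightarrow> f (pad (l @ v)) = f (pad l)"
  by (intro f_local) (auto simp: pad_def nth_append)

lemma Ysum_bound: "\<bar>Ysum f m w v\<bar> \<le> C * real (length w)"
proof -
  have "\<bar>Ysum f m w v\<bar> \<le> (\<Sum>j<length w. \<bar>f (pad (drop j w @ v)) - m\<bar>)"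
    unfolding Ysum_def by (rule sum_abs)
  also have "\<dots> \<le> (\<Sum>j<length w. C)" by (intro sum_mono f_bound)
  finally show ?thesis by (simp add: mult.commute)
qed

lemma SL_bound: "\<bar>SL f m w\<bar> \<le> C * real (length w)"
  unfolding SL_def by (rule Ysum_bound)

text \<open>Only the last \<open>K\<close> indices can differ, each by at most 2 * C; the bound does
  not depend on \<open>n\<close>.\<close>

lemma sum_boundary:
  fixes g h :: "nat \<Rightarrow> real"
  assumes "\<And>j. j + K \<le> n \<Longrightarrow> g j = h j" and "\<And>j. \<bar>g j - h j\<bar> \<le> 2 * C"
  shows "\<bar>(\<Sum>j<n. g j) - (\<Sum>j<n. h j)\<bar> \<le> 2 * C * real K"
proof -
  have "\<bar>(\<Sum>j<n. g j) - (\<Sum>j<n. h j)\<bar> \<le> (\<Sum>j<n. \<bar>g j - h j\<bar>)"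
    by (simp add: sum_subtractf[symmetric] sum_abs)
  also have "\<dots> = (\<Sum>j\<in>{n - K..<n}. \<bar>g j - h j\<bar>)"
    using assms(1) by (intro sum.mono_neutral_right) auto
  also have "\<dots> \<le> (\<Sum>j\<in>{n - K..<n}. 2 * C)" by (intro sum_mono assms(2))
  also have "\<dots> = 2 * C * real (card {n - K..<n})" by simp
  also have "\<dots> \<le> 2 * C * real K" using C_nonneg by (intro mult_left_mono) auto
  finally show ?thesis .
qed

lemma f_diff: "\<bar>(f w - m) - (f w' - m)\<bar> \<le> 2 * C"
  using f_bound[of w] f_bound[of w'] by linarith

text \<open>\<open>f\<close> looks into \<open>v\<close> only from the last \<open>K\<close>
  positions of \<open>w\<close>, so cutting a word costs a constant, whatever the lengths of the
  pieces.\<close>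

lemma Ysum_SL: "\<bar>Ysum f m w v - SL f m w\<bar> \<le> 2 * C * real K"
  unfolding SL_def Ysum_def
proof (rule sum_boundary)
  fix j assume "j + K \<le> length w"
  then show "f (pad (drop j w @ v)) - m = f (pad (drop j w @ [])) - m"
    using pad_append_local[of "drop j w" v] by simp
qed (rule f_diff)

lemma SL_append_le: "SL f m (w @ v) \<le> SL f m w + SL f m v + 2 * C * real K"
  using Ysum_SL[of w v] by (simp add: SL_append)

lemma stepseq_local:
  assumes "j + K \<le> n"
  shows "f (stepseq X j) = f (pad (drop j (steps X n)))"
proof (rule f_local)
  fix i assume "i < K"
  then have "i < n - j" "j + i < n" using assms by linarith+
  then show "stepseq X j i = pad (drop j (steps X n)) i"
    using assms by (simp add: stepseq_def pad_def steps_def)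
qed

lemma SL_steps: "\<bar>(\<Sum>j<n. f (stepseq X j) - m) - SL f m (steps X n)\<bar> \<le> 2 * C * real K"
proof -
  have "SL f m (steps X n) = (\<Sum>j<n. f (pad (drop j (steps X n))) - m)"
    by (simp add: SL_def Ysum_def)
  then show ?thesis
    using sum_boundary[of n "\<lambda>j. f (stepseq X j) - m" "\<lambda>j. f (pad (drop j (steps X n))) - m"]
      stepseq_local[of _ n X] f_diff by auto
qed

text \<open>Each of the next \<open>K - 1\<close> blocks has at least one step; with the step at
  position \<open>j\<close> itself this makes \<open>K\<close> steps, and \<open>f\<close> reads no
  further.\<close>

lemma Ysum_take:
  assumes "K \<le> length bs + 1" "bs \<in> lists (blocks u)"
  shows "Ysum f m b (concat bs) = Ysum f m b (concat (take (K - 1) bs))"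
  unfolding Ysum_def
proof (intro sum.cong refl)
  fix j assume j: "j \<in> {..<length b}"
  have "take (K - 1) bs \<in> lists (blocks u)" using assms(2) by (auto dest: in_set_takeD)
  then have "K - 1 \<le> length (concat (take (K - 1) bs))"
    using length_concat_blocks[of "take (K - 1) bs" u] assms(1) by simp
  then have len: "K \<le> length (drop j b @ concat (take (K - 1) bs))" using j by auto
  have "concat bs = concat (take (K - 1) bs) @ concat (drop (K - 1) bs)"
    by (metis append_take_drop_id concat_append)
  then show "f (pad (drop j b @ concat bs)) - m = f (pad (drop j b @ concat (take (K - 1) bs))) - m"
    using pad_append_local[OF len, of "concat (drop (K - 1) bs)"] by simp
qed

end

locale rwre_tilt = rwre_dir \<mu> Pq c1 u
  for \<mu> :: "(int^'d::finite \<Rightarrow> real) measure" and Pq c1 u +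
  fixes \<theta> :: "real^'d"
  assumes good: "good \<theta>"
begin

abbreviation \<Lambda> :: real where "\<Lambda> \<equiv> Lambda_a P0 \<theta>"

lemma Phi_1: "Phi \<theta> \<Lambda> = 1"
  using good by (simp add: good_def)

definition \<gamma> :: "(int^'d) list pmf" where
  "\<gamma> = embed_pmf (\<lambda>b. pmf \<beta> b * ew \<theta> \<Lambda> b)"

lemma pmf_\<gamma>: "pmf \<gamma> b = pmf \<beta> b * ew \<theta> \<Lambda> b"
  unfolding \<gamma>_def
proof (rule pmf_embed_pmf)
  have "(\<integral>\<^sup>+b. ennreal (pmf \<beta> b * ew \<theta> \<Lambda> b) \<partial>count_space UNIV) = Phi \<theta> \<Lambda>"
    by (simp add: Phi_def nn_integral_measure_pmf ennreal_mult)
  then show "(\<integral>\<^sup>+b. ennreal (pmf \<beta> b * ew \<theta> \<Lambda> b) \<partial>count_space UNIV) = 1" using Phi_1 by simp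
qed simp

lemma set_\<gamma>: "set_pmf \<gamma> \<subseteq> blocks u"
proof
  fix b assume "b \<in> set_pmf \<gamma>"
  then have "pmf \<beta> b \<noteq> 0" by (auto simp: set_pmf_eq pmf_\<gamma>)
  then show "b \<in> blocks u" by (auto simp: pmf_\<beta> split: if_splits)
qed

lemma pmf_replicate_\<gamma>: "pmf (replicate_pmf n \<gamma>) bs = pmf (replicate_pmf n \<beta>) bs * ew \<theta> \<Lambda> (concat bs)"
proof -
  have "prod_list (map (pmf \<gamma>) bs) = prod_list (map (pmf \<beta>) bs) * ew \<theta> \<Lambda> (concat bs)"
    by (induction bs) (simp_all add: pmf_\<gamma> ew_append)
  then show ?thesis by (simp add: pmf_replicate_pmf)
qed

lemma replicate_\<gamma>_density:
  "measure_pmf (replicate_pmf n \<gamma>) = density (measure_pmf (replicate_pmf n \<beta>)) (\<lambda>bs. ennreal (ew \<theta> \<Lambda> (concat bs)))"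
proof -
  have "measure_pmf (replicate_pmf n \<gamma>) = density (count_space UNIV) (\<lambda>bs. ennreal (pmf (replicate_pmf n \<gamma>) bs))"
    by (rule measure_pmf_eq_density)
  also have "\<dots> = density (count_space UNIV)
      (\<lambda>bs. ennreal (pmf (replicate_pmf n \<beta>) bs) * ennreal (ew \<theta> \<Lambda> (concat bs)))"
    by (simp add: pmf_replicate_\<gamma> ennreal_mult)
  also have "\<dots> = density (density (count_space UNIV) (\<lambda>bs. ennreal (pmf (replicate_pmf n \<beta>) bs)))
      (\<lambda>bs. ennreal (ew \<theta> \<Lambda> (concat bs)))"
    by (rule density_density_eq[symmetric]) auto
  also have "density (count_space UNIV) (\<lambda>bs. ennreal (pmf (replicate_pmf n \<beta>) bs)) = measure_pmf (replicate_pmf n \<beta>)"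
    by (rule measure_pmf_eq_density[symmetric])
  finally show ?thesis .
qed

lemma nn_integral_replicate_\<gamma>:
  "(\<integral>\<^sup>+bs. g bs \<partial>replicate_pmf n \<gamma>) = (\<integral>\<^sup>+bs. ennreal (ew \<theta> \<Lambda> (concat bs)) * g bs \<partial>replicate_pmf n \<beta>)"
  unfolding replicate_\<gamma>_density by (rule nn_integral_density) auto

lemma integral_replicate_\<gamma>:
  fixes g :: "(int^'d) list list \<Rightarrow> real"
  shows "(\<integral>bs. g bs \<partial>replicate_pmf n \<gamma>) = (\<integral>bs. ew \<theta> \<Lambda> (concat bs) * g bs \<partial>replicate_pmf n \<beta>)"
  unfolding replicate_\<gamma>_density by (subst integral_density) auto

text \<open>A factor exponential in the length only lowers the rate of the tilt from \<Lambda> to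
  \<Lambda> - \<eta>, so the tilted lengths have exponential moments exactly where
  \<open>Phi\<close> is finite.\<close>

lemma exp_length_replicate_\<gamma>:
  "(\<integral>\<^sup>+bs. ennreal (exp (\<eta> * real (length (concat bs)))) \<partial>replicate_pmf n \<gamma>) = Phi \<theta> (\<Lambda> - \<eta>) ^ n"
proof -
  have "(\<integral>\<^sup>+bs. ennreal (exp (\<eta> * real (length (concat bs)))) \<partial>replicate_pmf n \<gamma>) =
    (\<integral>\<^sup>+bs. ennreal (ew \<theta> (\<Lambda> - \<eta>) (concat bs)) \<partial>replicate_pmf n \<beta>)"
    unfolding nn_integral_replicate_\<gamma>
    by (intro nn_integral_cong) (simp add: ew_def algebra_simps flip: ennreal_mult exp_add)
  then show ?thesis by (simp add: nn_integral_ew_replicate)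
qed

definition \<eta> :: real where
  "\<eta> = (SOME \<eta>. 0 < \<eta> \<and> AA \<theta> (\<Lambda> - \<eta>) < \<infinity>)"

lemma \<eta>: "0 < \<eta>" "AA \<theta> (\<Lambda> - \<eta>) < \<infinity>"
proof -
  have "\<exists>\<eta>. 0 < \<eta> \<and> AA \<theta> (\<Lambda> - \<eta>) < \<infinity>" using good by (auto simp: good_def)
  then have "0 < \<eta> \<and> AA \<theta> (\<Lambda> - \<eta>) < \<infinity>" unfolding \<eta>_def by (rule someI_ex)
  then show "0 < \<eta>" "AA \<theta> (\<Lambda> - \<eta>) < \<infinity>" by auto
qed

lemma integrable_exp_length:
  assumes "c \<le> \<eta>"
  shows "integrable (replicate_pmf n \<gamma>) (\<lambda>bs. exp (c * real (length (concat bs))))"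
proof (rule integrableI_nonneg)
  have "(\<integral>\<^sup>+bs. ennreal (exp (c * real (length (concat bs)))) \<partial>replicate_pmf n \<gamma>) \<le>
    (\<integral>\<^sup>+bs. ennreal (exp (\<eta> * real (length (concat bs)))) \<partial>replicate_pmf n \<gamma>)"
    using assms by (intro nn_integral_mono ennreal_leI) (simp add: mult_right_mono)
  also have "\<dots> < \<infinity>"
    unfolding exp_length_replicate_\<gamma> using Phi_finite[OF \<eta>(2)] by (simp add: power_less_top_ennreal)
  finally show "(\<integral>\<^sup>+bs. ennreal (exp (c * real (length (concat bs)))) \<partial>replicate_pmf n \<gamma>) < \<infinity>" .
qed auto

lemma integrable_length: "integrable (replicate_pmf n \<gamma>) (\<lambda>bs. real (length (concat bs)))"
proof (rule Bochner_Integration.integrable_bound)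
  show "integrable (replicate_pmf n \<gamma>) (\<lambda>bs. 1 / \<eta> * exp (\<eta> * real (length (concat bs))))"
    using integrable_exp_length[of \<eta> n] by auto
  show "AE bs in replicate_pmf n \<gamma>. norm (real (length (concat bs))) \<le> norm (1 / \<eta> * exp (\<eta> * real (length (concat bs))))"
  proof (rule AE_I2)
    fix bs :: "(int^'d) list list"
    have "\<eta> * real (length (concat bs)) \<le> exp (\<eta> * real (length (concat bs)))"
      using exp_ge_add_one_self[of "\<eta> * real (length (concat bs))"] by linarith
    then show "norm (real (length (concat bs))) \<le> norm (1 / \<eta> * exp (\<eta> * real (length (concat bs))))"
      using \<eta>(1) by (simp add: field_simps)
  qed
qed simp

lemma AE_replicate_\<gamma>: "AE bs in replicate_pmf n \<gamma>. bs \<in> lists (blocks u) \<and> length bs = n"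
  unfolding AE_measure_pmf_iff set_replicate_pmf using set_\<gamma> by auto

end

subsection \<open>Identification of the limiting measure\<close>

lemma tau_infinity: "tau u X (Suc 0) = \<infinity> \<Longrightarrow> tau u X (Suc m) = \<infinity>"
  by (induction m) (simp_all add: tau.simps(2)[of u X "Suc _"])

lemma tau_Suc_eq:
  "tau u X (Suc m) = (case tau u X (Suc 0) of \<infinity> \<Rightarrow> \<infinity> | enat t \<Rightarrow> enat t + tau u (pshift t X) m)"
proof (cases "tau u X (Suc 0)")
  case (enat t)
  then show ?thesis using tau_Suc_shift[OF enat] by (simp only: enat.case)
next
  case infinity
  then show ?thesis using tau_infinity[OF infinity] by (simp only: enat.case)
qed

lemma measurable_tau [measurable]:
  "(\<lambda>X :: nat \<Rightarrow> int^'d::finite. tau u X m) \<in> pathM \<rightarrow>\<^sub>M count_space UNIV"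
proof (induction m)
  case (Suc m)
  have "(\<lambda>X :: nat \<Rightarrow> int^'d. case tau u X (Suc 0) of \<infinity> \<Rightarrow> \<infinity> | enat t \<Rightarrow> enat t + tau u (pshift t X) m)
      \<in> pathM \<rightarrow>\<^sub>M count_space UNIV"
  proof (rule measurable_compose_countable[OF _ measurable_tau_1,
        where f = "\<lambda>s X. case s of \<infinity> \<Rightarrow> \<infinity> | enat t \<Rightarrow> enat t + tau u (pshift t X) m"])
    fix s :: enat
    show "(\<lambda>X :: nat \<Rightarrow> int^'d. case s of \<infinity> \<Rightarrow> \<infinity> | enat t \<Rightarrow> enat t + tau u (pshift t X) m)
      \<in> pathM \<rightarrow>\<^sub>M count_space UNIV"
    proof (cases s)
      case (enat t)
      have "(\<lambda>X :: nat \<Rightarrow> int^'d. tau u (pshift t X) m) \<in> pathM \<rightarrow>\<^sub>M count_space UNIV"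
        by (rule measurable_compose[OF measurable_pshift Suc])
      then have "(\<lambda>X :: nat \<Rightarrow> int^'d. enat t + tau u (pshift t X) m) \<in> pathM \<rightarrow>\<^sub>M count_space UNIV"
        by (rule measurable_compose) simp
      then show ?thesis using enat by simp
    qed simp
  qed
  then show ?case by (simp only: tau_Suc_eq[of u _ m])
qed simp

lemma map_pmf_tl_replicate_pmf: "map_pmf tl (replicate_pmf (Suc n) p) = replicate_pmf n p"
proof -
  have "map_pmf tl (replicate_pmf (Suc n) p) = map_pmf snd (pair_pmf p (replicate_pmf n p))"
    unfolding replicate_pmf_Suc_pair by (simp add: pmf.map_comp o_def split_beta)
  then show ?thesis by (simp add: map_snd_pair_pmf)
qed

locale tilt_fun = rwre_tilt \<mu> Pq c1 u \<theta> + local_fun f K m C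
  for \<mu> :: "(int^'d::finite \<Rightarrow> real) measure" and Pq c1 u \<theta>
    and f :: "(nat \<Rightarrow> int^'d) \<Rightarrow> real" and K m C +
  assumes K_pos: "1 \<le> K"
begin

lemma measurable_f_stepseq [measurable]: "(\<lambda>X. f (stepseq X j)) \<in> borel_measurable pathM"
proof -
  have eq: "(\<lambda>X. f (stepseq X j)) = (\<lambda>X. f (pad (drop j (steps X (j + K)))))"
    using stepseq_local[of j "j + K"] by (simp add: fun_eq_iff)
  show ?thesis unfolding eq by (rule measurable_compose[OF measurable_steps]) simp
qed

text \<open>Dividing by \<open>pD u\<close> turns the integral over \<open>Dinf\<close> into one
  under \<open>PD\<close>, and under \<open>PD\<close> the first \<open>n\<close> blocks are
  independent with law \<open>\<beta>\<close>.\<close>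

lemma condE_blk:
  assumes F: "F \<in> borel_measurable pathM" and eq: "AE X in PD. F X = g (blk u n X)"
  shows "condE P0 u F = (\<integral>bs. g bs \<partial>replicate_pmf n \<beta>)"
proof -
  have FP: "F \<in> borel_measurable P0" using F by (simp add: measurable_cong_sets[OF sets_P0 refl])
  have FD: "F \<in> borel_measurable PD" using F by (simp add: measurable_cong_sets[OF sets_PD refl])
  have gD: "(\<lambda>X. g (blk u n X)) \<in> borel_measurable PD"
    by (rule measurable_compose[of "blk u n" _ "count_space UNIV"]) auto
  have PD_eq: "PD = density P0 (\<lambda>X. ennreal (indicator {X. Dinf u X} X / pD u))"
  proof -
    have "indicator {X. Dinf u X} X / emeasure P0 {X. Dinf u X} = ennreal (indicator {X. Dinf u X} X / pD u)" for X
      using pD_pos by (simp add: emeasure_Dinf indicator_def divide_ennreal[symmetric])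
    then show ?thesis by (simp add: PD_def uniform_measure_def)
  qed
  have "condE P0 u F = (\<integral>X. F X * indicator {X. Dinf u X} X \<partial>P0) / pD u"
    by (simp add: condE_def pD_def)
  also have "\<dots> = (\<integral>X. indicator {X. Dinf u X} X / pD u * F X \<partial>P0)"
    by (simp add: mult.commute flip: integral_divide_zero)
  also have "\<dots> = (\<integral>X. F X \<partial>PD)"
    unfolding PD_eq using FP pD_pos by (subst integral_density) auto
  also have "\<dots> = (\<integral>X. g (blk u n X) \<partial>PD)"
    by (rule integral_cong_AE[OF FD gD eq])
  also have "\<dots> = (\<integral>bs. g bs \<partial>distr PD (count_space UNIV) (blk u n))"
    by (rule integral_distr[symmetric]) auto
  finally show ?thesis unfolding distr_blk .
qed

lemma AE_blk:
  assumes "1 \<le> n"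
  shows "AE X in PD. blk u n X \<in> lists (blocks u) \<and> length (blk u n X) = n \<and> nnpath X \<and>
    tau u X n = enat (length (concat (blk u n X))) \<and> steps X (length (concat (blk u n X))) = concat (blk u n X) \<and>
    tau u X (Suc 0) = enat (length (hd (blk u n X)))"
proof -
  have "AE bs in distr PD (count_space UNIV) (blk u n). length bs = n"
    unfolding distr_blk AE_measure_pmf_iff by (simp add: set_replicate_pmf)
  then have len: "AE X in PD. length (blk u n X) = n"
    by (subst (asm) AE_distr_iff) auto
  show ?thesis
    using len AE_PD
  proof eventually_elim
    case (elim X)
    define bs where "bs = blk u n X"
    have A: "bs \<in> lists (blocks u) \<and> steps X (length (concat bs)) = concat bs \<and> Dinf u (pshift (length (concat bs)) X)"
      using blk_eqD[of X u n bs] elim by (simp add: bs_def)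
    then have B: "tau u X n = enat (length (concat bs))"
      using blk_eqI[of X bs u] elim by (simp add: bs_def)
    obtain t where t: "tau u X (Suc 0) = enat t" using elim by blast
    obtain n' where "n = Suc n'" using assms by (cases n) auto
    then have "hd bs = steps X t" using t by (simp add: bs_def)
    then show ?case using A B t elim unfolding bs_def by simp
  qed
qed

text \<open>The contribution of the first block, including the look-ahead into its successors; by
  \<open>Ysum_take\<close> a list of \<open>K\<close> blocks determines it.\<close>

definition G :: "(int^'d) list list \<Rightarrow> real" where
  "G bs = Ysum f m (hd bs) (concat (tl bs))"

text \<open>The mean tilted block length, which is the denominator of \<open>mu_int\<close>.\<close>

definition mlen :: real where
  "mlen = (\<integral>bs. real (length (concat bs)) \<partial>replicate_pmf 1 \<gamma>)"

lemma mlen_pos: "0 < mlen"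
proof -
  have "1 = (\<integral>bs. (1::real) \<partial>replicate_pmf 1 \<gamma>)" by (simp del: replicate_pmf.simps One_nat_def)
  also have "\<dots> \<le> mlen"
    unfolding mlen_def
  proof (rule integral_mono_AE)
    show "AE bs in replicate_pmf 1 \<gamma>. 1 \<le> real (length (concat bs))"
      using AE_replicate_\<gamma>[of 1]
    proof eventually_elim
      case (elim bs)
      then show ?case using length_concat_blocks[of bs u] by simp
    qed
  qed (simp_all add: integrable_length del: replicate_pmf.simps One_nat_def)
  finally show ?thesis by simp
qed

lemma integrable_hd_length:
  assumes "1 \<le> n"
  shows "integrable (replicate_pmf n \<gamma>) (\<lambda>bs. real (length (hd bs)))"
proof (rule Bochner_Integration.integrable_bound[OF integrable_length[of n]])
  show "AE bs in replicate_pmf n \<gamma>. norm (real (length (hd bs))) \<le> norm (real (length (concat bs)))"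
    using AE_replicate_\<gamma>[of n]
  proof eventually_elim
    case (elim bs)
    then show ?case using assms by (cases bs) auto
  qed
qed simp

lemma integral_hd_length:
  assumes "1 \<le> n"
  shows "(\<integral>bs. real (length (hd bs)) \<partial>replicate_pmf n \<gamma>) = mlen"
proof -
  have "mlen = (\<integral>bs. real (length (concat bs)) \<partial>map_pmf (take 1) (replicate_pmf (1 + (n - 1)) \<gamma>))"
    unfolding mlen_def map_pmf_take_replicate_pmf ..
  also have "\<dots> = (\<integral>bs. real (length (concat (take 1 bs))) \<partial>replicate_pmf n \<gamma>)"
    using assms by simp
  also have "\<dots> = (\<integral>bs. real (length (hd bs)) \<partial>replicate_pmf n \<gamma>)"
  proof (rule integral_cong_AE)
    show "AE bs in replicate_pmf n \<gamma>. real (length (concat (take 1 bs))) = real (length (hd bs))"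
      using AE_replicate_\<gamma>[of n]
    proof eventually_elim
      case (elim bs)
      then show ?case using assms by (cases bs) auto
    qed
  qed auto
  finally show ?thesis ..
qed

lemma G_bound: "\<bar>G bs\<bar> \<le> C * real (length (hd bs))"
  unfolding G_def by (rule Ysum_bound)

lemma integrable_G:
  assumes "1 \<le> n"
  shows "integrable (replicate_pmf n \<gamma>) G"
proof (rule Bochner_Integration.integrable_bound[of _ "\<lambda>bs. C * real (length (hd bs))"])
  show "integrable (replicate_pmf n \<gamma>) (\<lambda>bs. C * real (length (hd bs)))"
    using integrable_hd_length[OF assms] by simp
qed (use G_bound C_nonneg in \<open>auto simp: abs_mult\<close>)

text \<open>The weight at \<open>tau_K\<close> in \<open>mu_int\<close> is the density of
  \<open>K\<close> tilted blocks against \<open>K\<close> untilted ones, so both expectations become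
  means under \<open>\<gamma>\<close>. The numerator uses \<open>K\<close> blocks because the
  positions in the first one look that far ahead.\<close>

lemma integral_G: "(\<integral>bs. G bs \<partial>replicate_pmf K \<gamma>) = (mu_int P0 u \<theta> K f - m) * mlen"
proof -
  define F1 where "F1 = (\<lambda>X. case tau u X (Suc 0) of \<infinity> \<Rightarrow> 0
    | enat t1 \<Rightarrow> (case tau u X K of \<infinity> \<Rightarrow> 0
        | enat tK \<Rightarrow> (\<Sum>j<t1. f (stepseq X j)) * exp (\<theta> \<bullet> rv (X tK) - \<Lambda> * real tK)))"
  define F2 where "F2 = (\<lambda>X. case tau u X (Suc 0) of \<infinity> \<Rightarrow> 0
    | enat t1 \<Rightarrow> real t1 * exp (\<theta> \<bullet> rv (X t1) - \<Lambda> * real t1))"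
  have mexp: "(\<lambda>X. exp (\<theta> \<bullet> rv (X t) - \<Lambda> * real t)) \<in> borel_measurable pathM" for t
    by simp
  have m1: "F1 \<in> borel_measurable pathM"
    unfolding F1_def
  proof (rule measurable_compose_countable[OF _ measurable_tau_1, where
      f = "\<lambda>s X. case s of \<infinity> \<Rightarrow> 0 | enat t1 \<Rightarrow> (case tau u X K of \<infinity> \<Rightarrow> 0
        | enat tK \<Rightarrow> (\<Sum>j<t1. f (stepseq X j)) * exp (\<theta> \<bullet> rv (X tK) - \<Lambda> * real tK))"])
    fix s :: enat
    show "(\<lambda>X. case s of \<infinity> \<Rightarrow> 0 | enat t1 \<Rightarrow> (case tau u X K of \<infinity> \<Rightarrow> 0
        | enat tK \<Rightarrow> (\<Sum>j<t1. f (stepseq X j)) * exp (\<theta> \<bullet> rv (X tK) - \<Lambda> * real tK))) \<in> borel_measurable pathM"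
    proof (cases s)
      case (enat t1)
      have "(\<lambda>X. case tau u X K of \<infinity> \<Rightarrow> 0
        | enat tK \<Rightarrow> (\<Sum>j<t1. f (stepseq X j)) * exp (\<theta> \<bullet> rv (X tK) - \<Lambda> * real tK)) \<in> borel_measurable pathM"
      proof (rule measurable_compose_countable[OF _ measurable_tau, where
          f = "\<lambda>s X. case s of \<infinity> \<Rightarrow> 0
            | enat tK \<Rightarrow> (\<Sum>j<t1. f (stepseq X j)) * exp (\<theta> \<bullet> rv (X tK) - \<Lambda> * real tK)"])
        fix s :: enat
        show "(\<lambda>X. case s of \<infinity> \<Rightarrow> 0
            | enat tK \<Rightarrow> (\<Sum>j<t1. f (stepseq X j)) * exp (\<theta> \<bullet> rv (X tK) - \<Lambda> * real tK)) \<in> borel_measurable pathM"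
          using mexp by (cases s) auto
      qed
      then show ?thesis using enat by simp
    qed simp
  qed
  have m2: "F2 \<in> borel_measurable pathM"
    unfolding F2_def
  proof (rule measurable_compose_countable[OF _ measurable_tau_1, where
      f = "\<lambda>s X. case s of \<infinity> \<Rightarrow> 0 | enat t1 \<Rightarrow> real t1 * exp (\<theta> \<bullet> rv (X t1) - \<Lambda> * real t1)"])
    fix s :: enat
    show "(\<lambda>X. case s of \<infinity> \<Rightarrow> 0 | enat t1 \<Rightarrow> real t1 * exp (\<theta> \<bullet> rv (X t1) - \<Lambda> * real t1)) \<in> borel_measurable pathM"
      using mexp by (cases s) auto
  qed
  have c1: "condE P0 u F1 = (\<integral>bs. ew \<theta> \<Lambda> (concat bs) * (G bs + m * real (length (hd bs))) \<partial>replicate_pmf K \<beta>)"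
  proof (rule condE_blk[OF m1], use AE_blk[OF K_pos] in eventually_elim)
    case (elim X)
    define bs where "bs = blk u K X"
    define n where "n = length (concat bs)"
    have bs: "bs \<in> lists (blocks u)" "length bs = K" "tau u X K = enat n" "steps X n = concat bs"
      "tau u X (Suc 0) = enat (length (hd bs))" "X 0 = 0"
      using elim unfolding bs_def n_def nnpath_def by auto
    have ne: "bs \<noteq> []" using bs(2) K_pos by auto
    then have split: "concat bs = hd bs @ concat (tl bs)" by (cases bs) auto
    have "tl bs \<in> lists (blocks u)" using bs(1) ne by (cases bs) auto
    \<comment> \<open>The remaining \<open>K - 1\<close> blocks are nonempty, so every position of
      the first block has \<open>K\<close> steps ahead of it before \<open>tau_K\<close>.\<close>
    then have "K - 1 \<le> length (concat (tl bs))"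
      using length_concat_blocks[of "tl bs" u] bs(2) by simp
    moreover have "n = length (hd bs) + length (concat (tl bs))"
      unfolding n_def by (subst split) simp
    ultimately have "f (stepseq X j) = f (pad (drop j (hd bs) @ concat (tl bs)))" if "j < length (hd bs)" for j
    proof -
      assume len: "K - 1 \<le> length (concat (tl bs))" "n = length (hd bs) + length (concat (tl bs))"
      have "j + K \<le> n" using len that by linarith
      then have "f (stepseq X j) = f (pad (drop j (hd bs @ concat (tl bs))))"
        unfolding split[symmetric] bs(4)[symmetric] by (rule stepseq_local)
      then show ?thesis using that by simp
    qed
    then have "(\<Sum>j<length (hd bs). f (stepseq X j)) = G bs + m * real (length (hd bs))"
      by (simp add: G_def Ysum_def sum_subtractf mult.commute)
    moreover have "exp (\<theta> \<bullet> rv (X n) - \<Lambda> * real n) = ew \<theta> \<Lambda> (concat bs)"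
      using sum_list_steps[of X n, OF bs(6)] unfolding bs(4) by (simp add: ew_def n_def)
    ultimately show ?case
      unfolding F1_def bs_def[symmetric] bs(3,5) enat.case by (simp only: mult.commute)
  qed
  have c2: "condE P0 u F2 = (\<integral>bs. ew \<theta> \<Lambda> (concat bs) * real (length (concat bs)) \<partial>replicate_pmf 1 \<beta>)"
  proof (rule condE_blk[OF m2], use AE_blk[OF order_refl] in eventually_elim)
    case (elim X)
    define bs where "bs = blk u 1 X"
    define n where "n = length (concat bs)"
    have bs: "length bs = 1" "steps X n = concat bs" "tau u X (Suc 0) = enat (length (hd bs))" "X 0 = 0"
      using elim unfolding bs_def n_def nnpath_def by auto
    have "hd bs = concat bs" using bs(1) by (cases bs) auto
    moreover have "exp (\<theta> \<bullet> rv (X n) - \<Lambda> * real n) = ew \<theta> \<Lambda> (concat bs)"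
      using sum_list_steps[of X n, OF bs(4)] unfolding bs(2) by (simp add: ew_def n_def)
    ultimately show ?case
      unfolding F2_def bs_def[symmetric] bs(3) enat.case n_def by (simp only: mult.commute)
  qed
  have "mu_int P0 u \<theta> K f = condE P0 u F1 / condE P0 u F2"
    by (simp only: mu_int_def F1_def F2_def One_nat_def)
  also have "condE P0 u F2 = mlen" unfolding c2 mlen_def integral_replicate_\<gamma> ..
  also have "condE P0 u F1 = (\<integral>bs. G bs + m * real (length (hd bs)) \<partial>replicate_pmf K \<gamma>)"
    unfolding c1 integral_replicate_\<gamma> ..
  also have "\<dots> = (\<integral>bs. G bs \<partial>replicate_pmf K \<gamma>) + m * mlen"
    using integrable_G[OF K_pos] integrable_hd_length[OF K_pos] integral_hd_length[OF K_pos] by simp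
  finally show ?thesis using mlen_pos by (simp add: field_simps)
qed

lemma SL_concat: "bs \<noteq> [] \<Longrightarrow> SL f m (concat bs) = G bs + SL f m (concat (tl bs))"
  by (cases bs) (simp_all add: G_def SL_append)

lemma integrable_SL: "integrable (replicate_pmf n \<gamma>) (\<lambda>bs. SL f m (concat bs))"
proof (rule Bochner_Integration.integrable_bound[of _ "\<lambda>bs. C * real (length (concat bs))"])
  show "integrable (replicate_pmf n \<gamma>) (\<lambda>bs. C * real (length (concat bs)))"
    using integrable_length by simp
qed (use SL_bound C_nonneg in \<open>auto simp: abs_mult\<close>)

text \<open>A block put in front adds the mean of \<open>G\<close>, which no longer depends on the
  number of blocks once there are \<open>K\<close> of them, and leaves the law of the others
  unchanged.\<close>

lemma integral_SL_Suc:
  assumes "K \<le> Suc n"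
  shows "(\<integral>bs. SL f m (concat bs) \<partial>replicate_pmf (Suc n) \<gamma>) =
    (mu_int P0 u \<theta> K f - m) * mlen + (\<integral>bs. SL f m (concat bs) \<partial>replicate_pmf n \<gamma>)"
proof -
  have tl: "(\<integral>bs. SL f m (concat (tl bs)) \<partial>replicate_pmf (Suc n) \<gamma>) = (\<integral>bs. SL f m (concat bs) \<partial>replicate_pmf n \<gamma>)"
    unfolding map_pmf_tl_replicate_pmf[of n \<gamma>, symmetric] by (simp only: integral_map_pmf)
  have itl: "integrable (replicate_pmf (Suc n) \<gamma>) (\<lambda>bs. SL f m (concat (tl bs)))"
    using integrable_SL[of n] unfolding map_pmf_tl_replicate_pmf[of n \<gamma>, symmetric] by (simp only: integrable_map_pmf_eq)
  have GK: "(\<integral>bs. G bs \<partial>replicate_pmf (Suc n) \<gamma>) = (\<integral>bs. G bs \<partial>replicate_pmf K \<gamma>)"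
  proof -
    have "(\<integral>bs. G bs \<partial>replicate_pmf K \<gamma>) = (\<integral>bs. G bs \<partial>map_pmf (take K) (replicate_pmf (K + (Suc n - K)) \<gamma>))"
      unfolding map_pmf_take_replicate_pmf ..
    also have "\<dots> = (\<integral>bs. G (take K bs) \<partial>replicate_pmf (Suc n) \<gamma>)"
      using assms by (simp only: integral_map_pmf le_add_diff_inverse)
    also have "\<dots> = (\<integral>bs. G bs \<partial>replicate_pmf (Suc n) \<gamma>)"
    proof (rule integral_cong_AE)
      show "AE bs in replicate_pmf (Suc n) \<gamma>. G (take K bs) = G bs"
        using AE_replicate_\<gamma>[of "Suc n"]
      proof eventually_elim
        case (elim bs)
        then obtain b bs' where bs: "bs = b # bs'" by (cases bs) auto
        obtain k where k: "K = Suc k" using K_pos by (cases K) auto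
        have "Ysum f m b (concat bs') = Ysum f m b (concat (take (K - 1) bs'))"
          using elim bs assms by (intro Ysum_take[where u = u]) auto
        then show ?case by (simp add: G_def bs k)
      qed
    qed auto
    finally show ?thesis ..
  qed
  have "(\<integral>bs. SL f m (concat bs) \<partial>replicate_pmf (Suc n) \<gamma>) =
      (\<integral>bs. G bs + SL f m (concat (tl bs)) \<partial>replicate_pmf (Suc n) \<gamma>)"
  proof (rule integral_cong_AE)
    show "AE bs in replicate_pmf (Suc n) \<gamma>. SL f m (concat bs) = G bs + SL f m (concat (tl bs))"
      using AE_replicate_\<gamma>[of "Suc n"]
    proof eventually_elim
      case (elim bs)
      then have "bs \<noteq> []" by auto
      then show ?case by (rule SL_concat)
    qed
  qed auto
  also have "\<dots> = (\<integral>bs. G bs \<partial>replicate_pmf (Suc n) \<gamma>) + (\<integral>bs. SL f m (concat (tl bs)) \<partial>replicate_pmf (Suc n) \<gamma>)"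
    by (rule Bochner_Integration.integral_add[OF integrable_G itl]) simp
  finally show ?thesis unfolding GK tl integral_G .
qed

subsection \<open>Exponential tail of the empirical average\<close>

text \<open>From \<open>K\<close> blocks on, the mean of \<open>SL\<close> falls linearly in the
  number of blocks. A long enough run therefore outweighs the fixed cost 2 * C * K of a cut, which a
  single block need not do.\<close>

lemma negative_superblock:
  assumes "mu_int P0 u \<theta> K f < m"
  shows "\<exists>L\<ge>1. (\<integral>bs. SL f m (concat bs) + 2 * C * real K \<partial>replicate_pmf L \<gamma>) < 0"
proof -
  define e where "e n = (\<integral>bs. SL f m (concat bs) \<partial>replicate_pmf n \<gamma>)" for n
  define y where "y = (m - mu_int P0 u \<theta> K f) * mlen"
  have y: "0 < y" using assms mlen_pos by (simp add: y_def)
  have e: "e (K + q) = e K - real q * y" for q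
  proof (induction q)
    case (Suc q)
    then show ?case using integral_SL_Suc[of "K + q"] by (simp add: e_def y_def algebra_simps)
  qed simp
  obtain q :: nat where "(e K + 2 * C * real K) / y < real q" using reals_Archimedean2 by blast
  then have "e (K + q) + 2 * C * real K < 0" using y by (simp add: e divide_less_eq algebra_simps)
  moreover have "(\<integral>bs. SL f m (concat bs) + 2 * C * real K \<partial>replicate_pmf (K + q) \<gamma>) = e (K + q) + 2 * C * real K"
    using integrable_SL[of "K + q"] by (simp add: e_def)
  ultimately show ?thesis using K_pos by (intro exI[of _ "K + q"]) auto
qed

text \<open>\<open>exp_moment_le_1\<close> for a run of \<open>L\<close> blocks with the cost of one
  cut included. The bound on \<open>s * C\<close> keeps exp (s * SL) below exp (\<eta> * length),
  where moments are finite.\<close>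

lemma contraction:
  assumes "mu_int P0 u \<theta> K f < m"
  shows "\<exists>L\<ge>1. \<exists>s>0. s * C \<le> \<eta> \<and>
    (\<integral>\<^sup>+bs. ennreal (exp (s * (SL f m (concat bs) + 2 * C * real K))) \<partial>replicate_pmf L \<gamma>) \<le> 1"
proof -
  obtain L where L: "1 \<le> L" "(\<integral>bs. SL f m (concat bs) + 2 * C * real K \<partial>replicate_pmf L \<gamma>) < 0"
    using negative_superblock[OF assms] by blast
  \<comment> \<open>The \<open>+ 1\<close> avoids a division by zero for
    \<open>C = 0\<close>.\<close>
  define \<eta>' where "\<eta>' = \<eta> / (C + 1)"
  have \<eta>': "0 < \<eta>'" "\<eta>' * C \<le> \<eta>"
    using \<eta>(1) C_nonneg by (auto simp: \<eta>'_def field_simps)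
  have "integrable (replicate_pmf L \<gamma>) (\<lambda>bs. exp (\<eta>' * \<bar>SL f m (concat bs) + 2 * C * real K\<bar>))"
  proof (rule Bochner_Integration.integrable_bound)
    show "integrable (replicate_pmf L \<gamma>) (\<lambda>bs. exp (\<eta>' * (2 * C * real K)) * exp (\<eta>' * C * real (length (concat bs))))"
      using integrable_exp_length[OF \<eta>'(2), of L] by simp
    show "AE bs in replicate_pmf L \<gamma>. norm (exp (\<eta>' * \<bar>SL f m (concat bs) + 2 * C * real K\<bar>)) \<le>
        norm (exp (\<eta>' * (2 * C * real K)) * exp (\<eta>' * C * real (length (concat bs))))"
    proof (rule AE_I2)
      fix bs :: "(int^'d) list list"
      have "0 \<le> 2 * C * real K" using C_nonneg by simp
      then have "\<bar>SL f m (concat bs) + 2 * C * real K\<bar> \<le> 2 * C * real K + C * real (length (concat bs))"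
        using SL_bound[of "concat bs"] by linarith
      then have "\<eta>' * \<bar>SL f m (concat bs) + 2 * C * real K\<bar> \<le> \<eta>' * (2 * C * real K + C * real (length (concat bs)))"
        using \<eta>'(1) by (intro mult_left_mono) auto
      also have "\<dots> = \<eta>' * (2 * C * real K) + \<eta>' * C * real (length (concat bs))"
        by (simp only: distrib_left mult.assoc)
      finally show "norm (exp (\<eta>' * \<bar>SL f m (concat bs) + 2 * C * real K\<bar>)) \<le>
        norm (exp (\<eta>' * (2 * C * real K)) * exp (\<eta>' * C * real (length (concat bs))))"
        by (simp add: abs_mult flip: exp_add)
    qed
  qed simp
  from exp_moment_le_1[OF \<eta>'(1) this L(2)] obtain s0 where s0: "s0 > 0"
    "\<And>s. 0 < s \<Longrightarrow> s \<le> s0 \<Longrightarrow>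
      (\<integral>\<^sup>+bs. ennreal (exp (s * (SL f m (concat bs) + 2 * C * real K))) \<partial>replicate_pmf L \<gamma>) \<le> 1"
    by blast
  define s where "s = min s0 \<eta>'"
  have "0 < s" using s0 \<eta>' by (simp add: s_def)
  moreover have "s * C \<le> \<eta>"
    using mult_right_mono[of s \<eta>' C] C_nonneg \<eta>'(2) by (simp add: s_def)
  moreover have "(\<integral>\<^sup>+bs. ennreal (exp (s * (SL f m (concat bs) + 2 * C * real K))) \<partial>replicate_pmf L \<gamma>) \<le> 1"
    using \<open>0 < s\<close> by (intro s0(2)) (auto simp: s_def)
  ultimately show ?thesis using L(1) by blast
qed

text \<open>Splitting off \<open>L\<close> blocks at a time costs a factor at most 1, so only the
  finitely many lists with fewer than \<open>L\<close> blocks matter for the size of the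
  moment.\<close>

lemma block_sum_moment_bounded:
  assumes "1 \<le> L" "0 < s" "s * C \<le> \<eta>"
    and contr: "(\<integral>\<^sup>+bs. ennreal (exp (s * (SL f m (concat bs) + 2 * C * real K))) \<partial>replicate_pmf L \<gamma>) \<le> 1"
  shows "\<exists>D<\<infinity>. \<forall>M. (\<integral>\<^sup>+bs. ennreal (exp (s * SL f m (concat bs))) \<partial>replicate_pmf M \<gamma>) \<le> D"
proof -
  define Q where "Q M = (\<integral>\<^sup>+bs. ennreal (exp (s * SL f m (concat bs))) \<partial>replicate_pmf M \<gamma>)" for M
  have step: "Q (L + M) \<le> Q M" for M
  proof -
    have "Q (L + M) = (\<integral>\<^sup>+xs. (\<integral>\<^sup>+ys. ennreal (exp (s * SL f m (concat xs @ concat ys))) \<partial>replicate_pmf M \<gamma>) \<partial>replicate_pmf L \<gamma>)"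
      unfolding Q_def replicate_pmf_distrib by simp
    also have "\<dots> \<le> (\<integral>\<^sup>+xs. (\<integral>\<^sup>+ys. ennreal (exp (s * (SL f m (concat xs) + 2 * C * real K))) *
        ennreal (exp (s * SL f m (concat ys))) \<partial>replicate_pmf M \<gamma>) \<partial>replicate_pmf L \<gamma>)"
    proof (intro nn_integral_mono)
      fix xs ys :: "(int^'d) list list"
      have "s * SL f m (concat xs @ concat ys) \<le> s * ((SL f m (concat xs) + 2 * C * real K) + SL f m (concat ys))"
        using SL_append_le[of "concat xs" "concat ys"] assms(2) by (intro mult_left_mono) auto
      then show "ennreal (exp (s * SL f m (concat xs @ concat ys))) \<le>
         ennreal (exp (s * (SL f m (concat xs) + 2 * C * real K))) * ennreal (exp (s * SL f m (concat ys)))"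
        by (simp add: distrib_left ennreal_leI flip: ennreal_mult exp_add)
    qed
    also have "\<dots> = (\<integral>\<^sup>+xs. ennreal (exp (s * (SL f m (concat xs) + 2 * C * real K))) \<partial>replicate_pmf L \<gamma>) * Q M"
      by (simp add: Q_def nn_integral_cmult nn_integral_multc)
    also have "\<dots> \<le> 1 * Q M" by (intro mult_right_mono contr) auto
    finally show ?thesis by simp
  qed
  have fin: "Q M < \<infinity>" for M
  proof -
    have "Q M \<le> (\<integral>\<^sup>+bs. ennreal (exp (\<eta> * real (length (concat bs)))) \<partial>replicate_pmf M \<gamma>)"
      unfolding Q_def
    proof (intro nn_integral_mono ennreal_leI)
      fix bs :: "(int^'d) list list"
      have "s * SL f m (concat bs) \<le> s * (C * real (length (concat bs)))"
        using SL_bound[of "concat bs"] assms(2) by (intro mult_left_mono) auto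
      also have "\<dots> = (s * C) * real (length (concat bs))" by simp
      also have "\<dots> \<le> \<eta> * real (length (concat bs))" using assms(3) by (intro mult_right_mono) auto
      finally show "exp (s * SL f m (concat bs)) \<le> exp (\<eta> * real (length (concat bs)))" by simp
    qed
    also have "\<dots> < \<infinity>"
      unfolding exp_length_replicate_\<gamma> using Phi_finite[OF \<eta>(2)] by (simp add: power_less_top_ennreal)
    finally show ?thesis .
  qed
  have red: "Q (q * L + r) \<le> Q r" for q r
  proof (induction q)
    case (Suc q)
    have "Q (L + (q * L + r)) \<le> Q (q * L + r)" by (rule step)
    with Suc show ?case by (simp add: add.assoc)
  qed simp
  have "Q M \<le> (\<Sum>r<L. Q r)" for M
  proof -
    have "Q M = Q ((M div L) * L + M mod L)" by simp
    also have "\<dots> \<le> Q (M mod L)" by (rule red)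
    also have "\<dots> \<le> (\<Sum>r<L. Q r)" using assms(1) by (intro member_le_sum) auto
    finally show ?thesis .
  qed
  moreover have "(\<Sum>r<L. Q r) < \<infinity>" using fin by simp
  ultimately show ?thesis unfolding Q_def by blast
qed

text \<open>\<open>decomposition_bound\<close> with two rates: on the first block and the unfinished
  stretch the sum of \<open>f - m\<close> is estimated by \<open>C\<close> times the length and
  absorbed by passing to \<Lambda> - \<eta>, while the complete blocks keep the rate \<Lambda> and
  have bounded moments.\<close>

lemma tilted_moment_bound:
  assumes "mu_int P0 u \<theta> K f < m"
  shows "\<exists>s>0. \<exists>c>0. \<forall>n. (\<integral>\<^sup>+X. ennreal (ew \<theta> \<Lambda> (steps X n) * exp (s * SL f m (steps X n))) \<partial>P0) \<le> ennreal (c * real (Suc n))"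
proof -
  obtain L s where Ls: "1 \<le> L" "0 < s" "s * C \<le> \<eta>"
    "(\<integral>\<^sup>+bs. ennreal (exp (s * (SL f m (concat bs) + 2 * C * real K))) \<partial>replicate_pmf L \<gamma>) \<le> 1"
    using contraction[OF assms] by blast
  obtain D where D: "D < \<infinity>"
    "\<And>M. (\<integral>\<^sup>+bs. ennreal (exp (s * SL f m (concat bs))) \<partial>replicate_pmf M \<gamma>) \<le> D"
    using block_sum_moment_bounded[OF Ls] by blast
  define r where "r = \<Lambda> - \<eta>"
  \<comment> \<open>The word is cut twice, each time at the cost 2 * C * K.\<close>
  define c where "c = ennreal (exp (s * (4 * C * real K)))"
  define F where "F w = ennreal (ew \<theta> \<Lambda> w * exp (s * SL f m w))" for w
  define \<psi> where "\<psi> bs = ennreal (ew \<theta> \<Lambda> (concat bs)) * ennreal (exp (s * SL f m (concat bs)))" for bs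
  have ewr: "ew \<theta> \<Lambda> w * exp (s * SL f m w) \<le> ew \<theta> r w" for w
  proof -
    have "s * SL f m w \<le> s * (C * real (length w))"
      using SL_bound[of w] Ls(2) by (intro mult_left_mono) auto
    also have "\<dots> \<le> \<eta> * real (length w)" using Ls(3) by (simp add: mult_right_mono mult.assoc[symmetric])
    finally show ?thesis by (simp add: ew_def r_def algebra_simps flip: exp_add)
  qed
  have "(\<integral>\<^sup>+X. F (steps X n) \<partial>P0) * ennreal (pD u) \<le>
    c * AA \<theta> r * ennreal (pD u) + c * AA \<theta> r * AA \<theta> r * (\<Sum>M\<le>n. \<integral>\<^sup>+bs. \<psi> bs \<partial>replicate_pmf M \<beta>)" for n
  proof (rule decomposition_bound)
    fix w :: "(int^'d) list"
    have "1 * ennreal (ew \<theta> r w) \<le> c * ennreal (ew \<theta> r w)"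
      unfolding c_def using Ls(2) C_nonneg by (intro mult_right_mono) auto
    then show "F w \<le> c * ennreal (ew \<theta> r w)"
      unfolding F_def mult_1 by (rule order_trans[OF ennreal_leI[OF ewr[of w]]])
  next
    fix b v :: "(int^'d) list" and bs :: "(int^'d) list list"
    let ?w = "concat bs"
    have "SL f m (b @ ?w @ v) \<le> SL f m b + SL f m ?w + SL f m v + 4 * C * real K"
      using SL_append_le[of b "?w @ v"] SL_append_le[of ?w v] by linarith
    then have "s * SL f m (b @ ?w @ v) \<le> s * (SL f m b + SL f m ?w + SL f m v + 4 * C * real K)"
      using Ls(2) by (intro mult_left_mono) auto
    then have "exp (s * SL f m (b @ ?w @ v)) \<le>
      exp (s * (4 * C * real K)) * (exp (s * SL f m b) * exp (s * SL f m ?w) * exp (s * SL f m v))"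
      by (simp add: algebra_simps flip: exp_add)
    then have "ew \<theta> \<Lambda> (b @ ?w @ v) * exp (s * SL f m (b @ ?w @ v)) \<le>
      (ew \<theta> \<Lambda> b * ew \<theta> \<Lambda> ?w * ew \<theta> \<Lambda> v) *
      (exp (s * (4 * C * real K)) * (exp (s * SL f m b) * exp (s * SL f m ?w) * exp (s * SL f m v)))"
      by (simp add: ew_append mult.assoc)
    also have "\<dots> = exp (s * (4 * C * real K)) * ((ew \<theta> \<Lambda> b * exp (s * SL f m b)) *
       (ew \<theta> \<Lambda> ?w * exp (s * SL f m ?w)) * (ew \<theta> \<Lambda> v * exp (s * SL f m v)))"
      by (simp only: mult_ac)
    also have "\<dots> \<le> exp (s * (4 * C * real K)) * (ew \<theta> r b * (ew \<theta> \<Lambda> ?w * exp (s * SL f m ?w)) * ew \<theta> r v)"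
      by (intro mult_left_mono mult_mono ewr order_refl) auto
    finally have "F (b @ ?w @ v) \<le> ennreal (exp (s * (4 * C * real K)) *
        (ew \<theta> r b * (ew \<theta> \<Lambda> ?w * exp (s * SL f m ?w)) * ew \<theta> r v))"
      unfolding F_def by (rule ennreal_leI)
    also have "\<dots> = c * (ennreal (ew \<theta> r b) * \<psi> bs * ennreal (ew \<theta> r v))"
      by (simp add: c_def \<psi>_def ennreal_mult)
    finally show "F (b @ concat bs @ v) \<le> c * (ennreal (ew \<theta> r b) * \<psi> bs * ennreal (ew \<theta> r v))" .
  qed
  note dec = this
  have \<psi>D: "(\<integral>\<^sup>+bs. \<psi> bs \<partial>replicate_pmf M \<beta>) \<le> D" for M
    using D(2)[of M] unfolding nn_integral_replicate_\<gamma> \<psi>_def .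
  define B where "B = c * AA \<theta> r * ennreal (pD u) + c * AA \<theta> r * AA \<theta> r * D"
  have Bfin: "B < \<infinity>"
    using \<eta>(2) D(1) by (simp add: B_def c_def r_def ennreal_mult_less_top)
  then obtain b where b: "0 \<le> b" "B = ennreal b" by (cases B) auto
  have "(\<integral>\<^sup>+X. F (steps X n) \<partial>P0) \<le> ennreal (((b + 1) / pD u) * real (Suc n))" for n
  proof -
    have "(\<integral>\<^sup>+X. F (steps X n) \<partial>P0) * ennreal (pD u) \<le>
      c * AA \<theta> r * ennreal (pD u) + c * AA \<theta> r * AA \<theta> r * (\<Sum>M\<le>n. \<integral>\<^sup>+bs. \<psi> bs \<partial>replicate_pmf M \<beta>)"
      by (rule dec)
    also have "\<dots> \<le> c * AA \<theta> r * ennreal (pD u) * of_nat (Suc n) + c * AA \<theta> r * AA \<theta> r * (D * of_nat (Suc n))"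
    proof (intro add_mono mult_left_mono)
      have "c * AA \<theta> r * ennreal (pD u) * 1 \<le> c * AA \<theta> r * ennreal (pD u) * of_nat (Suc n)"
        by (intro mult_left_mono) auto
      then show "c * AA \<theta> r * ennreal (pD u) \<le> c * AA \<theta> r * ennreal (pD u) * of_nat (Suc n)" by simp
      have "(\<Sum>M\<le>n. \<integral>\<^sup>+bs. \<psi> bs \<partial>replicate_pmf M \<beta>) \<le> (\<Sum>M\<le>n. D)" by (intro sum_mono \<psi>D)
      then show "(\<Sum>M\<le>n. \<integral>\<^sup>+bs. \<psi> bs \<partial>replicate_pmf M \<beta>) \<le> D * of_nat (Suc n)" by (simp add: mult.commute)
    qed auto
    also have "\<dots> = B * of_nat (Suc n)" by (simp only: B_def distrib_right mult.assoc)
    also have "\<dots> = ennreal (b * real (Suc n))"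
      unfolding b(2) ennreal_of_nat_eq_real_of_nat using b(1) by (subst ennreal_mult) auto
    finally have "(\<integral>\<^sup>+X. F (steps X n) \<partial>P0) * ennreal (pD u) * ennreal (1 / pD u) \<le> ennreal (b * real (Suc n)) * ennreal (1 / pD u)"
      by (rule mult_right_mono) simp
    moreover have "ennreal (pD u) * ennreal (1 / pD u) = 1"
      using pD_pos by (simp flip: ennreal_mult)
    moreover have "ennreal (b * real (Suc n)) * ennreal (1 / pD u) = ennreal (b / pD u * real (Suc n))"
      using b(1) pD_pos by (subst ennreal_mult[symmetric]) auto
    ultimately have "(\<integral>\<^sup>+X. F (steps X n) \<partial>P0) \<le> ennreal (b / pD u * real (Suc n))"
      by (simp only: mult.assoc mult_1_right)
    also have "\<dots> \<le> ennreal (((b + 1) / pD u) * real (Suc n))"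
      using pD_pos by (intro ennreal_leI mult_right_mono divide_right_mono) auto
    finally show ?thesis .
  qed
  moreover have "0 < (b + 1) / pD u" using b(1) pD_pos by simp
  ultimately show ?thesis using Ls(2) unfolding F_def by blast
qed

lemma upper_tail:
  assumes "mu_int P0 u \<theta> K f < m" "0 < \<epsilon>"
  shows "\<exists>\<kappa>>0. \<exists>c>0. \<forall>n\<ge>1. (\<integral>\<^sup>+X. indicator {X. m + \<epsilon> < nu_int n f X} X * ennreal (ew \<theta> \<Lambda> (steps X n)) \<partial>P0)
    \<le> ennreal (c * real (Suc n) * exp (- \<kappa> * real n))"
proof -
  obtain s c where sc: "0 < s" "0 < c"
    "\<And>n. (\<integral>\<^sup>+X. ennreal (ew \<theta> \<Lambda> (steps X n) * exp (s * SL f m (steps X n))) \<partial>P0) \<le> ennreal (c * real (Suc n))"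
    using tilted_moment_bound[OF assms(1)] by blast
  \<comment> \<open>The reciprocal of the Chebyshev threshold exp (s * \<epsilon> * n), corrected
    for the last \<open>K\<close> positions, where the padded sum and the sum along the trajectory
    may differ.\<close>
  define h where "h n = exp (s * (2 * C * real K)) * exp (- (s * \<epsilon>) * real n)" for n :: nat
  have "(\<integral>\<^sup>+X. indicator {X. m + \<epsilon> < nu_int n f X} X * ennreal (ew \<theta> \<Lambda> (steps X n)) \<partial>P0)
    \<le> ennreal (exp (s * (2 * C * real K)) * c * real (Suc n) * exp (- (s * \<epsilon>) * real n))" if n: "1 \<le> n" for n
  proof -
    have meas: "(\<lambda>X. ennreal (ew \<theta> \<Lambda> (steps X n) * exp (s * SL f m (steps X n)))) \<in> borel_measurable P0"
      by (rule measurable_compose[of "\<lambda>X. steps X n" _ "count_space UNIV"]) auto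
    have "(\<integral>\<^sup>+X. indicator {X. m + \<epsilon> < nu_int n f X} X * ennreal (ew \<theta> \<Lambda> (steps X n)) \<partial>P0) \<le>
      (\<integral>\<^sup>+X. ennreal (h n) * ennreal (ew \<theta> \<Lambda> (steps X n) * exp (s * SL f m (steps X n))) \<partial>P0)"
    proof (rule nn_integral_mono)
      fix X
      show "indicator {X. m + \<epsilon> < nu_int n f X} X * ennreal (ew \<theta> \<Lambda> (steps X n)) \<le>
        ennreal (h n) * ennreal (ew \<theta> \<Lambda> (steps X n) * exp (s * SL f m (steps X n)))"
      proof (cases "m + \<epsilon> < nu_int n f X")
        case True
        then have "(m + \<epsilon>) * real n \<le> (\<Sum>j<n. f (stepseq X j))"
          using n by (simp add: nu_int_def pos_less_divide_eq)
        then have "\<epsilon> * real n \<le> (\<Sum>j<n. f (stepseq X j) - m)"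
          by (simp add: sum_subtractf algebra_simps)
        then have "\<epsilon> * real n \<le> SL f m (steps X n) + 2 * C * real K"
          using SL_steps[where X = X and n = n] by linarith
        then have "s * (\<epsilon> * real n) \<le> s * (SL f m (steps X n) + 2 * C * real K)"
          using sc(1) by (intro mult_left_mono) auto
        then have "1 \<le> h n * exp (s * SL f m (steps X n))"
          by (simp add: h_def algebra_simps flip: exp_add)
        then have "1 * ew \<theta> \<Lambda> (steps X n) \<le> h n * exp (s * SL f m (steps X n)) * ew \<theta> \<Lambda> (steps X n)"
          by (intro mult_right_mono) auto
        then have "ennreal (ew \<theta> \<Lambda> (steps X n)) \<le> ennreal (h n * (ew \<theta> \<Lambda> (steps X n) * exp (s * SL f m (steps X n))))"
          by (intro ennreal_leI) (simp add: mult_ac)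
        also have "\<dots> = ennreal (h n) * ennreal (ew \<theta> \<Lambda> (steps X n) * exp (s * SL f m (steps X n)))"
          by (rule ennreal_mult) (auto simp: h_def)
        finally show ?thesis using True by simp
      qed simp
    qed
    also have "\<dots> = ennreal (h n) * (\<integral>\<^sup>+X. ennreal (ew \<theta> \<Lambda> (steps X n) * exp (s * SL f m (steps X n))) \<partial>P0)"
      by (rule nn_integral_cmult[OF meas])
    also have "\<dots> \<le> ennreal (h n) * ennreal (c * real (Suc n))"
      by (intro mult_left_mono sc(3)) auto
    also have "\<dots> = ennreal (h n * (c * real (Suc n)))"
      using sc(2) by (intro ennreal_mult[symmetric]) (auto simp: h_def)
    also have "h n * (c * real (Suc n)) = exp (s * (2 * C * real K)) * c * real (Suc n) * exp (- (s * \<epsilon>) * real n)"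
      by (simp only: h_def mult_ac)
    finally show ?thesis .
  qed
  moreover have "0 < s * \<epsilon>" "0 < exp (s * (2 * C * real K)) * c" using sc assms(2) by auto
  ultimately show ?thesis by blast
qed

end

subsection \<open>Lower bound for the conditioning event\<close>

context rwre
begin

lemma prob_X: "measure P0 {X. S (X n)} = (\<Sum>w\<in>{w\<in>paths n. S (sum_list w)}. W w)"
proof -
  have [measurable]: "Measurable.pred pathM (\<lambda>X :: nat \<Rightarrow> int^'d. S (X n))"
    by (rule measurable_compose[OF measurable_coord]) simp
  have "measure P0 {X\<in>space P0. S (X n)} = measure P0 {X\<in>space P0. S (sum_list (steps X n))}"
  proof (rule P.finite_measure_eq_AE)
    show "AE X in P0. X \<in> {X\<in>space P0. S (X n)} \<longleftrightarrow> X \<in> {X\<in>space P0. S (sum_list (steps X n))}"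
      using AE_nnpath by eventually_elim (simp add: nnpath_def sum_list_steps)
  qed measurable
  then show ?thesis using prob_steps[of "\<lambda>w. S (sum_list w)" n] by simp
qed

text \<open>In the total weight \<open>Zn \<theta> n\<close>, the words whose endpoint over
  \<open>n\<close> is farther than \<open>\<delta>\<close> from \<open>\<xi>\<close> are negligible:
  a slightly different tilt \<theta> + h would give them more weight than the differentiability of
  \<open>\<Lambda>\<close> permits. The remaining words carry nearly all of \<open>Zn\<close>, and
  on them the tilt is almost constant, so it can be removed.\<close>

lemma lower_bound:
  assumes lim: "\<And>\<theta>'. norm (\<theta>' - \<theta>) < \<rho> \<Longrightarrow> (\<lambda>n. ln (Zn \<theta>' n) / real n) \<longlonglongrightarrow> \<Lambda> \<theta>'"
    and \<rho>: "0 < \<rho>" and der: "(\<Lambda> has_derivative (\<lambda>h. \<xi> \<bullet> h)) (at \<theta>)"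
    and \<delta>: "0 < \<delta>" and \<kappa>: "0 < \<kappa>"
  shows "eventually (\<lambda>n. exp (- real n * (\<theta> \<bullet> \<xi> - \<Lambda> \<theta> + norm \<theta> * \<delta> + \<kappa>)) \<le>
    measure P0 {X. norm ((1 / real n) *\<^sub>R rv (X n) - \<xi> :: real^'d) \<le> \<delta>}) sequentially"
proof -
  define d where "d = real CARD('d)"
  have d: "0 < d" by (simp add: d_def)
  \<comment> \<open>The Euclidean norm is at most the sum of the moduli of the coordinates, so
    outside the ball of radius \<open>\<delta>\<close> some coordinate exceeds \<delta> / d.\<close>
  define \<alpha> where "\<alpha> = \<delta> / d"
  have \<alpha>: "0 < \<alpha>" using \<delta> d by (simp add: \<alpha>_def)
  obtain \<rho>' where \<rho>': "\<rho>' > 0"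
    "\<And>h. norm h < \<rho>' \<Longrightarrow> norm (\<Lambda> (\<theta> + h) - \<Lambda> \<theta> - \<xi> \<bullet> h) \<le> \<alpha> / 4 * norm h"
  proof -
    have "\<forall>e>0. \<exists>r>0. \<forall>y. norm (y - \<theta>) < r \<longrightarrow> norm (\<Lambda> y - \<Lambda> \<theta> - \<xi> \<bullet> (y - \<theta>)) \<le> e * norm (y - \<theta>)"
      using der by (simp add: has_derivative_at_alt)
    then obtain r where r: "r > 0"
      "\<And>y. norm (y - \<theta>) < r \<Longrightarrow> norm (\<Lambda> y - \<Lambda> \<theta> - \<xi> \<bullet> (y - \<theta>)) \<le> \<alpha> / 4 * norm (y - \<theta>)"
      using \<alpha> by (meson divide_pos_pos zero_less_numeral)
    show thesis by (rule that[OF r(1)]) (use r(2)[of "\<theta> + _"] in simp)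
  qed
  define t where "t = min \<rho> \<rho>' / 2"
  have t: "0 < t" "t < \<rho>" "t < \<rho>'" using \<rho> \<rho>'(1) by (auto simp: t_def)
  \<comment> \<open>Both signs of each axis: finitely many tilts detect every deviation.\<close>
  define H :: "(real^'d) set" where "H = (\<lambda>i. axis i t) ` UNIV \<union> (\<lambda>i. axis i (- t)) ` UNIV"
  have finH: "finite H" by (simp add: H_def)
  have neH: "H \<noteq> {}" by (simp add: H_def)
  have normH: "norm h = t" if "h \<in> H" for h
    using that t by (auto simp: H_def norm_eq_sqrt_inner inner_axis_axis)
  \<comment> \<open>The bad words weigh about exp (n * (\<Lambda> - t * \<alpha> / 2)), at most exp
    (n * (\<Lambda> - 2 * \<kappa>0)), against a total of at least exp (n * (\<Lambda> -
    \<kappa>0)). The loss 2 * \<kappa>0 has to stay within \<open>\<kappa>\<close>.\<close>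
  define \<kappa>0 where "\<kappa>0 = min (\<kappa> / 2) (t * \<alpha> / 4)"
  have \<kappa>0: "0 < \<kappa>0" "2 * \<kappa>0 \<le> \<kappa>" "4 * \<kappa>0 \<le> t * \<alpha>" using \<kappa> t \<alpha> by (auto simp: \<kappa>0_def)
  have ZH: "eventually (\<lambda>n. \<forall>h\<in>H. ln (Zn (\<theta> + h) n) / real n < \<Lambda> \<theta> + \<xi> \<bullet> h + t * \<alpha> / 2) sequentially"
  proof (rule eventually_ball_finite[OF finH], rule ballI)
    fix h assume h: "h \<in> H"
    have "(\<lambda>n. ln (Zn (\<theta> + h) n) / real n) \<longlonglongrightarrow> \<Lambda> (\<theta> + h)"
      using normH[OF h] t by (intro lim) simp
    moreover have "norm (\<Lambda> (\<theta> + h) - \<Lambda> \<theta> - \<xi> \<bullet> h) \<le> \<alpha> / 4 * norm h"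
      using normH[OF h] t by (intro \<rho>'(2)) simp
    then have "\<Lambda> (\<theta> + h) < \<Lambda> \<theta> + \<xi> \<bullet> h + t * \<alpha> / 2"
      unfolding normH[OF h] real_norm_def using mult_pos_pos[OF t(1) \<alpha>] mult.commute[of t \<alpha>] by linarith
    ultimately show "eventually (\<lambda>n. ln (Zn (\<theta> + h) n) / real n < \<Lambda> \<theta> + \<xi> \<bullet> h + t * \<alpha> / 2) sequentially"
      by (rule order_tendstoD)
  qed
  have Z0: "eventually (\<lambda>n. \<Lambda> \<theta> - \<kappa>0 < ln (Zn \<theta> n) / real n) sequentially"
    using lim[of \<theta>] \<rho> \<kappa>0(1) by (intro order_tendstoD) auto
  have dec: "eventually (\<lambda>n. real (card H) * exp (- \<kappa>0 * real n) < 1 / 2) sequentially"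
  proof -
    have "(\<lambda>n. real (card H) * exp (- \<kappa>0 * real n)) \<longlonglongrightarrow> 0" using \<kappa>0(1) by real_asymp
    then show ?thesis by (rule order_tendstoD) simp
  qed
  show ?thesis
    using ZH Z0 dec eventually_gt_at_top[of 0]
  proof eventually_elim
    case (elim n)
    have n: "0 < real n" using elim by simp
    define Gd where "Gd = {w\<in>paths n. norm ((1 / real n) *\<^sub>R rv (sum_list w) - \<xi> :: real^'d) \<le> \<delta>}"
    define T where "T w = W w * exp (\<theta> \<bullet> rv (sum_list w))" for w
    have T0: "0 \<le> T w" for w by (simp add: T_def)
    have sub: "Gd \<subseteq> paths n" by (auto simp: Gd_def)
    have split: "Zn \<theta> n = (\<Sum>w\<in>Gd. T w) + (\<Sum>w\<in>paths n - Gd. T w)"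
      unfolding Zn_eq T_def[symmetric] using sum.subset_diff[OF sub finite_paths, of T] by simp
    have bad: "(\<Sum>w\<in>paths n - Gd. T w) \<le> real (card H) * exp (real n * (\<Lambda> \<theta> - 2 * \<kappa>0))"
    proof -
      have "(\<Sum>w\<in>paths n - Gd. T w) \<le> (\<Sum>w\<in>paths n - Gd. \<Sum>h\<in>H. T w * exp (h \<bullet> rv (sum_list w) - real n * (\<xi> \<bullet> h + t * \<alpha>)))"
      proof (rule sum_mono)
        fix w assume w: "w \<in> paths n - Gd"
        define v :: "real^'d" where "v = (1 / real n) *\<^sub>R rv (sum_list w) - \<xi>"
        have "\<exists>i. \<alpha> < \<bar>v $ i\<bar>"
        proof (rule ccontr)
          assume "\<not> ?thesis"
          then have "(\<Sum>i\<in>UNIV. \<bar>v $ i\<bar>) \<le> (\<Sum>i\<in>(UNIV :: 'd set). \<alpha>)" by (intro sum_mono) (auto simp: not_less)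
          also have "\<dots> = \<delta>" using d by (simp add: \<alpha>_def d_def)
          finally have "norm v \<le> \<delta>" using norm_le_l1_cart[of v] by linarith
          then show False using w by (simp add: Gd_def v_def)
        qed
        then obtain i where i: "\<alpha> < \<bar>v $ i\<bar>" by blast
        define h :: "real^'d" where "h = axis i (if 0 \<le> v $ i then t else - t)"
        have h: "h \<in> H" by (simp add: h_def H_def)
        have hv: "h \<bullet> v = t * \<bar>v $ i\<bar>" by (simp add: h_def inner_axis' abs_if)
        have "t * \<alpha> \<le> h \<bullet> v" unfolding hv using i t by (intro mult_left_mono) auto
        then have "real n * (t * \<alpha>) \<le> real n * (h \<bullet> v)" using n by (intro mult_left_mono) auto
        also have "real n * (h \<bullet> v) = h \<bullet> rv (sum_list w) - real n * (\<xi> \<bullet> h)"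
          using n by (simp add: v_def inner_diff_right right_diff_distrib inner_commute)
        finally have "0 \<le> h \<bullet> rv (sum_list w) - real n * (\<xi> \<bullet> h + t * \<alpha>)" by (simp add: distrib_left)
        then have "T w * 1 \<le> T w * exp (h \<bullet> rv (sum_list w) - real n * (\<xi> \<bullet> h + t * \<alpha>))"
          by (intro mult_left_mono T0) simp
        also have "\<dots> \<le> (\<Sum>h\<in>H. T w * exp (h \<bullet> rv (sum_list w) - real n * (\<xi> \<bullet> h + t * \<alpha>)))"
          using h T0 by (intro member_le_sum finH mult_nonneg_nonneg) auto
        finally show "T w \<le> (\<Sum>h\<in>H. T w * exp (h \<bullet> rv (sum_list w) - real n * (\<xi> \<bullet> h + t * \<alpha>)))" by simp
      qed
      also have "\<dots> \<le> (\<Sum>w\<in>paths n. \<Sum>h\<in>H. T w * exp (h \<bullet> rv (sum_list w) - real n * (\<xi> \<bullet> h + t * \<alpha>)))"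
        using T0 by (intro sum_mono2 finite_paths sum_nonneg mult_nonneg_nonneg) auto
      also have "\<dots> = (\<Sum>h\<in>H. \<Sum>w\<in>paths n. T w * exp (h \<bullet> rv (sum_list w) - real n * (\<xi> \<bullet> h + t * \<alpha>)))"
        by (rule sum.swap)
      also have "\<dots> = (\<Sum>h\<in>H. Zn (\<theta> + h) n * exp (- (real n * (\<xi> \<bullet> h + t * \<alpha>))))"
        unfolding Zn_eq sum_distrib_right T_def
        by (intro sum.cong refl) (simp add: inner_add_left exp_add exp_diff exp_minus divide_inverse mult.assoc)
      also have "\<dots> \<le> (\<Sum>h\<in>H. exp (real n * (\<Lambda> \<theta> - 2 * \<kappa>0)))"
      proof (rule sum_mono)
        fix h assume h: "h \<in> H"
        have "ln (Zn (\<theta> + h) n) \<le> real n * (\<Lambda> \<theta> + \<xi> \<bullet> h + t * \<alpha> / 2)"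
          using elim(1) h n by (auto simp: divide_less_eq mult.commute less_imp_le)
        then have "Zn (\<theta> + h) n \<le> exp (real n * (\<Lambda> \<theta> + \<xi> \<bullet> h + t * \<alpha> / 2))"
          using Zn_pos[of "\<theta> + h" n] by (simp add: ln_le_cancel_iff[symmetric])
        then have "Zn (\<theta> + h) n * exp (- (real n * (\<xi> \<bullet> h + t * \<alpha>))) \<le>
            exp (real n * (\<Lambda> \<theta> + \<xi> \<bullet> h + t * \<alpha> / 2)) * exp (- (real n * (\<xi> \<bullet> h + t * \<alpha>)))"
          by (intro mult_right_mono) auto
        also have "\<dots> = exp (real n * (\<Lambda> \<theta> - t * \<alpha> / 2))" by (simp add: algebra_simps flip: exp_add)
        also have "\<dots> \<le> exp (real n * (\<Lambda> \<theta> - 2 * \<kappa>0))"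
          using \<kappa>0(3) n by (subst exp_le_cancel_iff) (intro mult_left_mono, auto)
        finally show "Zn (\<theta> + h) n * exp (- (real n * (\<xi> \<bullet> h + t * \<alpha>))) \<le> exp (real n * (\<Lambda> \<theta> - 2 * \<kappa>0))" .
      qed
      finally show ?thesis by simp
    qed
    have half: "real (card H) * exp (real n * (\<Lambda> \<theta> - 2 * \<kappa>0)) \<le> 1 / 2 * exp (real n * (\<Lambda> \<theta> - \<kappa>0))"
    proof -
      have "exp (real n * (\<Lambda> \<theta> - 2 * \<kappa>0)) = exp (- \<kappa>0 * real n) * exp (real n * (\<Lambda> \<theta> - \<kappa>0))"
        by (simp add: algebra_simps flip: exp_add)
      then have "real (card H) * exp (real n * (\<Lambda> \<theta> - 2 * \<kappa>0)) =
          real (card H) * exp (- \<kappa>0 * real n) * exp (real n * (\<Lambda> \<theta> - \<kappa>0))" by simp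
      also have "\<dots> \<le> 1 / 2 * exp (real n * (\<Lambda> \<theta> - \<kappa>0))"
        using elim(3) by (intro mult_right_mono) auto
      finally show ?thesis .
    qed
    have total: "exp (real n * (\<Lambda> \<theta> - \<kappa>0)) \<le> Zn \<theta> n"
    proof -
      have "real n * (\<Lambda> \<theta> - \<kappa>0) \<le> ln (Zn \<theta> n)" using elim(2) n by (simp add: less_divide_eq mult.commute)
      then show ?thesis using Zn_pos[of \<theta> n] by (simp add: ln_ge_iff)
    qed
    \<comment> \<open>At least half of the lower bound for the total survives the removal of the bad
      words, and this half is itself at least card H times exp (n * (\<Lambda> - 2 *
      \<kappa>0)).\<close>
    have "1 \<le> real (card H)" using finH neH by (simp add: Suc_le_eq card_gt_0_iff)
    then have "1 * exp (real n * (\<Lambda> \<theta> - 2 * \<kappa>0)) \<le> real (card H) * exp (real n * (\<Lambda> \<theta> - 2 * \<kappa>0))"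
      by (intro mult_right_mono) auto
    then have G1: "exp (real n * (\<Lambda> \<theta> - 2 * \<kappa>0)) \<le> (\<Sum>w\<in>Gd. T w)"
      using split bad half total by linarith
    have "(\<Sum>w\<in>Gd. T w) \<le> (\<Sum>w\<in>Gd. W w * exp (real n * (\<theta> \<bullet> \<xi> + norm \<theta> * \<delta>)))"
      unfolding T_def
    proof (intro sum_mono mult_left_mono)
      fix w assume w: "w \<in> Gd"
      define v :: "real^'d" where "v = (1 / real n) *\<^sub>R rv (sum_list w) - \<xi>"
      have "\<theta> \<bullet> v \<le> norm \<theta> * norm v" by (rule norm_cauchy_schwarz)
      also have "\<dots> \<le> norm \<theta> * \<delta>" using w by (intro mult_left_mono) (auto simp: Gd_def v_def)
      finally have "real n * (\<theta> \<bullet> v) \<le> real n * (norm \<theta> * \<delta>)" using n by (intro mult_left_mono) auto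
      moreover have "real n * (\<theta> \<bullet> v) = \<theta> \<bullet> rv (sum_list w) - real n * (\<theta> \<bullet> \<xi>)"
        using n by (simp add: v_def inner_diff_right right_diff_distrib)
      ultimately show "exp (\<theta> \<bullet> rv (sum_list w)) \<le> exp (real n * (\<theta> \<bullet> \<xi> + norm \<theta> * \<delta>))"
        by (simp add: distrib_left)
    qed simp
    then have "exp (real n * (\<Lambda> \<theta> - 2 * \<kappa>0)) \<le> (\<Sum>w\<in>Gd. W w) * exp (real n * (\<theta> \<bullet> \<xi> + norm \<theta> * \<delta>))"
      using G1 by (simp add: sum_distrib_right)
    then have "exp (real n * (\<Lambda> \<theta> - 2 * \<kappa>0)) * exp (- (real n * (\<theta> \<bullet> \<xi> + norm \<theta> * \<delta>))) \<le>
       (\<Sum>w\<in>Gd. W w) * exp (real n * (\<theta> \<bullet> \<xi> + norm \<theta> * \<delta>)) * exp (- (real n * (\<theta> \<bullet> \<xi> + norm \<theta> * \<delta>)))"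
      by (intro mult_right_mono) auto
    then have "exp (real n * (\<Lambda> \<theta> - 2 * \<kappa>0) - real n * (\<theta> \<bullet> \<xi> + norm \<theta> * \<delta>)) \<le> (\<Sum>w\<in>Gd. W w)"
      by (simp add: mult.assoc exp_diff exp_minus divide_inverse)
    moreover have "- real n * (\<theta> \<bullet> \<xi> - \<Lambda> \<theta> + norm \<theta> * \<delta> + \<kappa>) \<le> real n * (\<Lambda> \<theta> - 2 * \<kappa>0) - real n * (\<theta> \<bullet> \<xi> + norm \<theta> * \<delta>)"
      using mult_left_mono[OF \<kappa>0(2), of "real n"] by (simp add: algebra_simps)
    moreover have "(\<Sum>w\<in>Gd. W w) = measure P0 {X. norm ((1 / real n) *\<^sub>R rv (X n) - \<xi> :: real^'d) \<le> \<delta>}"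
      unfolding Gd_def by (rule prob_X[of "\<lambda>x. norm ((1 / real n) *\<^sub>R rv x - \<xi> :: real^'d) \<le> \<delta>" n, symmetric])
    ultimately show ?case by (smt (verit) exp_le_cancel_iff)
  qed
qed

end

subsection \<open>The conditional large deviation estimate\<close>

lemma nu_int_uminus: "nu_int n (\<lambda>w. - f w) X = - nu_int n f X"
  by (simp add: nu_int_def sum_negf)

lemma mu_int_uminus: "mu_int P u \<theta> K (\<lambda>w. - f w) = - mu_int P u \<theta> K f"
proof -
  have "(\<lambda>X. case tau u X 1 of \<infinity> \<Rightarrow> 0 | enat t1 \<Rightarrow> (case tau u X K of \<infinity> \<Rightarrow> 0
      | enat tK \<Rightarrow> (\<Sum>j<t1. - f (stepseq X j)) * exp (\<theta> \<bullet> rv (X tK) - Lambda_a P \<theta> * real tK))) =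
    (\<lambda>X. - (case tau u X 1 of \<infinity> \<Rightarrow> 0 | enat t1 \<Rightarrow> (case tau u X K of \<infinity> \<Rightarrow> 0
      | enat tK \<Rightarrow> (\<Sum>j<t1. f (stepseq X j)) * exp (\<theta> \<bullet> rv (X tK) - Lambda_a P \<theta> * real tK))))"
    by (auto simp: fun_eq_iff sum_negf split: enat.split)
  then show ?thesis by (simp add: mu_int_def condE_def)
qed

context rwre_tilt
begin

lemma one_sided_tail:
  assumes K: "1 \<le> K" and bdd: "bounded (range f)" and loc: "\<forall>w w'. (\<forall>i<K. w i = w' i) \<longrightarrow> f w = f w'"
    and \<epsilon>: "0 < \<epsilon>"
  shows "(\<forall>n. {X. mu_int P0 u \<theta> K f + \<epsilon> < nu_int n f X} \<in> sets pathM) \<and>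
    (\<exists>\<kappa>>0. \<exists>c>0. \<forall>n\<ge>1. (\<integral>\<^sup>+X. indicator {X. mu_int P0 u \<theta> K f + \<epsilon> < nu_int n f X} X * ennreal (ew \<theta> \<Lambda> (steps X n)) \<partial>P0)
      \<le> ennreal (c * real (Suc n) * exp (- \<kappa> * real n)))"
proof -
  \<comment> \<open>Half of \<open>\<epsilon>\<close> puts \<open>m\<close> strictly above the mean,
    which \<open>upper_tail\<close> requires; the other half is its deviation.\<close>
  define m where "m = mu_int P0 u \<theta> K f + \<epsilon> / 2"
  obtain B where B: "\<And>w. \<bar>f w\<bar> \<le> B" using bdd by (auto simp: bounded_iff)
  interpret tilt_fun \<mu> Pq c1 u \<theta> f K m "B + \<bar>m\<bar>"
  proof unfold_locales
    show "f w = f w'" if "\<And>i. i < K \<Longrightarrow> w i = w' i" for w w' using loc that by simp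
    show "\<bar>f w - m\<bar> \<le> B + \<bar>m\<bar>" for w using B[of w] by linarith
  qed (rule K)
  have eq: "m + \<epsilon> / 2 = mu_int P0 u \<theta> K f + \<epsilon>" by (simp add: m_def)
  have "{X. mu_int P0 u \<theta> K f + \<epsilon> < nu_int n f X} \<in> sets pathM" for n
  proof -
    have "{X \<in> space pathM. mu_int P0 u \<theta> K f + \<epsilon> < nu_int n f X} \<in> sets pathM"
      unfolding nu_int_def by measurable
    then show ?thesis by simp
  qed
  moreover have "\<exists>\<kappa>>0. \<exists>c>0. \<forall>n\<ge>1. (\<integral>\<^sup>+X. indicator {X. m + \<epsilon> / 2 < nu_int n f X} X * ennreal (ew \<theta> \<Lambda> (steps X n)) \<partial>P0)
      \<le> ennreal (c * real (Suc n) * exp (- \<kappa> * real n))"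
    by (rule upper_tail) (use \<epsilon> in \<open>auto simp: m_def\<close>)
  ultimately show ?thesis unfolding eq by blast
qed

text \<open>Where the endpoint over \<open>n\<close> is \<open>\<delta>\<close>-close to
  \<open>\<xi>\<close>, the tilted weight is almost constant, so bounds on the weighted integral
  become bounds on the probability. The two signs of the deviation are the one-sided estimate for
  \<open>f\<close> and for its negative.\<close>

lemma joint_upper:
  assumes K: "1 \<le> K" and bdd: "bounded (range f)" and loc: "\<forall>w w'. (\<forall>i<K. w i = w' i) \<longrightarrow> f w = f w'"
    and \<epsilon>: "0 < \<epsilon>"
  shows "\<exists>\<kappa>>0. \<exists>c>0. \<forall>n\<ge>1. \<forall>\<delta>. measure P0 ({X. \<bar>nu_int n f X - mu_int P0 u \<theta> K f\<bar> > \<epsilon>} \<inter>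
      {X. norm ((1 / real n) *\<^sub>R rv (X n) - \<xi>) \<le> \<delta>})
    \<le> c * real (Suc n) * exp (- \<kappa> * real n) * exp (- real n * (\<theta> \<bullet> \<xi> - norm \<theta> * \<delta> - \<Lambda>))"
proof -
  define A1 where "A1 n = {X. mu_int P0 u \<theta> K f + \<epsilon> < nu_int n f X}" for n
  define A2 where "A2 n = {X. mu_int P0 u \<theta> K (\<lambda>w. - f w) + \<epsilon> < nu_int n (\<lambda>w. - f w) X}" for n
  have bdd': "bounded (range (\<lambda>w. - f w))" using bdd by (simp add: bounded_iff)
  have loc': "\<forall>w w'. (\<forall>i<K. w i = w' i) \<longrightarrow> - f w = - f w'"
  proof (intro allI impI)
    fix w w' :: "nat \<Rightarrow> int^'d" assume "\<forall>i<K. w i = w' i"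
    then have "f w = f w'" using loc by simp
    then show "- f w = - f w'" by simp
  qed
  obtain \<kappa>1 k1 where 1: "0 < \<kappa>1" "0 < k1"
    "\<And>n. n \<ge> 1 \<Longrightarrow> (\<integral>\<^sup>+X. indicator (A1 n) X * ennreal (ew \<theta> \<Lambda> (steps X n)) \<partial>P0) \<le> ennreal (k1 * real (Suc n) * exp (- \<kappa>1 * real n))"
    and m1: "\<And>n. A1 n \<in> sets pathM"
    using one_sided_tail[OF K bdd loc \<epsilon>] unfolding A1_def by blast
  obtain \<kappa>2 k2 where 2: "0 < \<kappa>2" "0 < k2"
    "\<And>n. n \<ge> 1 \<Longrightarrow> (\<integral>\<^sup>+X. indicator (A2 n) X * ennreal (ew \<theta> \<Lambda> (steps X n)) \<partial>P0) \<le> ennreal (k2 * real (Suc n) * exp (- \<kappa>2 * real n))"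
    and m2: "\<And>n. A2 n \<in> sets pathM"
    using one_sided_tail[OF K bdd' loc' \<epsilon>] unfolding A2_def by blast
  define \<kappa> where "\<kappa> = min \<kappa>1 \<kappa>2"
  have \<kappa>: "0 < \<kappa>" "\<kappa> \<le> \<kappa>1" "\<kappa> \<le> \<kappa>2" using 1 2 by (auto simp: \<kappa>_def)
  have "measure P0 ({X. \<bar>nu_int n f X - mu_int P0 u \<theta> K f\<bar> > \<epsilon>} \<inter> {X. norm ((1 / real n) *\<^sub>R rv (X n) - \<xi>) \<le> \<delta>})
    \<le> (k1 + k2) * real (Suc n) * exp (- \<kappa> * real n) * exp (- real n * (\<theta> \<bullet> \<xi> - norm \<theta> * \<delta> - \<Lambda>))"
    if n: "n \<ge> 1" for n \<delta>
  proof -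
    define Bd where "Bd = {X. norm ((1 / real n) *\<^sub>R rv (X n) - \<xi>) \<le> \<delta>}"
    define E where "E = {X. \<bar>nu_int n f X - mu_int P0 u \<theta> K f\<bar> > \<epsilon>} \<inter> Bd"
    \<comment> \<open>The reciprocal of the least tilted weight that a path in \<open>Bd\<close> can
      have.\<close>
    define a where "a = exp (- real n * (\<theta> \<bullet> \<xi> - norm \<theta> * \<delta> - \<Lambda>))"
    define w where "w X = ennreal (ew \<theta> \<Lambda> (steps X n))" for X
    have wm [measurable]: "w \<in> borel_measurable pathM"
      unfolding w_def by (rule measurable_compose[OF measurable_steps]) simp
    note [measurable] = m1 m2
    have Bdm: "Bd \<in> sets pathM"
    proof -
      have [measurable]: "Measurable.pred pathM (\<lambda>X :: nat \<Rightarrow> int^'d. norm ((1 / real n) *\<^sub>R rv (X n) - \<xi>) \<le> \<delta>)"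
        by (rule measurable_compose[OF measurable_coord]) simp
      have "{X \<in> space pathM. norm ((1 / real n) *\<^sub>R rv (X n) - \<xi>) \<le> \<delta>} \<in> sets pathM" by measurable
      then show ?thesis by (simp add: Bd_def)
    qed
    have E_eq: "E = (A1 n \<union> A2 n) \<inter> Bd"
      by (auto simp: E_def A1_def A2_def nu_int_uminus mu_int_uminus)
    have Em: "E \<in> sets P0" unfolding E_eq using m1 m2 Bdm by auto
    have "emeasure P0 E = (\<integral>\<^sup>+X. indicator E X \<partial>P0)" using Em by simp
    also have "\<dots> \<le> (\<integral>\<^sup>+X. ennreal a * (indicator (A1 n) X * w X + indicator (A2 n) X * w X) \<partial>P0)"
    proof (rule nn_integral_mono_AE, use AE_nnpath in eventually_elim)
      case (elim X)
      show ?case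
      proof (cases "X \<in> E")
        case True
        define v where "v = (1 / real n) *\<^sub>R rv (X n) - \<xi>"
        have "\<bar>\<theta> \<bullet> v\<bar> \<le> norm \<theta> * norm v" by (rule Cauchy_Schwarz_ineq2)
        also have "\<dots> \<le> norm \<theta> * \<delta>" using True by (intro mult_left_mono) (auto simp: E_def Bd_def v_def)
        finally have "- (norm \<theta> * \<delta>) \<le> \<theta> \<bullet> v" by linarith
        then have "real n * - (norm \<theta> * \<delta>) \<le> real n * (\<theta> \<bullet> v)" by (intro mult_left_mono) auto
        moreover have "real n * (\<theta> \<bullet> v) = \<theta> \<bullet> rv (X n) - real n * (\<theta> \<bullet> \<xi>)"
          using n by (simp add: v_def inner_diff_right right_diff_distrib)
        ultimately have "0 \<le> - real n * (\<theta> \<bullet> \<xi> - norm \<theta> * \<delta> - \<Lambda>) + (\<theta> \<bullet> rv (X n) - \<Lambda> * real n)"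
          by (simp add: algebra_simps)
        then have "1 \<le> exp (- real n * (\<theta> \<bullet> \<xi> - norm \<theta> * \<delta> - \<Lambda>) + (\<theta> \<bullet> rv (X n) - \<Lambda> * real n))"
          by (simp only: one_le_exp_iff)
        also have "\<dots> = a * ew \<theta> \<Lambda> (steps X n)"
          using elim by (simp only: exp_add a_def ew_def sum_list_steps nnpath_def length_steps)
        finally have "ennreal 1 \<le> ennreal (a * ew \<theta> \<Lambda> (steps X n))" by (rule ennreal_leI)
        then have le: "1 \<le> ennreal a * w X" by (simp add: w_def a_def ennreal_mult)
        have "X \<in> A1 n \<or> X \<in> A2 n" using True by (simp add: E_eq)
        then have "w X \<le> indicator (A1 n) X * w X + indicator (A2 n) X * w X"
          by (auto simp: indicator_def add_increasing add_increasing2)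
        then have "ennreal a * w X \<le> ennreal a * (indicator (A1 n) X * w X + indicator (A2 n) X * w X)"
          by (rule mult_left_mono) simp
        then show ?thesis using le True by (simp add: order_trans)
      qed simp
    qed
    also have "\<dots> = ennreal a * ((\<integral>\<^sup>+X. indicator (A1 n) X * w X \<partial>P0) + (\<integral>\<^sup>+X. indicator (A2 n) X * w X \<partial>P0))"
      by (subst nn_integral_cmult) (auto simp: nn_integral_add)
    also have "\<dots> \<le> ennreal a * (ennreal (k1 * real (Suc n) * exp (- \<kappa>1 * real n)) + ennreal (k2 * real (Suc n) * exp (- \<kappa>2 * real n)))"
      unfolding w_def by (intro mult_left_mono add_mono 1(3) 2(3) n) auto
    also have "\<dots> = ennreal (a * (k1 * real (Suc n) * exp (- \<kappa>1 * real n) + k2 * real (Suc n) * exp (- \<kappa>2 * real n)))"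
      using 1(2) 2(2) by (subst ennreal_plus[symmetric]) (auto simp: a_def ennreal_mult simp del: ennreal_plus)
    also have "\<dots> \<le> ennreal (a * ((k1 + k2) * real (Suc n) * exp (- \<kappa> * real n)))"
    proof (intro ennreal_leI mult_left_mono)
      have "k1 * real (Suc n) * exp (- \<kappa>1 * real n) \<le> k1 * real (Suc n) * exp (- \<kappa> * real n)"
        using 1(2) \<kappa> by (intro mult_left_mono) (auto intro: mult_right_mono)
      moreover have "k2 * real (Suc n) * exp (- \<kappa>2 * real n) \<le> k2 * real (Suc n) * exp (- \<kappa> * real n)"
        using 2(2) \<kappa> by (intro mult_left_mono) (auto intro: mult_right_mono)
      ultimately show "k1 * real (Suc n) * exp (- \<kappa>1 * real n) + k2 * real (Suc n) * exp (- \<kappa>2 * real n) \<le>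
        (k1 + k2) * real (Suc n) * exp (- \<kappa> * real n)" by (simp only: distrib_right)
    qed (simp add: a_def)
    finally have "ennreal (measure P0 E) \<le> ennreal (a * ((k1 + k2) * real (Suc n) * exp (- \<kappa> * real n)))"
      by (simp only: P.emeasure_eq_measure)
    moreover have "0 \<le> a * ((k1 + k2) * real (Suc n) * exp (- \<kappa> * real n))"
      using 1(2) 2(2) by (intro mult_nonneg_nonneg) (auto simp: a_def)
    ultimately have "measure P0 E \<le> a * ((k1 + k2) * real (Suc n) * exp (- \<kappa> * real n))"
      by (simp only: ennreal_le_iff)
    then show ?thesis unfolding E_def Bd_def a_def by (simp only: mult.commute)
  qed
  moreover have "0 < k1 + k2" using 1(2) 2(2) by simp
  ultimately show ?thesis using \<kappa>(1) by blast
qed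

lemma conditional_ldp:
  assumes K: "1 \<le> K" and bdd: "bounded (range f)" and loc: "\<forall>w w'. (\<forall>i<K. w i = w' i) \<longrightarrow> f w = f w'"
    and \<epsilon>: "0 < \<epsilon>"
    and nbhd: "\<And>\<theta>'. norm (\<theta>' - \<theta>) < \<rho> \<Longrightarrow> good \<theta>'" and \<rho>: "0 < \<rho>"
    and der: "(Lambda_a P0 has_derivative (\<lambda>h. \<xi> \<bullet> h)) (at \<theta>)"
  shows "Limsup (at_right (0::real)) (\<lambda>\<delta>. limsup (\<lambda>n.
           eln (condprob P0 {X. \<bar>nu_int n f X - mu_int P0 u \<theta> K f\<bar> > \<epsilon>}
                 {X. norm ((1 / real n) *\<^sub>R rv (X n) - \<xi>) \<le> \<delta>}) / ereal (real n))) < 0"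
proof -
  define A where "A n = {X. \<bar>nu_int n f X - mu_int P0 u \<theta> K f\<bar> > \<epsilon>}" for n
  define B where "B n \<delta> = {X. norm ((1 / real n) *\<^sub>R rv (X n) - \<xi>) \<le> \<delta>}" for n \<delta>
  obtain \<kappa> c where kc: "0 < \<kappa>" "0 < c" and up:
    "\<And>n \<delta>. n \<ge> 1 \<Longrightarrow> measure P0 (A n \<inter> B n \<delta>) \<le>
      c * real (Suc n) * exp (- \<kappa> * real n) * exp (- real n * (\<theta> \<bullet> \<xi> - norm \<theta> * \<delta> - \<Lambda>))"
    using joint_upper[OF K bdd loc \<epsilon>, of \<xi>] unfolding A_def B_def by blast
  have lim: "(\<lambda>n. ln (Zn \<theta>' n) / real n) \<longlonglongrightarrow> Lambda_a P0 \<theta>'" if "norm (\<theta>' - \<theta>) < \<rho>" for \<theta>'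
    using nbhd[OF that] by (simp add: good_def)
  \<comment> \<open>Below this radius 2 * norm \<theta> * \<delta> is at most \<kappa> / 4. Together
    with \<kappa> / 4 from the denominator and \<kappa> / 4 for the linear factor, a decay at rate
    \<kappa> / 4 is left.\<close>
  define \<delta>0 where "\<delta>0 = \<kappa> / (8 * (norm \<theta> + 1))"
  have \<delta>0: "0 < \<delta>0" using kc(1) by (simp add: \<delta>0_def add_nonneg_pos)
  have "limsup (\<lambda>n. eln (condprob P0 (A n) (B n \<delta>)) / ereal (real n)) \<le> ereal (- \<kappa> / 4)"
    if \<delta>: "0 < \<delta>" "\<delta> < \<delta>0" for \<delta>
  proof (rule Limsup_bounded)
    have nd: "2 * (norm \<theta> * \<delta>) \<le> \<kappa> / 4"
    proof -
      have "norm \<theta> * \<delta> \<le> (norm \<theta> + 1) * \<delta>0" using \<delta> by (intro mult_mono) auto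
      also have "\<dots> = \<kappa> / 8"
      proof -
        have "D * (\<kappa> / (8 * D)) = \<kappa> / 8" if "D \<noteq> 0" for D using that by simp
        then show ?thesis unfolding \<delta>0_def using norm_ge_zero[of \<theta>] by (metis add_nonneg_pos less_irrefl zero_less_one)
      qed
      finally show ?thesis by simp
    qed
    have low: "eventually (\<lambda>n. exp (- real n * (\<theta> \<bullet> \<xi> - \<Lambda> + norm \<theta> * \<delta> + \<kappa> / 4)) \<le> measure P0 (B n \<delta>)) sequentially"
      unfolding B_def using lim \<rho> der \<delta>(1) kc(1) by (intro lower_bound[where \<rho> = \<rho>]) auto
    have "(\<lambda>n. ln (c * real (Suc n)) / real n) \<longlonglongrightarrow> 0" using kc(2) by real_asymp
    then have sm: "eventually (\<lambda>n. ln (c * real (Suc n)) / real n < \<kappa> / 4) sequentially"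
      using kc(1) by (intro order_tendstoD) auto
    show "eventually (\<lambda>n. eln (condprob P0 (A n) (B n \<delta>)) / ereal (real n) \<le> ereal (- \<kappa> / 4)) sequentially"
      using low sm eventually_ge_at_top[of 1]
    proof eventually_elim
      case (elim n)
      have n: "0 < real n" using elim by simp
      define p where "p = condprob P0 (A n) (B n \<delta>)"
      \<comment> \<open>So the conditional probability is a genuine quotient and not the default
        value of a division by zero.\<close>
      have pos: "0 < measure P0 (B n \<delta>)" using elim(1) exp_gt_zero less_le_trans by blast
      have "p = measure P0 (A n \<inter> B n \<delta>) / measure P0 (B n \<delta>)" by (simp add: p_def condprob_def)
      also have "\<dots> \<le> (c * real (Suc n) * exp (- \<kappa> * real n) * exp (- real n * (\<theta> \<bullet> \<xi> - norm \<theta> * \<delta> - \<Lambda>))) /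
          exp (- real n * (\<theta> \<bullet> \<xi> - \<Lambda> + norm \<theta> * \<delta> + \<kappa> / 4))"
        using elim up[of n \<delta>] kc(2) by (intro frac_le) auto
      also have "\<dots> = c * real (Suc n) * exp (real n * (2 * (norm \<theta> * \<delta>) + \<kappa> / 4 - \<kappa>))"
      proof -
        have "exp (- \<kappa> * real n) * exp (- real n * (\<theta> \<bullet> \<xi> - norm \<theta> * \<delta> - \<Lambda>)) /
            exp (- real n * (\<theta> \<bullet> \<xi> - \<Lambda> + norm \<theta> * \<delta> + \<kappa> / 4)) =
          exp (real n * (2 * (norm \<theta> * \<delta>) + \<kappa> / 4 - \<kappa>))"
          by (simp add: algebra_simps flip: exp_add exp_diff)
        then show ?thesis by (simp only: mult.assoc times_divide_eq_right[symmetric])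
      qed
      also have "\<dots> \<le> c * real (Suc n) * exp (real n * (- \<kappa> / 2))"
        using kc(2) nd n by (intro mult_left_mono, subst exp_le_cancel_iff) (intro mult_left_mono, auto)
      finally have pb: "p \<le> c * real (Suc n) * exp (real n * (- \<kappa> / 2))" .
      show ?case
      proof (cases "0 < p")
        case True
        have "ln p \<le> ln (c * real (Suc n) * exp (real n * (- \<kappa> / 2)))"
          using True pb by (intro ln_mono) auto
        also have "\<dots> = ln (c * real (Suc n)) + real n * (- \<kappa> / 2)"
          using kc(2) by (subst ln_mult) auto
        finally have "ln p / real n \<le> (ln (c * real (Suc n)) + real n * (- \<kappa> / 2)) / real n"
          using n by (intro divide_right_mono) auto
        also have "\<dots> = ln (c * real (Suc n)) / real n + (- \<kappa> / 2)"
          unfolding add_divide_distrib using n by simp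
        also have "\<dots> \<le> - \<kappa> / 4" using elim(2) by linarith
        finally show ?thesis using True n by (simp add: p_def[symmetric] eln_def)
      next
        \<comment> \<open>Here \<open>eln\<close> takes the value minus infinity, and so does its
          quotient by \<open>n\<close>.\<close>
        case False
        then show ?thesis using n by (simp add: p_def[symmetric] eln_def)
      qed
    qed
  qed
  then have "Limsup (at_right (0::real)) (\<lambda>\<delta>. limsup (\<lambda>n. eln (condprob P0 (A n) (B n \<delta>)) / ereal (real n))) \<le> ereal (- \<kappa> / 4)"
    using \<delta>0 by (intro Limsup_bounded) (auto simp: eventually_at_right_field)
  also have "\<dots> < 0" using kc(1) by simp
  finally show ?thesis unfolding A_def B_def .
qed

end

theorem theorem3p9:
  fixes \<mu> :: "(int^'d::finite \<Rightarrow> real) measure"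
    and Pq :: "(int^'d \<Rightarrow> int^'d \<Rightarrow> real) \<Rightarrow> (nat \<Rightarrow> int^'d) measure"
    and u \<theta> \<xi> :: "real^'d"
    and c1 c3 c4 \<epsilon> :: real
    and K :: nat
    and f :: "(nat \<Rightarrow> int^'d) \<Rightarrow> real"
  assumes mu_prob: "prob_space \<mu>"
    and mu_sets: "sets \<mu> = sets siteM"
    and mu_simplex: "AE p in \<mu>. p \<in> trans_simplex"
    and c1_pos: "0 < c1"
    and elliptic: "AE p in \<mu>. \<forall>z\<in>nnU. c1 \<le> p z"
    and quenched: "is_quenched_law Pq"
    and u_unit: "norm u = 1"
    and kal: "kalikow \<mu> Pq u"
    and c3: "\<not> nestling \<mu> \<longrightarrow> 0 < c3 \<and>
        (\<integral>\<^sup>+X. (case tau u X 1 of enat t \<Rightarrow> ennreal (exp (2 * c3 * real t)) | \<infinity> \<Rightarrow> \<infinity>)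
           \<partial>annealed \<mu> Pq) < \<infinity>"
    and c4: "nestling \<mu> \<longrightarrow> 0 < c4 \<and>
        (\<integral>\<^sup>+X. (SUP n\<in>{n. 1 \<le> n \<and> enat n \<le> tau u X 1}. ennreal (exp (c4 * norm (rv (X n)))))
           \<partial>annealed \<mu> Pq) < \<infinity>"
    and theta_C: "\<theta> \<in> Cset \<mu> (annealed \<mu> Pq) c3 c4"
    and xi_grad: "(Lambda_a (annealed \<mu> Pq) has_derivative (\<lambda>h. \<xi> \<bullet> h)) (at \<theta>)"
    and K_pos: "1 \<le> K"
    and f_bdd: "bounded (range f)"
    and f_local: "\<forall>w w'. (\<forall>i<K. w i = w' i) \<longrightarrow> f w = f w'"
    and eps_pos: "0 < \<epsilon>"
  shows "Limsup (at_right (0::real)) (\<lambda>\<delta>. limsup (\<lambda>n.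
           eln (condprob (annealed \<mu> Pq)
                 {X. \<bar>nu_int n f X - mu_int (annealed \<mu> Pq) u \<theta> K f\<bar> > \<epsilon>}
                 {X. norm ((1 / real n) *\<^sub>R rv (X n) - \<xi>) \<le> \<delta>}) / ereal (real n))) < 0"
proof -
  interpret rwre \<mu> Pq c1
    by (rule rwre.intro) (fact mu_prob mu_sets mu_simplex c1_pos elliptic quenched)+
  have u0: "u \<noteq> 0" using u_unit by auto
  have fin3: "(\<integral>\<^sup>+X. (case tau u X (Suc 0) of enat t \<Rightarrow> ennreal (exp (2 * c3 * real t)) | \<infinity> \<Rightarrow> \<infinity>) \<partial>P0) < \<infinity>"
    if "\<not> nestling \<mu>" using c3[THEN mp, OF that] unfolding One_nat_def by (rule conjunct2)
  have c4_pos: "0 < c4" if "nestling \<mu>" using c4[THEN mp, OF that] by (rule conjunct1)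
  have fin4: "(\<integral>\<^sup>+X. (SUP n\<in>{n. 1 \<le> n \<and> enat n \<le> tau u X (Suc 0)}. ennreal (exp (c4 * norm (rv (X n) :: real^'d)))) \<partial>P0) < \<infinity>"
    if "nestling \<mu>" using c4[THEN mp, OF that] unfolding One_nat_def by (rule conjunct2)
  interpret rwre_dir \<mu> Pq c1 u
  proof unfold_locales
    show "AE X in P0. \<exists>t. regen u X t"
      using AE_regen_nonnestling[OF fin3] AE_regen_nestling[OF c4_pos fin4] by blast
  qed
  have good_C: "good \<theta>'" if "\<theta>' \<in> Cset \<mu> P0 c3 c4" for \<theta>'
    using that good_nonnestling[OF u0 fin3] good_nestling[OF u0 _ fin4]
    by (auto simp: Cset_def split: if_splits)
  interpret rwre_tilt \<mu> Pq c1 u \<theta>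
    by unfold_locales (rule good_C[OF theta_C])
  \<comment> \<open>\<open>lower_bound\<close> compares \<theta> with nearby tilts, where the limits
    must exist as well. In the nestling case the condition on the sign of \<open>Lambda_a\<close>
    persists near \<theta> because differentiability there gives continuity.\<close>
  have "eventually (\<lambda>\<theta>'. \<theta>' \<in> Cset \<mu> P0 c3 c4) (nhds \<theta>)"
  proof (cases "nestling \<mu>")
    case True
    have "isCont (Lambda_a P0) \<theta>" using has_derivative_continuous[OF xi_grad] .
    then have "(Lambda_a P0 \<longlongrightarrow> Lambda_a P0 \<theta>) (nhds \<theta>)" by (simp add: continuous_at tendsto_at_iff_tendsto_nhds)
    then have "eventually (\<lambda>\<theta>'. 0 < Lambda_a P0 \<theta>') (nhds \<theta>)"
      using theta_C True by (intro order_tendstoD) (auto simp: Cset_def)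
    moreover have "eventually (\<lambda>\<theta>'. norm \<theta>' < c4) (nhds \<theta>)"
      using theta_C True by (intro order_tendstoD(2)[OF tendsto_norm[OF filterlim_ident]]) (auto simp: Cset_def)
    ultimately show ?thesis by eventually_elim (simp add: Cset_def True)
  next
    case False
    have "eventually (\<lambda>\<theta>'. norm \<theta>' < c3) (nhds \<theta>)"
      using theta_C False by (intro order_tendstoD(2)[OF tendsto_norm[OF filterlim_ident]]) (auto simp: Cset_def)
    then show ?thesis by eventually_elim (simp add: Cset_def False)
  qed
  then obtain \<rho> where \<rho>: "0 < \<rho>" "\<And>\<theta>'. dist \<theta>' \<theta> < \<rho> \<Longrightarrow> \<theta>' \<in> Cset \<mu> P0 c3 c4"
    unfolding eventually_nhds_metric by blast
  show ?thesis
    by (rule conditional_ldp[OF K_pos f_bdd f_local eps_pos _ \<rho>(1) xi_grad])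
      (rule good_C[OF \<rho>(2)], simp add: dist_norm)
qed

end
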